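(* Let $p \geq 2$ and $d \geq 1$ be integers and let $\delta > 0$. Then for all sufficiently large $n$, $M_{p,d}(n) < \delta n^p$. Moreover, for each $p \geq 2$ there exists a value $D_p$ depending only on $p$ such that $M_{p,2}(n) \leq D_p n^{p-1}$ for all $n$.
   Context: For a finite set $S \subset \mathbb{R}^d$, the Vietoris–Rips complex $R(S)$ is the simplicial complex on vertex set $S$ whose faces are all subsets of $S$ of (Euclidean) diameter at most $1$. For a fixed field $\mathbf{k}$, $\tilde{\beta}_p(\Gamma)=\dim_{\mathbf{k}}\tilde{H}_p(\Gamma;\mathbf{k})$ denotes the $p$-th reduced Betti number. Define $M_{p,d}(n) := \max\{\tilde{\beta}_p(R(S)) : S \subset \mathbb{R}^d,\ |S| \leq n\}$. *)

theory Defs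
  imports "HOL-Analysis.Analysis" "HOL-Library.Function_Algebras"
begin

subsection \<open>Dimension of a quotient of spaces of functions\<close>

definition chain_scale :: "'k::field \<Rightarrow> ('b \<Rightarrow> 'k) \<Rightarrow> 'b \<Rightarrow> 'k" where
  "chain_scale a c = (\<lambda>\<sigma>. a * c \<sigma>)"

interpretation chain: vector_space "chain_scale :: 'k::field \<Rightarrow> ('b \<Rightarrow> 'k) \<Rightarrow> 'b \<Rightarrow> 'k"
  by unfold_locales (auto simp: chain_scale_def fun_eq_iff algebra_simps)

text \<open>For a subspace \<open>W\<close> of \<open>V\<close>: the classes of the elements of \<open>E\<close> are pairwise distinct and
  form a basis of the quotient space \<open>V / W\<close>.\<close>

definition quotient_basis :: "('b \<Rightarrow> 'k::field) set \<Rightarrow> ('b \<Rightarrow> 'k) set \<Rightarrow> ('b \<Rightarrow> 'k) set \<Rightarrow> bool" where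
  "quotient_basis V W E \<longleftrightarrow>
     E \<subseteq> V \<and>
     (\<forall>T u. finite T \<and> T \<subseteq> E \<and> (\<Sum>v\<in>T. chain_scale (u v) v) \<in> W \<longrightarrow> (\<forall>v\<in>T. u v = 0)) \<and>
     (\<forall>x\<in>V. \<exists>T u. finite T \<and> T \<subseteq> E \<and> x - (\<Sum>v\<in>T. chain_scale (u v) v) \<in> W)"

definition quotient_dim :: "('b \<Rightarrow> 'k::field) set \<Rightarrow> ('b \<Rightarrow> 'k) set \<Rightarrow> nat" where
  "quotient_dim V W = card (SOME E. quotient_basis V W E)"

lemma independent_Un_quotient_basis:
  fixes V W :: "('b \<Rightarrow> 'k::field) set"
  assumes W: "chain.subspace W" and A: "A \<subseteq> W" "chain.independent A" and E: "quotient_basis V W E"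
  shows "A \<inter> E = {}" and "chain.independent (A \<union> E)"
proof -
  have ind: "\<And>T u v. finite T \<Longrightarrow> T \<subseteq> E \<Longrightarrow> (\<Sum>v\<in>T. chain_scale (u v) v) \<in> W \<Longrightarrow> v \<in> T \<Longrightarrow> u v = 0"
    using E unfolding quotient_basis_def by blast
  show "A \<inter> E = {}"
  proof (rule ccontr)
    assume "A \<inter> E \<noteq> {}"
    then obtain v where "v \<in> A" "v \<in> E" by blast
    then have "(1::'k) = 0" using ind[of "{v}" "\<lambda>_. 1" v] A by auto
    then show False by simp
  qed
  show "chain.independent (A \<union> E)"
  proof
    assume "chain.dependent (A \<union> E)"
    then obtain t u v where t: "finite t" "t \<subseteq> A \<union> E" "(\<Sum>v\<in>t. chain_scale (u v) v) = 0" "v \<in> t" "u v \<noteq> 0"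
      unfolding chain.dependent_explicit by blast
    have split: "(\<Sum>v\<in>t. chain_scale (u v) v) = (\<Sum>v\<in>t \<inter> E. chain_scale (u v) v) + (\<Sum>v\<in>t - E. chain_scale (u v) v)"
      using t(1) by (rule sum.Int_Diff)
    have tA: "t - E \<subseteq> A" using t(2) by blast
    have "(\<Sum>v\<in>t - E. chain_scale (u v) v) \<in> W"
      using tA A(1) W by (intro chain.subspace_sum chain.subspace_scale) auto
    moreover have "(\<Sum>v\<in>t \<inter> E. chain_scale (u v) v) = - (\<Sum>v\<in>t - E. chain_scale (u v) v)"
      using split t(3) by (simp add: eq_neg_iff_add_eq_0)
    ultimately have "(\<Sum>v\<in>t \<inter> E. chain_scale (u v) v) \<in> W"
      using chain.subspace_neg[OF W] by simp
    then have z: "\<And>w. w \<in> t \<inter> E \<Longrightarrow> u w = 0"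
      using ind[of "t \<inter> E" u] t(1) by blast
    then have "(\<Sum>v\<in>t \<inter> E. chain_scale (u v) v) = 0" by (simp add: sum.neutral)
    then have "(\<Sum>v\<in>t - E. chain_scale (u v) v) = 0" using split t(3) by simp
    then have "\<forall>w\<in>t - E. u w = 0"
      using A(2) tA t(1) unfolding chain.dependent_explicit by (meson finite_Diff)
    with z t(4,5) show False by blast
  qed
qed

lemma quotient_basis_exists:
  fixes V W :: "('b \<Rightarrow> 'k::field) set"
  assumes V: "chain.subspace V" and W: "chain.subspace W" "W \<subseteq> V"
  obtains E where "quotient_basis V W E"
proof -
  obtain A where A: "A \<subseteq> W" "chain.independent A" "W \<subseteq> chain.span A"
    using chain.maximal_independent_subset[of W] by blast
  obtain C where C: "A \<subseteq> C" "C \<subseteq> V" "chain.independent C" "V \<subseteq> chain.span C"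
    using chain.maximal_independent_subset_extend[of A V] A W(2) by blast
  have "quotient_basis V W (C - A)"
    unfolding quotient_basis_def
  proof (intro conjI allI impI ballI)
    show "C - A \<subseteq> V" using C by blast
  next
    fix T u v
    assume T: "finite T \<and> T \<subseteq> C - A \<and> (\<Sum>v\<in>T. chain_scale (u v) v) \<in> W" and v: "v \<in> T"
    then have "(\<Sum>v\<in>T. chain_scale (u v) v) \<in> chain.span A" using A by blast
    then obtain S r where S: "finite S" "S \<subseteq> A" "(\<Sum>v\<in>T. chain_scale (u v) v) = (\<Sum>a\<in>S. chain_scale (r a) a)"
      unfolding chain.span_explicit by auto
    define g where "g x = (if x \<in> T then u x else - r x)" for x
    have d: "T \<inter> S = {}" using T S(2) by blast
    have "(\<Sum>x\<in>T \<union> S. chain_scale (g x) x) = (\<Sum>x\<in>T. chain_scale (g x) x) + (\<Sum>x\<in>S. chain_scale (g x) x)"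
      using T S(1) d by (intro sum.union_disjoint) auto
    also have "(\<Sum>x\<in>T. chain_scale (g x) x) = (\<Sum>x\<in>T. chain_scale (u x) x)"
      by (rule sum.cong) (auto simp: g_def)
    also have "(\<Sum>x\<in>S. chain_scale (g x) x) = (\<Sum>x\<in>S. - (chain_scale (r x) x))"
      using d by (intro sum.cong) (auto simp: g_def)
    also have "(\<Sum>x\<in>T. chain_scale (u x) x) + (\<Sum>x\<in>S. - (chain_scale (r x) x)) = 0"
      by (simp add: S(3) sum_negf)
    finally have "(\<Sum>x\<in>T \<union> S. chain_scale (g x) x) = 0" .
    moreover have "finite (T \<union> S)" "T \<union> S \<subseteq> C" using T S C(1) by auto
    ultimately have "\<forall>x\<in>T \<union> S. g x = 0"
      using C(3) unfolding chain.dependent_explicit by blast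
    with v have "g v = 0" by blast
    with v show "u v = 0" by (simp add: g_def)
  next
    fix x assume "x \<in> V"
    then have "x \<in> chain.span C" using C by blast
    then obtain t r where t: "finite t" "t \<subseteq> C" "x = (\<Sum>a\<in>t. chain_scale (r a) a)"
      unfolding chain.span_explicit by auto
    have "x = (\<Sum>a\<in>t \<inter> A. chain_scale (r a) a) + (\<Sum>a\<in>t - A. chain_scale (r a) a)"
      unfolding t(3) using t(1) by (rule sum.Int_Diff)
    moreover have "(\<Sum>a\<in>t \<inter> A. chain_scale (r a) a) \<in> W"
      using A(1) W(1) by (intro chain.subspace_sum chain.subspace_scale) auto
    ultimately show "\<exists>T u. finite T \<and> T \<subseteq> C - A \<and> x - (\<Sum>v\<in>T. chain_scale (u v) v) \<in> W"
      using t by (intro exI[of _ "t - A"] exI[of _ r]) auto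
  qed
  then show thesis by (rule that)
qed

lemma quotient_dim_add:
  fixes V W :: "('b \<Rightarrow> 'k::field) set"
  assumes V: "chain.subspace V" and W: "chain.subspace W" "W \<subseteq> V" and fin: "finite F" "V \<subseteq> chain.span F"
  shows "quotient_dim V W + chain.dim W = chain.dim V"
proof -
  obtain A where A: "A \<subseteq> W" "chain.independent A" "W \<subseteq> chain.span A" "card A = chain.dim W"
    using chain.basis_exists[of W] by blast
  define E where "E = (SOME E. quotient_basis V W E)"
  obtain E' where "quotient_basis V W E'" using quotient_basis_exists[OF V W] by blast
  then have E: "quotient_basis V W E" unfolding E_def by (rule someI)
  note AE = independent_Un_quotient_basis[OF W(1) A(1,2) E]
  have "E \<subseteq> V" using E by (simp add: quotient_basis_def)
  then have sub: "A \<union> E \<subseteq> V" using A(1) W(2) by blast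
  have gen: "\<forall>x\<in>V. \<exists>T u. finite T \<and> T \<subseteq> E \<and> x - (\<Sum>v\<in>T. chain_scale (u v) v) \<in> W"
    using E unfolding quotient_basis_def by (elim conjE)
  have "x \<in> chain.span (A \<union> E)" if x: "x \<in> V" for x
  proof -
    obtain T u where T: "finite T" "T \<subseteq> E" "x - (\<Sum>v\<in>T. chain_scale (u v) v) \<in> W"
      using gen x by blast
    have "x - (\<Sum>v\<in>T. chain_scale (u v) v) \<in> chain.span (A \<union> E)"
      using T(3) A(3) chain.span_mono[of A "A \<union> E"] by blast
    moreover have "(\<Sum>v\<in>T. chain_scale (u v) v) \<in> chain.span (A \<union> E)"
      using T(2) by (intro chain.span_sum chain.span_scale chain.span_base) auto
    ultimately have "(x - (\<Sum>v\<in>T. chain_scale (u v) v)) + (\<Sum>v\<in>T. chain_scale (u v) v) \<in> chain.span (A \<union> E)"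
      by (rule chain.span_add)
    then show ?thesis by (simp only: diff_add_cancel)
  qed
  then have "chain.dim V = card (A \<union> E)"
    using chain.dim_unique[of "A \<union> E" V] sub AE(2) by blast
  moreover have "finite (A \<union> E)"
    using chain.independent_span_bound[OF fin(1) AE(2)] sub fin(2) by blast
  ultimately show ?thesis
    using AE(1) A(4) by (simp add: card_Un_disjoint quotient_dim_def E_def)
qed


subsection \<open>Reduced simplicial homology over a field\<close>

text \<open>An arbitrary total order of the vertices, used to orient the simplices. Another choice
  yields an isomorphic chain complex.\<close>

definition vertex_order :: "'v rel" where
  "vertex_order = (SOME r. linear_order r)"

lemma linear_order_vertex_order: "linear_order (vertex_order :: 'v rel)"
proof -
  obtain r :: "'v rel" where "well_order r" using well_order_on by blast
  then have "linear_order r" by (simp add: well_order_on_def)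
  then show ?thesis unfolding vertex_order_def by (rule someI)
qed

text \<open>A simplicial complex is given by the set of its faces, the empty face included. The index
  \<open>q\<close> of a chain group is the number of vertices, i.e. one more than the dimension; \<open>q = 0\<close> is the
  group of the empty face, so that the complex is the augmented one.\<close>

definition chain_space :: "'v set set \<Rightarrow> nat \<Rightarrow> ('v set \<Rightarrow> 'k::field) set" where
  "chain_space \<Gamma> q = {c. \<forall>\<sigma>. c \<sigma> \<noteq> 0 \<longrightarrow> \<sigma> \<in> \<Gamma> \<and> card \<sigma> = q}"

text \<open>The boundary of the simplex with vertices \<open>v\<^sub>0 < \<dots> < v\<^sub>p\<close> is the sum over \<open>i\<close> of
  \<open>(-1)\<^sup>i\<close> times the simplex without \<open>v\<^sub>i\<close>. Hence the coefficient at \<open>\<tau>\<close> of the boundary of a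
  chain \<open>c\<close> collects \<open>c\<close> on all \<open>insert v \<tau>\<close>, where the index of \<open>v\<close> in \<open>insert v \<tau>\<close> is the number
  of vertices of \<open>\<tau>\<close> below \<open>v\<close>.\<close>

definition boundary_map :: "'v set set \<Rightarrow> ('v set \<Rightarrow> 'k::field) \<Rightarrow> 'v set \<Rightarrow> 'k" where
  "boundary_map \<Gamma> c = (\<lambda>\<tau>. \<Sum>v\<in>\<Union>\<Gamma> - \<tau>. (-1) ^ card {u \<in> \<tau>. (u, v) \<in> vertex_order} * c (insert v \<tau>))"

definition cycle_space :: "'v set set \<Rightarrow> nat \<Rightarrow> ('v set \<Rightarrow> 'k::field) set" where
  "cycle_space \<Gamma> p = {c \<in> chain_space \<Gamma> (p + 1). boundary_map \<Gamma> c = 0}"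

definition boundary_space :: "'v set set \<Rightarrow> nat \<Rightarrow> ('v set \<Rightarrow> 'k::field) set" where
  "boundary_space \<Gamma> p = boundary_map \<Gamma> ` chain_space \<Gamma> (p + 2)"

definition reduced_betti :: "'k::field itself \<Rightarrow> nat \<Rightarrow> 'v set set \<Rightarrow> nat" where
  "reduced_betti _ p \<Gamma> =
     quotient_dim (cycle_space \<Gamma> p :: ('v set \<Rightarrow> 'k) set) (boundary_space \<Gamma> p)"


subsection \<open>Vietoris--Rips complexes\<close>

definition rips :: "'a::metric_space set \<Rightarrow> 'a set set" where
  "rips S = {\<sigma>. \<sigma> \<subseteq> S \<and> diameter \<sigma> \<le> 1}"

definition max_betti :: "'k::field itself \<Rightarrow> 'd::finite itself \<Rightarrow> nat \<Rightarrow> nat \<Rightarrow> nat" where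
  "max_betti k _ p n =
     Max {reduced_betti k p (rips S) | S :: (real ^ 'd) set. finite S \<and> card S \<le> n}"


subsection \<open>Well-definedness\<close>

lemma boundary_map_boundary_map:
  fixes c :: "'v set \<Rightarrow> 'k::field"
  assumes fin: "finite (\<Union>\<Gamma>)" and c: "c \<in> chain_space \<Gamma> q"
  shows "boundary_map \<Gamma> (boundary_map \<Gamma> c) = 0"
proof
  fix \<tau> :: "'v set"
  define V where "V = \<Union>\<Gamma>"
  define s :: "'v \<Rightarrow> 'v set \<Rightarrow> 'k" where "s v t = (-1) ^ card {u \<in> t. (u, v) \<in> vertex_order}" for v t
  define f where "f v w = s v \<tau> * (s w (insert v \<tau>) * c (insert w (insert v \<tau>)))" for v w
  have bb: "boundary_map \<Gamma> (boundary_map \<Gamma> c) \<tau> = (\<Sum>v\<in>V - \<tau>. \<Sum>w\<in>V - insert v \<tau>. f v w)"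
    unfolding boundary_map_def f_def s_def V_def by (simp add: sum_distrib_left)
  have finV: "finite V" using fin by (simp add: V_def)
  have lin: "linear_order (vertex_order :: 'v rel)" by (rule linear_order_vertex_order)
  then have total: "\<And>x y :: 'v. x \<noteq> y \<Longrightarrow> (x, y) \<in> vertex_order \<or> (y, x) \<in> vertex_order"
    and anti: "\<And>x y :: 'v. (x, y) \<in> vertex_order \<Longrightarrow> (y, x) \<in> vertex_order \<Longrightarrow> x = y"
    by (auto simp: linear_order_on_def partial_order_on_def total_on_def antisym_def)
  have swap: "f w v = - f v w" if vw: "(v, w) \<in> vertex_order" "v \<noteq> w" "v \<notin> \<tau>" "w \<notin> \<tau>" for v w
  proof (cases "finite \<tau>")
    case True
    have "{u \<in> insert v \<tau>. (u, w) \<in> vertex_order} = insert v {u \<in> \<tau>. (u, w) \<in> vertex_order}"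
      using vw by auto
    then have 1: "s w (insert v \<tau>) = - s w \<tau>"
      using True vw by (simp add: s_def)
    have "{u \<in> insert w \<tau>. (u, v) \<in> vertex_order} = {u \<in> \<tau>. (u, v) \<in> vertex_order}"
      using vw anti by auto
    then have 2: "s v (insert w \<tau>) = s v \<tau>" by (simp add: s_def)
    show ?thesis by (simp add: f_def 1 2 insert_commute[of v w])
  next
    case False
    have "\<not> insert w (insert v \<tau>) \<in> \<Gamma>"
      using False fin by (meson Sup_upper finite_insert finite_subset)
    then have "c (insert w (insert v \<tau>)) = 0" using c unfolding chain_space_def by blast
    then show ?thesis by (simp add: f_def insert_commute[of v w])
  qed
  define P where "P = {(v, w). v \<in> V - \<tau> \<and> w \<in> V - \<tau> \<and> v \<noteq> w \<and> (v, w) \<in> vertex_order}"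
  have finP: "finite P"
    by (rule finite_subset[of _ "V \<times> V"]) (use finV in \<open>auto simp: P_def\<close>)
  have "(\<Sum>v\<in>V - \<tau>. \<Sum>w\<in>V - insert v \<tau>. f v w) = (\<Sum>(v, w)\<in>Sigma (V - \<tau>) (\<lambda>v. V - insert v \<tau>). f v w)"
    using finV by (intro sum.Sigma) auto
  also have "Sigma (V - \<tau>) (\<lambda>v. V - insert v \<tau>) = P \<union> prod.swap ` P"
    by (auto simp: P_def image_iff dest: total)
  also have "(\<Sum>(v, w)\<in>P \<union> prod.swap ` P. f v w) = (\<Sum>(v, w)\<in>P. f v w) + (\<Sum>(v, w)\<in>prod.swap ` P. f v w)"
    using finP anti by (intro sum.union_disjoint) (auto simp: P_def)
  also have "(\<Sum>(v, w)\<in>prod.swap ` P. f v w) = (\<Sum>(v, w)\<in>P. f w v)"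
    by (subst sum.reindex) (auto simp: o_def case_prod_beta)
  also have "\<dots> = (\<Sum>(v, w)\<in>P. - f v w)"
    by (rule sum.cong) (auto simp: P_def swap)
  also have "(\<Sum>(v, w)\<in>P. f v w) + \<dots> = 0"
    by (simp add: case_prod_beta sum_negf)
  finally show "boundary_map \<Gamma> (boundary_map \<Gamma> c) \<tau> = (0 :: 'v set \<Rightarrow> 'k) \<tau>" using bb by simp
qed

lemma boundary_map_add: "boundary_map \<Gamma> (c + d) = boundary_map \<Gamma> c + boundary_map \<Gamma> d"
  by (simp add: boundary_map_def fun_eq_iff algebra_simps sum.distrib)

lemma boundary_map_scale: "boundary_map \<Gamma> (chain_scale a c) = chain_scale a (boundary_map \<Gamma> c)"
  by (simp add: boundary_map_def chain_scale_def fun_eq_iff algebra_simps sum_distrib_left)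

lemma boundary_map_zero: "boundary_map \<Gamma> 0 = 0"
  by (simp add: boundary_map_def fun_eq_iff)

lemma subspace_chain_space: "chain.subspace (chain_space \<Gamma> q :: ('v set \<Rightarrow> 'k::field) set)"
  unfolding chain.subspace_def chain_space_def chain_scale_def
proof (intro conjI ballI allI CollectI impI)
  fix x y :: "'v set \<Rightarrow> 'k" and \<sigma>
  assume "x \<in> {c. \<forall>\<sigma>. c \<sigma> \<noteq> 0 \<longrightarrow> \<sigma> \<in> \<Gamma> \<and> card \<sigma> = q}"
    and "y \<in> {c. \<forall>\<sigma>. c \<sigma> \<noteq> 0 \<longrightarrow> \<sigma> \<in> \<Gamma> \<and> card \<sigma> = q}" and "(x + y) \<sigma> \<noteq> 0"
  moreover from this have "x \<sigma> \<noteq> 0 \<or> y \<sigma> \<noteq> 0" by auto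
  ultimately show "\<sigma> \<in> \<Gamma>" "card \<sigma> = q" by auto
qed auto

lemma subspace_cycle_space: "chain.subspace (cycle_space \<Gamma> p)"
  using subspace_chain_space[of \<Gamma> "p + 1"]
  unfolding chain.subspace_def cycle_space_def
  by (auto simp: boundary_map_add boundary_map_scale boundary_map_zero)

lemma subspace_boundary_space: "chain.subspace (boundary_space \<Gamma> p)"
  unfolding chain.subspace_def boundary_space_def
proof (intro conjI ballI allI)
  note sub = subspace_chain_space[of \<Gamma> "p + 2"]
  show "0 \<in> boundary_map \<Gamma> ` chain_space \<Gamma> (p + 2)"
    using chain.subspace_0[OF sub] boundary_map_zero[of \<Gamma>] by (metis image_eqI)
  show "x + y \<in> boundary_map \<Gamma> ` chain_space \<Gamma> (p + 2)"
    if xy: "x \<in> boundary_map \<Gamma> ` chain_space \<Gamma> (p + 2)" "y \<in> boundary_map \<Gamma> ` chain_space \<Gamma> (p + 2)" for x y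
  proof -
    obtain c d where "c \<in> chain_space \<Gamma> (p + 2)" "d \<in> chain_space \<Gamma> (p + 2)"
      and "x = boundary_map \<Gamma> c" "y = boundary_map \<Gamma> d"
      using xy by blast
    then show ?thesis
      using imageI[OF chain.subspace_add[OF sub], of c d "boundary_map \<Gamma>"] by (simp only: boundary_map_add)
  qed
  show "chain_scale a x \<in> boundary_map \<Gamma> ` chain_space \<Gamma> (p + 2)"
    if xy: "x \<in> boundary_map \<Gamma> ` chain_space \<Gamma> (p + 2)" for a x
  proof -
    obtain c where "c \<in> chain_space \<Gamma> (p + 2)" and "x = boundary_map \<Gamma> c"
      using xy by blast
    then show ?thesis
      using imageI[OF chain.subspace_scale[OF sub], of c "boundary_map \<Gamma>" a] by (simp only: boundary_map_scale)
  qed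
qed

lemma boundary_map_in_chain_space:
  assumes fin: "finite (\<Union>\<Gamma>)" and down: "\<And>\<sigma> \<tau>. \<sigma> \<in> \<Gamma> \<Longrightarrow> \<tau> \<subseteq> \<sigma> \<Longrightarrow> \<tau> \<in> \<Gamma>"
    and c: "c \<in> chain_space \<Gamma> (Suc q)"
  shows "boundary_map \<Gamma> c \<in> chain_space \<Gamma> q"
  unfolding chain_space_def
proof (intro CollectI allI impI)
  fix \<tau> assume "boundary_map \<Gamma> c \<tau> \<noteq> 0"
  then obtain v where v: "v \<in> \<Union>\<Gamma> - \<tau>" "c (insert v \<tau>) \<noteq> 0"
    unfolding boundary_map_def by (metis (no_types, lifting) mult_zero_right sum.neutral)
  then have 1: "insert v \<tau> \<in> \<Gamma>" "card (insert v \<tau>) = Suc q" using c unfolding chain_space_def by blast+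
  then have "finite \<tau>" using fin by (meson Sup_upper finite_insert finite_subset)
  with 1 v down show "\<tau> \<in> \<Gamma> \<and> card \<tau> = q" by auto
qed

lemma chain_space_subset_span:
  assumes fin: "finite \<Gamma>"
  shows "(chain_space \<Gamma> q :: ('v set \<Rightarrow> 'k::field) set)
    \<subseteq> chain.span ((\<lambda>\<sigma> \<tau>. if \<tau> = \<sigma> then 1 else 0) ` {\<sigma> \<in> \<Gamma>. card \<sigma> = q})"
proof
  fix c :: "'v set \<Rightarrow> 'k" assume c: "c \<in> chain_space \<Gamma> q"
  let ?F = "{\<sigma> \<in> \<Gamma>. card \<sigma> = q}"
  let ?e = "\<lambda>\<sigma> \<tau>. if \<tau> = \<sigma> then 1 else (0::'k)"
  have app: "(\<Sum>\<sigma>\<in>A. g \<sigma>) \<tau> = (\<Sum>\<sigma>\<in>A. g \<sigma> \<tau>)" for A and g :: "'v set \<Rightarrow> 'v set \<Rightarrow> 'k" and \<tau>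
    by (induction A rule: infinite_finite_induct) auto
  have "c = (\<Sum>\<sigma>\<in>?F. chain_scale (c \<sigma>) (?e \<sigma>))"
  proof
    fix \<tau>
    have "(\<Sum>\<sigma>\<in>?F. c \<sigma> * ?e \<sigma> \<tau>) = (\<Sum>\<sigma>\<in>?F. if \<tau> = \<sigma> then c \<sigma> else 0)"
      by (rule sum.cong) auto
    also have "\<dots> = (if \<tau> \<in> ?F then c \<tau> else 0)"
      using fin by (subst sum.delta') auto
    also have "\<dots> = c \<tau>" using c unfolding chain_space_def by auto
    finally show "c \<tau> = (\<Sum>\<sigma>\<in>?F. chain_scale (c \<sigma>) (?e \<sigma>)) \<tau>" by (simp add: app chain_scale_def)
  qed
  also have "\<dots> \<in> chain.span (?e ` ?F)"
    by (intro chain.span_sum chain.span_scale chain.span_base) auto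
  finally show "c \<in> chain.span (?e ` ?F)" .
qed

lemma
  fixes \<Gamma> :: "'v set set"
  assumes fin: "finite \<Gamma>" "finite (\<Union>\<Gamma>)" and down: "\<And>\<sigma> \<tau>. \<sigma> \<in> \<Gamma> \<Longrightarrow> \<tau> \<subseteq> \<sigma> \<Longrightarrow> \<tau> \<in> \<Gamma>"
  shows reduced_betti_eq: "reduced_betti TYPE('k::field) p \<Gamma> =
      chain.dim (cycle_space \<Gamma> p :: ('v set \<Rightarrow> 'k) set) - chain.dim (boundary_space \<Gamma> p :: ('v set \<Rightarrow> 'k) set)"
    and reduced_betti_le: "reduced_betti TYPE('k) p \<Gamma> \<le> card {\<sigma> \<in> \<Gamma>. card \<sigma> = p + 1}"
proof -
  let ?Z = "cycle_space \<Gamma> p :: ('v set \<Rightarrow> 'k) set" and ?B = "boundary_space \<Gamma> p :: ('v set \<Rightarrow> 'k) set"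
  let ?E = "(\<lambda>\<sigma> \<tau>. if \<tau> = \<sigma> then 1 else (0::'k)) ` {\<sigma> \<in> \<Gamma>. card \<sigma> = p + 1}"
  have BZ: "?B \<subseteq> ?Z"
    unfolding boundary_space_def cycle_space_def
    using boundary_map_in_chain_space[OF fin(2) down, where q = "p + 1"] boundary_map_boundary_map[OF fin(2)] by auto
  have Z: "?Z \<subseteq> chain.span ?E"
    using chain_space_subset_span[OF fin(1), of "p + 1"] unfolding cycle_space_def by blast
  have add: "reduced_betti TYPE('k) p \<Gamma> + chain.dim ?B = chain.dim ?Z"
    unfolding reduced_betti_def
    by (rule quotient_dim_add[OF subspace_cycle_space subspace_boundary_space BZ _ Z]) (use fin in simp)
  then show "reduced_betti TYPE('k) p \<Gamma> = chain.dim ?Z - chain.dim ?B" by simp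
  have "chain.dim ?Z \<le> card ?E" by (rule chain.dim_le_card[OF Z]) (use fin in simp)
  also have "\<dots> \<le> card {\<sigma> \<in> \<Gamma>. card \<sigma> = p + 1}" by (rule card_image_le) (use fin in simp)
  finally show "reduced_betti TYPE('k) p \<Gamma> \<le> card {\<sigma> \<in> \<Gamma>. card \<sigma> = p + 1}" using add by simp
qed

lemma rips_complex:
  fixes S :: "'a::metric_space set"
  assumes "finite S"
  shows "finite (rips S)" "finite (\<Union>(rips S))" "\<sigma> \<in> rips S \<Longrightarrow> \<tau> \<subseteq> \<sigma> \<Longrightarrow> \<tau> \<in> rips S"
proof -
  have sub: "rips S \<subseteq> Pow S" by (auto simp: rips_def)
  show "finite (rips S)" by (rule finite_subset[OF sub]) (use assms in simp)
  show "finite (\<Union>(rips S))" by (rule finite_subset[OF _ assms]) (use sub in blast)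
  show "\<tau> \<in> rips S" if "\<sigma> \<in> rips S" "\<tau> \<subseteq> \<sigma>"
  proof -
    have "finite \<sigma>" using that assms by (auto simp: rips_def intro: finite_subset)
    then have "diameter \<tau> \<le> diameter \<sigma>"
      using that by (intro diameter_subset finite_imp_bounded)
    with that show ?thesis by (auto simp: rips_def)
  qed
qed

lemma finite_betti_values:
  "finite {reduced_betti TYPE('k::field) p (rips S) | S :: 'a::metric_space set. finite S \<and> card S \<le> n}"
proof (rule finite_subset)
  show "{reduced_betti TYPE('k) p (rips S) | S :: 'a set. finite S \<and> card S \<le> n} \<subseteq> {..2 ^ n}"
  proof
    fix b assume "b \<in> {reduced_betti TYPE('k) p (rips S) | S :: 'a set. finite S \<and> card S \<le> n}"
    then obtain S :: "'a set" where S: "finite S" "card S \<le> n" and b: "b = reduced_betti TYPE('k) p (rips S)"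
      by blast
    have "reduced_betti TYPE('k) p (rips S) \<le> card {\<sigma> \<in> rips S. card \<sigma> = p + 1}"
      by (rule reduced_betti_le) (use rips_complex[OF S(1)] in blast)+
    also have "\<dots> \<le> card (Pow S)"
      by (rule card_mono) (use S in \<open>auto simp: rips_def\<close>)
    also have "\<dots> \<le> 2 ^ n" using S by (simp add: card_Pow)
    finally show "b \<in> {..2 ^ n}" using b by simp
  qed
qed simp

end

theory Submission
  imports Defs "HOL-Real_Asymp.Real_Asymp"
begin

text \<open>
  Deleting a vertex \<open>v\<close> gives \<open>\<beta>\<^sub>p(\<Gamma>) \<le> \<beta>\<^sub>p(\<Gamma> - v) + \<beta>\<^sub>p\<^sub>-\<^sub>1(lk v)\<close>, and links in a Rips complex are Rips complexes
  again, so everything reduces to \<open>p = 2\<close>.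

  In dimension \<open>d\<close>, packing bounds \<open>\<beta>\<^sub>0\<close> of a link and hence \<open>\<beta>\<^sub>1 = O(n)\<close>. A greedy hitting set together with the
  Sauer--Shelah lemma splits the points into polylogarithmically many classes such that the
  neighbourhoods of two points \<open>v\<close>, \<open>w\<close> of one class differ by at most \<open>\<epsilon>n\<close> points. As long as \<open>w\<close> is present, the link of
  \<open>v\<close> is a cone with apex \<open>w\<close> up to \<open>\<epsilon>n\<close> further vertices, so deleting \<open>v\<close> costs only \<open>O(\<epsilon>n)\<close>.

  In the plane, colour the points by the cells of a fine grid, modulo a large period. Modulo
  boundaries and two-coloured faces, a triangle with three colours may change one vertex within its
  colour, and representatives \<open>abv\<close> of the resulting classes are counted as follows: if \<open>abv\<close> and \<open>ab'v'\<close>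
  are inequivalent, then \<open>|bv'|, |b'v| > 1\<close>, which for nearly equilateral triangles forces the edge
  opposite to \<open>a\<close> to be strictly longest in one of the two. Two-coloured complexes are treated by deleting
  the vertices of one colour in the order of a coordinate in which unit circles around points of the
  other colour cross at most once.
\<close>

section \<open>Codimension of subspaces\<close>

text \<open>Two points of one colour with a common neighbour are at most 2 apart, and the period of
  the colouring then puts them into the same small cell, so they are adjacent. This property
  (\<open>common_neighbour\<close>) makes every colour class within a link a clique, and it is what
  allows a vertex to move within its colour. In dimension d, a vertex without a partner in its class
  costs O(n), once per class. Any o(n) number of classes would thus do; sampling with fixed
  \<epsilon> gives a polylogarithmic one. In the plane the obstacle is that single links are not
  bounded: with two colours only the total cost over the whole order of deletion is linear, so that
  order has to be chosen geometrically. The colours make this possible: they fix the displacement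
  between two nearby points up to a small error, hence one direction in which the points of one
  colour lie ahead of all relevant centres of the other. Codimensions are bounded instead of
  dimensions because exact-sequence arguments then become compositions of spanning sets, without
  finiteness conditions.\<close>

definition codim_le :: "('b \<Rightarrow> 'k::field) set \<Rightarrow> ('b \<Rightarrow> 'k) set \<Rightarrow> nat \<Rightarrow> bool" where
  "codim_le V W k \<longleftrightarrow> (\<exists>F. finite F \<and> card F \<le> k \<and> V \<subseteq> chain.span (W \<union> F))"

lemma codim_le_mono: "codim_le V W k \<Longrightarrow> k \<le> l \<Longrightarrow> codim_le V W l"
  unfolding codim_le_def by (meson order_trans)

lemma codim_le_trans:
  assumes "codim_le V U k" "codim_le U W l"
  shows "codim_le V W (k + l)"
proof -
  obtain F where F: "finite F" "card F \<le> k" "V \<subseteq> chain.span (U \<union> F)"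
    using assms(1) unfolding codim_le_def by blast
  obtain G where G: "finite G" "card G \<le> l" "U \<subseteq> chain.span (W \<union> G)"
    using assms(2) unfolding codim_le_def by blast
  have "U \<union> F \<subseteq> chain.span (W \<union> (F \<union> G))"
    using G(3) chain.span_mono[of "W \<union> G" "W \<union> (F \<union> G)"] chain.span_superset[of "W \<union> (F \<union> G)"] by blast
  then have "V \<subseteq> chain.span (W \<union> (F \<union> G))"
    using F(3) chain.span_minimal[OF _ chain.subspace_span] by blast
  moreover have "card (F \<union> G) \<le> k + l"
    using card_Un_le[of F G] F G by linarith
  ultimately show ?thesis unfolding codim_le_def using F G by blast
qed

lemma codim_le_0I: "V \<subseteq> chain.span W \<Longrightarrow> codim_le V W 0"
  unfolding codim_le_def by (intro exI[of _ "{}"]) auto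

lemma span_insert_subspace:
  fixes W :: "('b \<Rightarrow> 'k::field) set"
  assumes "x \<in> chain.span (insert f W)" "chain.subspace W"
  obtains c where "x - chain_scale c f \<in> W"
  using assms(1) chain.span_eq_iff[THEN iffD2, OF assms(2)] that by (auto simp: chain.span_breakdown_eq)

text \<open>Modulo the preimage of \<open>W\<close>, the space \<open>V\<close> embeds into its
  image modulo \<open>W\<close>. The induction absorbs one vector \<open>f\<close> of
  \<open>F\<close> into \<open>W\<close> at a time, which enlarges the preimage by at most one
  dimension.\<close>

lemma codim_le_preimage:
  fixes \<phi> :: "('b \<Rightarrow> 'k::field) \<Rightarrow> ('c \<Rightarrow> 'k)"
  assumes lin: "\<And>x y. \<phi> (x + y) = \<phi> x + \<phi> y" "\<And>a x. \<phi> (chain_scale a x) = chain_scale a (\<phi> x)"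
    and V: "chain.subspace V" and W: "chain.subspace W" and le: "codim_le (\<phi> ` V) W k"
  shows "codim_le V {z \<in> V. \<phi> z \<in> W} k"
proof -
  obtain F where F: "finite F" "card F \<le> k" "\<phi> ` V \<subseteq> chain.span (W \<union> F)"
    using le unfolding codim_le_def by blast
  have "codim_le V {z \<in> V. \<phi> z \<in> W} (card F)"
    using F(1,3) W
  proof (induction F arbitrary: W rule: finite_induct)
    case empty
    then have "V \<subseteq> {z \<in> V. \<phi> z \<in> W}" using chain.span_eq_iff[THEN iffD2, OF empty(2)] by auto
    then show ?case using chain.span_superset by (intro codim_le_mono[OF codim_le_0I]) auto
  next
    case (insert f F)
    let ?W = "chain.span (insert f W)"
    have "W \<union> insert f F \<subseteq> chain.span (?W \<union> F)"
      using chain.span_superset[of "insert f W"] chain.span_superset[of "?W \<union> F"] by blast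
    then have "\<phi> ` V \<subseteq> chain.span (?W \<union> F)"
      using insert.prems(1) chain.span_minimal[OF _ chain.subspace_span] by blast
    from insert.IH[OF this chain.subspace_span]
    have 1: "codim_le V {z \<in> V. \<phi> z \<in> ?W} (card F)" .
    have 2: "codim_le {z \<in> V. \<phi> z \<in> ?W} {z \<in> V. \<phi> z \<in> W} 1"
    proof (cases "{z \<in> V. \<phi> z \<in> ?W} \<subseteq> {z \<in> V. \<phi> z \<in> W}")
      case True
      then show ?thesis using chain.span_superset by (intro codim_le_mono[OF codim_le_0I]) auto
    next
      case False
      then obtain z0 where z0: "z0 \<in> V" "\<phi> z0 \<in> ?W" "\<phi> z0 \<notin> W" by blast
      obtain c0 where c0: "\<phi> z0 - chain_scale c0 f \<in> W"
        using span_insert_subspace[OF z0(2) insert.prems(2)] by blast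
      have "c0 \<noteq> 0" using c0 z0(3) by auto
      have "z \<in> chain.span ({z \<in> V. \<phi> z \<in> W} \<union> {z0})" if z: "z \<in> V" "\<phi> z \<in> ?W" for z
      proof -
        obtain c where c: "\<phi> z - chain_scale c f \<in> W"
          using span_insert_subspace[OF z(2) insert.prems(2)] by blast
        \<comment> \<open>The multiple of \<open>z0\<close> is chosen so that the
          \<open>f\<close>-components of the two images cancel.\<close>
        let ?y = "z + chain_scale (- (c / c0)) z0"
        have "\<phi> ?y = (\<phi> z - chain_scale c f) + chain_scale (- (c / c0)) (\<phi> z0 - chain_scale c0 f)"
          unfolding lin using \<open>c0 \<noteq> 0\<close> by (simp add: chain_scale_def fun_eq_iff field_simps)
        also have "\<dots> \<in> W"
          using insert.prems(2) c c0 by (intro chain.subspace_add chain.subspace_scale)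
        finally have "\<phi> ?y \<in> W" .
        moreover have "?y \<in> V" using V z z0 by (intro chain.subspace_add chain.subspace_scale)
        ultimately have "?y \<in> chain.span ({z \<in> V. \<phi> z \<in> W} \<union> {z0})"
          by (intro chain.span_base) blast
        moreover have "chain_scale (c / c0) z0 \<in> chain.span ({z \<in> V. \<phi> z \<in> W} \<union> {z0})"
          by (intro chain.span_scale chain.span_base) blast
        ultimately have "?y + chain_scale (c / c0) z0 \<in> chain.span ({z \<in> V. \<phi> z \<in> W} \<union> {z0})"
          by (rule chain.span_add)
        moreover have "?y + chain_scale (c / c0) z0 = z"
          by (simp add: chain_scale_def fun_eq_iff)
        ultimately show ?thesis by simp
      qed
      then show ?thesis unfolding codim_le_def by (intro exI[of _ "{z0}"]) auto
    qed
    show ?case using codim_le_trans[OF 1 2] insert.hyps by simp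
  qed
  then show ?thesis using F(2) by (rule codim_le_mono)
qed

text \<open>\<open>quotient_dim\<close> is the cardinality of a chosen basis, so a spanning set
  bounds it through the additivity of dimension; for this the finite spanning set \<open>G\<close>
  is supplied.\<close>

lemma quotient_dim_le:
  fixes V W :: "('b \<Rightarrow> 'k::field) set"
  assumes V: "chain.subspace V" and W: "chain.subspace W" "W \<subseteq> V" and fin: "finite G" "V \<subseteq> chain.span G"
    and le: "codim_le V W k"
  shows "quotient_dim V W \<le> k"
proof -
  obtain F where F: "finite F" "card F \<le> k" "V \<subseteq> chain.span (W \<union> F)"
    using le unfolding codim_le_def by blast
  obtain A where A: "A \<subseteq> W" "chain.independent A" "W \<subseteq> chain.span A" "card A = chain.dim W"
    using chain.basis_exists[of W] by blast
  have "finite A"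
    using chain.independent_span_bound[OF fin(1) A(2)] A(1) W(2) fin(2) by blast
  have "W \<union> F \<subseteq> chain.span (A \<union> F)"
    using A(3) chain.span_mono[of A "A \<union> F"] chain.span_superset[of "A \<union> F"] by blast
  then have "V \<subseteq> chain.span (A \<union> F)"
    using F(3) chain.span_minimal[OF _ chain.subspace_span] by blast
  then have "chain.dim V \<le> card (A \<union> F)"
    using \<open>finite A\<close> F(1) by (intro chain.dim_le_card) auto
  also have "\<dots> \<le> chain.dim W + k" using card_Un_le[of A F] A(4) F(2) by linarith
  finally show ?thesis using quotient_dim_add[OF V W fin] by simp
qed

section \<open>Cycles and boundaries relative to a vertex set\<close>

text \<open>The boundary in the full simplex on \<open>V\<close>: a single operator for all
  subcomplexes, so that their chains can be added and compared.\<close>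

abbreviation bd :: "'v set \<Rightarrow> ('v set \<Rightarrow> 'k::field) \<Rightarrow> 'v set \<Rightarrow> 'k" where
  "bd V \<equiv> boundary_map (Pow V)"

definition cycles :: "'v set \<Rightarrow> 'v set set \<Rightarrow> nat \<Rightarrow> ('v set \<Rightarrow> 'k::field) set" where
  "cycles V \<Gamma> q = {c \<in> chain_space \<Gamma> q. bd V c = 0}"

definition bounds :: "'v set \<Rightarrow> 'v set set \<Rightarrow> nat \<Rightarrow> ('v set \<Rightarrow> 'k::field) set" where
  "bounds V \<Gamma> q = bd V ` chain_space \<Gamma> (Suc q)"

text \<open>Homology is indexed by the number of vertices of the faces, as in \<^const>\<open>chain_space\<close>.\<close>

definition betti_le :: "'k::field itself \<Rightarrow> 'v set \<Rightarrow> 'v set set \<Rightarrow> nat \<Rightarrow> nat \<Rightarrow> bool" where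
  "betti_le _ V \<Gamma> q k \<longleftrightarrow> codim_le (cycles V \<Gamma> q :: ('v set \<Rightarrow> 'k) set) (bounds V \<Gamma> q) k"

definition complex_on :: "'v set \<Rightarrow> 'v set set \<Rightarrow> bool" where
  "complex_on V \<Gamma> \<longleftrightarrow> finite V \<and> \<Gamma> \<subseteq> Pow V \<and> (\<forall>\<sigma>\<in>\<Gamma>. \<forall>\<tau>\<subseteq>\<sigma>. \<tau> \<in> \<Gamma>)"

lemma betti_le_mono: "betti_le k V \<Gamma> q m \<Longrightarrow> m \<le> n \<Longrightarrow> betti_le k V \<Gamma> q n"
  unfolding betti_le_def by (rule codim_le_mono)

lemma bd_add: "bd V (c + d) = bd V c + bd V d" by (rule boundary_map_add)
lemma bd_scale: "bd V (chain_scale a c) = chain_scale a (bd V c)" by (rule boundary_map_scale)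

lemma bd_uminus: "bd V (- c) = - bd V c"
  by (simp add: boundary_map_def fun_eq_iff sum_negf)

lemma bd_diff: "bd V (c - d) = bd V c - bd V d"
  using bd_add[of V c "- d"] by (simp add: bd_uminus)

lemma chain_space_mono: "\<Gamma> \<subseteq> \<Delta> \<Longrightarrow> chain_space \<Gamma> q \<subseteq> chain_space \<Delta> q"
  unfolding chain_space_def by blast

lemma chain_spaceD: "c \<in> chain_space \<Gamma> q \<Longrightarrow> \<not> (\<sigma> \<in> \<Gamma> \<and> card \<sigma> = q) \<Longrightarrow> c \<sigma> = 0"
  unfolding chain_space_def by blast

lemma subspace_cycles: "chain.subspace (cycles V \<Gamma> q :: ('v set \<Rightarrow> 'k::field) set)"
  using subspace_chain_space[of \<Gamma> q]
  unfolding chain.subspace_def cycles_def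
  by (auto simp: boundary_map_add boundary_map_scale boundary_map_zero)

lemma subspace_bounds: "chain.subspace (bounds V \<Gamma> q :: ('v set \<Rightarrow> 'k::field) set)"
  unfolding chain.subspace_def
proof (intro conjI ballI allI)
  note sub = subspace_chain_space[of \<Gamma> "Suc q"]
  show "(0 :: 'v set \<Rightarrow> 'k) \<in> bounds V \<Gamma> q"
    unfolding bounds_def using chain.subspace_0[OF sub] boundary_map_zero[of "Pow V"] by (metis image_eqI)
  show "x + y \<in> bounds V \<Gamma> q" if "x \<in> bounds V \<Gamma> q" "y \<in> bounds V \<Gamma> q" for x y :: "'v set \<Rightarrow> 'k"
    using that chain.subspace_add[OF sub] unfolding bounds_def
    by (smt (verit, ccfv_threshold) bd_add image_iff)
  show "chain_scale a x \<in> bounds V \<Gamma> q" if "x \<in> bounds V \<Gamma> q" for a and x :: "'v set \<Rightarrow> 'k"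
    using that chain.subspace_scale[OF sub] unfolding bounds_def
    by (smt (verit, ccfv_threshold) bd_scale image_iff)
qed

lemma bd_in_chain_space:
  assumes "complex_on V \<Gamma>" "c \<in> chain_space \<Gamma> (Suc q)"
  shows "bd V c \<in> chain_space \<Gamma> q"
  unfolding chain_space_def
proof (intro CollectI allI impI)
  fix \<tau> assume "bd V c \<tau> \<noteq> 0"
  then obtain v where v: "v \<in> V - \<tau>" "c (insert v \<tau>) \<noteq> 0"
    unfolding boundary_map_def by (metis (no_types, lifting) Union_Pow_eq mult_zero_right sum.neutral)
  then have 1: "insert v \<tau> \<in> \<Gamma>" "card (insert v \<tau>) = Suc q" using assms(2) unfolding chain_space_def by blast+
  then have "finite \<tau>" using card_ge_0_finite[of "insert v \<tau>"] by auto
  with 1 v assms(1) show "\<tau> \<in> \<Gamma> \<and> card \<tau> = q" by (auto simp: complex_on_def)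
qed

lemma bd_bd:
  assumes "complex_on V \<Gamma>" "c \<in> chain_space \<Gamma> q"
  shows "bd V (bd V c) = 0"
proof -
  have "c \<in> chain_space (Pow V) q" using assms chain_space_mono[of \<Gamma> "Pow V" q] by (auto simp: complex_on_def)
  then show ?thesis using assms(1) by (intro boundary_map_boundary_map) (auto simp: complex_on_def)
qed

lemma bounds_subset_cycles: "complex_on V \<Gamma> \<Longrightarrow> bounds V \<Gamma> q \<subseteq> cycles V \<Gamma> q"
  by (auto simp: bounds_def cycles_def bd_in_chain_space bd_bd)

lemma bounds_mono: "\<Gamma> \<subseteq> \<Delta> \<Longrightarrow> bounds V \<Gamma> q \<subseteq> bounds V \<Delta> q"
  unfolding bounds_def by (intro image_mono chain_space_mono)

lemma boundary_map_eq_bd: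
  assumes "complex_on V \<Gamma>" "c \<in> chain_space \<Gamma> q"
  shows "boundary_map \<Gamma> c = bd V c"
proof
  fix \<tau>
  show "boundary_map \<Gamma> c \<tau> = bd V c \<tau>"
    unfolding boundary_map_def
    using assms chain_spaceD[OF assms(2)]
    by (intro sum.mono_neutral_left) (auto simp: complex_on_def)
qed

lemma reduced_betti_le_if_betti_le:
  assumes "complex_on V \<Gamma>" "betti_le TYPE('k::field) V \<Gamma> (Suc p) m"
  shows "reduced_betti TYPE('k) p \<Gamma> \<le> m"
proof -
  have "cycle_space \<Gamma> p = (cycles V \<Gamma> (Suc p) :: ('a set \<Rightarrow> 'k) set)"
    unfolding cycle_space_def cycles_def by (auto simp: boundary_map_eq_bd[OF assms(1)])
  moreover have "boundary_space \<Gamma> p = (bounds V \<Gamma> (Suc p) :: ('a set \<Rightarrow> 'k) set)"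
    unfolding boundary_space_def bounds_def by (auto simp: boundary_map_eq_bd[OF assms(1)] intro!: image_cong)
  moreover have "finite \<Gamma>" using assms(1) unfolding complex_on_def by (meson finite_Pow_iff finite_subset)
  moreover have "quotient_dim (cycles V \<Gamma> (Suc p) :: ('a set \<Rightarrow> 'k) set) (bounds V \<Gamma> (Suc p)) \<le> m"
  proof (rule quotient_dim_le)
    show "cycles V \<Gamma> (Suc p) \<subseteq> chain.span ((\<lambda>\<sigma> \<tau>. if \<tau> = \<sigma> then 1 else (0::'k)) ` {\<sigma> \<in> \<Gamma>. card \<sigma> = Suc p})"
      using chain_space_subset_span[OF \<open>finite \<Gamma>\<close>, of "Suc p"] unfolding cycles_def by blast
  qed (use assms(2) bounds_subset_cycles[OF assms(1)] \<open>finite \<Gamma>\<close> in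
      \<open>auto simp: betti_le_def subspace_cycles subspace_bounds\<close>)
  ultimately show ?thesis unfolding reduced_betti_def by simp
qed

lemma betti_le_no_faces:
  assumes "\<And>\<sigma>. \<sigma> \<in> \<Gamma> \<Longrightarrow> card \<sigma> \<noteq> q"
  shows "betti_le TYPE('k::field) V \<Gamma> q 0"
proof -
  have "(cycles V \<Gamma> q :: ('a set \<Rightarrow> 'k) set) \<subseteq> {0}"
    using assms chain_spaceD unfolding cycles_def by (fastforce intro!: ext)
  then show ?thesis
    unfolding betti_le_def using chain.span_zero by (intro codim_le_0I) blast
qed

section \<open>Cones, vertex deletion and links\<close>

definition osgn :: "'v \<Rightarrow> 'v set \<Rightarrow> 'k::field" where
  "osgn v \<tau> = (-1) ^ card {u \<in> \<tau>. (u, v) \<in> vertex_order}"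

text \<open>The join of \<open>v\<close> with the chain \<open>e\<close>. The sign is the incidence
  sign of \<open>v\<close> in the enlarged face; it occurs squared when the boundary removes
  \<open>v\<close> again.\<close>

definition cone_chain :: "'v \<Rightarrow> ('v set \<Rightarrow> 'k::field) \<Rightarrow> 'v set \<Rightarrow> 'k" where
  "cone_chain v e \<sigma> = (if v \<in> \<sigma> then osgn v (\<sigma> - {v}) * e (\<sigma> - {v}) else 0)"

lemma osgn_square: "osgn v \<tau> * osgn v \<tau> = (1 :: 'k::field)"
  unfolding osgn_def by (simp flip: power_mult_distrib)

lemma osgn_square': "osgn v \<tau> * (osgn v \<tau> * x) = (x :: 'k::field)"
  by (simp add: osgn_square flip: mult.assoc)

text \<open>The smaller of the two vertices counts as a predecessor of the larger but not
  conversely, so exactly one of the two signs flips. This is the minus sign in the cone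
  formula.\<close>

lemma osgn_swap:
  assumes "v \<noteq> w" "v \<notin> \<tau>" "w \<notin> \<tau>" "finite \<tau>"
  shows "osgn w (insert v \<tau>) * osgn v (insert w \<tau>) = - (osgn v \<tau> * osgn w \<tau> :: 'k::field)"
proof -
  have lin: "linear_order (vertex_order :: 'a rel)" by (rule linear_order_vertex_order)
  have ins: "osgn y (insert x \<tau>) = - (osgn y \<tau> :: 'k)" "osgn x (insert y \<tau>) = (osgn x \<tau> :: 'k)"
    if "(x, y) \<in> vertex_order" "x \<noteq> y" "x \<notin> \<tau>" "y \<notin> \<tau>" for x y
  proof -
    have "{u \<in> insert x \<tau>. (u, y) \<in> vertex_order} = insert x {u \<in> \<tau>. (u, y) \<in> vertex_order}"
      using that by auto
    then show "osgn y (insert x \<tau>) = - (osgn y \<tau> :: 'k)" using that assms(4) by (simp add: osgn_def)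
    have "(y, x) \<notin> vertex_order"
      using that lin by (auto simp: linear_order_on_def partial_order_on_def antisym_def)
    then have "{u \<in> insert y \<tau>. (u, x) \<in> vertex_order} = {u \<in> \<tau>. (u, x) \<in> vertex_order}" by auto
    then show "osgn x (insert y \<tau>) = (osgn x \<tau> :: 'k)" by (simp add: osgn_def)
  qed
  have "(v, w) \<in> vertex_order \<or> (w, v) \<in> vertex_order"
    using lin assms(1) by (auto simp: linear_order_on_def total_on_def)
  then show ?thesis using ins[of v w] ins[of w v] assms by auto
qed

lemma bd_eq_osgn: "bd V c \<tau> = (\<Sum>v\<in>V - \<tau>. osgn v \<tau> * c (insert v \<tau>))"
  unfolding boundary_map_def osgn_def by simp

text \<open>The cone formula. At a face without \<open>v\<close> only the removal of
  \<open>v\<close> contributes; at a face with \<open>v\<close>, \<open>osgn_swap\<close> turns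
  every other removal into a term of the negative join.\<close>

lemma bd_cone_chain:
  fixes e :: "'v set \<Rightarrow> 'k::field"
  assumes V: "finite V" "v \<in> V" and e: "e \<in> chain_space \<Gamma> q" "\<Gamma> \<subseteq> Pow V" "\<And>\<sigma>. \<sigma> \<in> \<Gamma> \<Longrightarrow> v \<notin> \<sigma>"
  shows "bd V (cone_chain v e) = e - cone_chain v (bd V e)"
proof
  fix \<tau>
  have ev: "e \<sigma> = 0" if "v \<in> \<sigma>" for \<sigma> using chain_spaceD[OF e(1)] e(3) that by blast
  have einf: "e \<sigma> = 0" if "infinite \<sigma>" for \<sigma>
  proof -
    have "\<sigma> \<notin> \<Gamma>" using e(2) V(1) that finite_subset[of \<sigma> V] by auto
    then show ?thesis using chain_spaceD[OF e(1)] by auto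
  qed
  show "bd V (cone_chain v e) \<tau> = (e - cone_chain v (bd V e)) \<tau>"
  proof (cases "v \<in> \<tau>")
    case False
    have "bd V (cone_chain v e) \<tau> = (\<Sum>w\<in>{v}. osgn w \<tau> * cone_chain v e (insert w \<tau>))"
      unfolding bd_eq_osgn using V False by (intro sum.mono_neutral_right) (auto simp: cone_chain_def)
    also have "\<dots> = e \<tau>" using False by (simp add: cone_chain_def osgn_square')
    finally show ?thesis using False by (simp add: cone_chain_def)
  next
    case True
    define \<rho> where "\<rho> = \<tau> - {v}"
    have \<rho>: "\<tau> = insert v \<rho>" "v \<notin> \<rho>" using True by (auto simp: \<rho>_def)
    have "bd V (cone_chain v e) \<tau> = (\<Sum>w\<in>V - \<tau>. - (osgn v \<rho> * (osgn w \<rho> * e (insert w \<rho>))))"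
      unfolding bd_eq_osgn
    proof (rule sum.cong)
      fix w assume w: "w \<in> V - \<tau>"
      have 1: "insert w \<tau> - {v} = insert w \<rho>" using w \<rho> by auto
      show "osgn w \<tau> * cone_chain v e (insert w \<tau>) = - (osgn v \<rho> * (osgn w \<rho> * e (insert w \<rho>)))"
      proof (cases "finite \<rho>")
        case True
        have "osgn w \<tau> * osgn v (insert w \<rho>) = - (osgn v \<rho> * osgn w \<rho> :: 'k)"
          unfolding \<rho>(1) using w \<rho> True by (intro osgn_swap) auto
        then show ?thesis using \<rho> 1 unfolding cone_chain_def by (simp add: mult.assoc[symmetric])
      next
        case False
        then show ?thesis using einf[of "insert w \<rho>"] 1 \<rho> by (simp add: cone_chain_def)
      qed
    qed simp
    also have "\<dots> = - (osgn v \<rho> * (\<Sum>w\<in>V - \<tau>. osgn w \<rho> * e (insert w \<rho>)))"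
      by (simp add: sum_negf sum_distrib_left)
    finally have 2: "bd V (cone_chain v e) \<tau> = - (osgn v \<rho> * (\<Sum>w\<in>V - \<tau>. osgn w \<rho> * e (insert w \<rho>)))" .
    have 3: "(\<Sum>w\<in>V - \<tau>. osgn w \<rho> * e (insert w \<rho>)) = bd V e \<rho>"
      unfolding bd_eq_osgn using V ev \<rho> by (intro sum.mono_neutral_left) auto
    show ?thesis unfolding 2 3 using True ev by (simp add: cone_chain_def \<rho>_def)
  qed
qed

definition delete_vertex :: "'v \<Rightarrow> 'v set set \<Rightarrow> 'v set set" where
  "delete_vertex v \<Gamma> = {\<sigma> \<in> \<Gamma>. v \<notin> \<sigma>}"

definition link :: "'v \<Rightarrow> 'v set set \<Rightarrow> 'v set set" where
  "link v \<Gamma> = {\<sigma>. v \<notin> \<sigma> \<and> insert v \<sigma> \<in> \<Gamma>}"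

text \<open>The coefficients at faces through \<open>v\<close>, read on the link; the sign inverts
  that of \<open>cone_chain\<close>, as \<open>chain_split\<close> requires.\<close>

definition link_part :: "'v \<Rightarrow> ('v set \<Rightarrow> 'k::field) \<Rightarrow> 'v set \<Rightarrow> 'k" where
  "link_part v z \<tau> = (if v \<in> \<tau> then 0 else osgn v \<tau> * z (insert v \<tau>))"

definition delete_part :: "'v \<Rightarrow> ('v set \<Rightarrow> 'k::field) \<Rightarrow> 'v set \<Rightarrow> 'k" where
  "delete_part v z \<tau> = (if v \<in> \<tau> then 0 else z \<tau>)"

lemma chain_split: "z = delete_part v z + cone_chain v (link_part v z)"
proof
  fix \<sigma>
  show "z \<sigma> = (delete_part v z + cone_chain v (link_part v z)) \<sigma>"
    by (cases "v \<in> \<sigma>") (simp_all add: delete_part_def link_part_def cone_chain_def osgn_square' insert_absorb)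
qed

lemma complex_on_delete_vertex: "complex_on V \<Gamma> \<Longrightarrow> complex_on V (delete_vertex v \<Gamma>)"
  unfolding complex_on_def delete_vertex_def by auto

lemma complex_on_link:
  assumes "complex_on V \<Gamma>"
  shows "complex_on V (link v \<Gamma>)"
proof -
  have "\<tau> \<in> link v \<Gamma>" if "\<sigma> \<in> link v \<Gamma>" "\<tau> \<subseteq> \<sigma>" for \<sigma> \<tau>
  proof -
    have "insert v \<sigma> \<in> \<Gamma>" "v \<notin> \<tau>" "insert v \<tau> \<subseteq> insert v \<sigma>" using that by (auto simp: link_def)
    then show ?thesis using assms by (simp add: complex_on_def link_def)
  qed
  moreover have "link v \<Gamma> \<subseteq> Pow V" using assms by (auto simp: complex_on_def link_def)
  ultimately show ?thesis using assms by (simp add: complex_on_def)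
qed

lemma link_subset_delete_vertex: "complex_on V \<Gamma> \<Longrightarrow> link v \<Gamma> \<subseteq> delete_vertex v \<Gamma>"
  unfolding complex_on_def link_def delete_vertex_def by auto

lemma delete_part_in: "z \<in> chain_space \<Gamma> q \<Longrightarrow> delete_part v z \<in> chain_space (delete_vertex v \<Gamma>) q"
  unfolding chain_space_def delete_part_def delete_vertex_def by auto

lemma link_part_in:
  assumes "z \<in> chain_space \<Gamma> (Suc q)"
  shows "link_part v z \<in> chain_space (link v \<Gamma>) q"
  unfolding chain_space_def
proof (intro CollectI allI impI)
  fix \<tau> assume "link_part v z \<tau> \<noteq> 0"
  then have 1: "v \<notin> \<tau>" "z (insert v \<tau>) \<noteq> 0" by (auto simp: link_part_def split: if_splits)
  then have 2: "insert v \<tau> \<in> \<Gamma>" "card (insert v \<tau>) = Suc q" using assms unfolding chain_space_def by blast+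
  then have "finite \<tau>" using card_ge_0_finite[of "insert v \<tau>"] by auto
  then show "\<tau> \<in> link v \<Gamma> \<and> card \<tau> = q" using 1 2 by (auto simp: link_def)
qed

lemma cone_chain_in:
  assumes "e \<in> chain_space (link v \<Gamma>) q" "complex_on V \<Gamma>"
  shows "cone_chain v e \<in> chain_space \<Gamma> (Suc q)"
  unfolding chain_space_def
proof (intro CollectI allI impI)
  fix \<tau> assume "cone_chain v e \<tau> \<noteq> 0"
  then have 1: "v \<in> \<tau>" "e (\<tau> - {v}) \<noteq> 0" by (auto simp: cone_chain_def split: if_splits)
  then have 2: "insert v (\<tau> - {v}) \<in> \<Gamma>" "card (\<tau> - {v}) = q"
    using assms unfolding chain_space_def link_def by blast+
  have \<tau>: "insert v (\<tau> - {v}) = \<tau>" using 1 by auto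
  have "finite \<tau>" using 2(1) assms(2) finite_subset[of \<tau> V] unfolding \<tau> complex_on_def by blast
  then show "\<tau> \<in> \<Gamma> \<and> card \<tau> = Suc q" using 1 2 \<tau> by (metis card_Suc_Diff1)
qed

lemma bd_cone_chain_link:
  assumes "complex_on V \<Gamma>" "v \<in> V" "e \<in> chain_space (link v \<Gamma>) q"
  shows "bd V (cone_chain v e) = e - cone_chain v (bd V e)"
proof (rule bd_cone_chain[OF _ assms(2,3)])
  show "finite V" using assms(1) unfolding complex_on_def by blast
  show "link v \<Gamma> \<subseteq> Pow V" using complex_on_link[OF assms(1)] unfolding complex_on_def by blast
  show "v \<notin> \<sigma>" if "\<sigma> \<in> link v \<Gamma>" for \<sigma> using that unfolding link_def by blast
qed

text \<open>For z = z0 + v * z1 the cone formula gives bd z = bd z0 + z1 - v * bd z1. Comparing the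
  faces that avoid \<open>v\<close> yields z1 = - bd z0, which is a cycle.\<close>

lemma link_part_cycle:
  fixes z :: "'v set \<Rightarrow> 'k::field"
  assumes \<Gamma>: "complex_on V \<Gamma>" and v: "v \<in> V" and z: "z \<in> chain_space \<Gamma> (Suc q)" "bd V z = 0"
  shows "link_part v z = - bd V (delete_part v z)" "bd V (link_part v z) = 0"
proof -
  let ?z0 = "delete_part v z" and ?z1 = "link_part v z"
  note z1 = link_part_in[OF z(1), of v]
  note z0 = delete_part_in[OF z(1), of v]
  have b0: "bd V z = bd V ?z0 + bd V (cone_chain v ?z1)"
    using bd_add[of V ?z0 "cone_chain v ?z1"] by (simp only: chain_split[of z v, symmetric])
  have b1: "bd V (cone_chain v ?z1) = ?z1 - cone_chain v (bd V ?z1)"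
    by (rule bd_cone_chain_link[OF \<Gamma> v z1])
  have eq: "bd V ?z0 + (?z1 - cone_chain v (bd V ?z1)) = 0" using b0 unfolding z(2) b1 by (rule sym)
  have bd0: "bd V ?z0 \<in> chain_space (delete_vertex v \<Gamma>) q"
    by (rule bd_in_chain_space[OF complex_on_delete_vertex[OF \<Gamma>] z0])
  show 1: "?z1 = - bd V ?z0"
  proof
    fix \<tau>
    show "?z1 \<tau> = (- bd V ?z0) \<tau>"
    proof (cases "v \<in> \<tau>")
      case True
      then have "bd V ?z0 \<tau> = 0" using chain_spaceD[OF bd0] by (auto simp: delete_vertex_def)
      then show ?thesis using True by (simp add: link_part_def)
    next
      case False
      then show ?thesis using fun_cong[OF eq, of \<tau>] by (simp add: cone_chain_def eq_neg_iff_add_eq_0 add.commute)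
    qed
  qed
  show "bd V ?z1 = 0"
    unfolding 1 bd_uminus using bd_bd[OF complex_on_delete_vertex[OF \<Gamma>] z0] by simp
qed

text \<open>Taking link parts sends cycles to cycles of the link, which accounts for
  \<open>m\<close>. If the link part bounds, say it is bd e, then adding the boundary of the cone
  over \<open>e\<close> turns the cycle into z0 + e, which avoids \<open>v\<close>; such cycles
  account for \<open>k\<close>.\<close>

lemma betti_le_delete_vertex:
  fixes \<Gamma> :: "'v set set"
  assumes \<Gamma>: "complex_on V \<Gamma>" and v: "v \<in> V"
    and del: "betti_le TYPE('k::field) V (delete_vertex v \<Gamma>) (Suc q) k"
    and lnk: "betti_le TYPE('k) V (link v \<Gamma>) q m"
  shows "betti_le TYPE('k) V \<Gamma> (Suc q) (k + m)"
proof -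
  let ?Z = "cycles V \<Gamma> (Suc q) :: ('v set \<Rightarrow> 'k) set"
  let ?B = "bounds V (link v \<Gamma>) q :: ('v set \<Rightarrow> 'k) set"
  let ?U = "{z \<in> ?Z. link_part v z \<in> ?B}"
  have "link_part v ` ?Z \<subseteq> cycles V (link v \<Gamma>) q"
  proof
    fix x assume "x \<in> link_part v ` ?Z"
    then obtain z where z: "x = link_part v z" "z \<in> chain_space \<Gamma> (Suc q)" "bd V z = 0"
      unfolding cycles_def by auto
    show "x \<in> cycles V (link v \<Gamma>) q"
      unfolding z(1) cycles_def using link_part_in[OF z(2), of v] link_part_cycle(2)[OF \<Gamma> v z(2,3)] by simp
  qed
  then have "codim_le (link_part v ` ?Z) ?B m"
    using lnk unfolding betti_le_def codim_le_def by (meson subset_trans)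
  then have 1: "codim_le ?Z ?U m"
    by (intro codim_le_preimage subspace_cycles subspace_bounds)
      (auto simp: fun_eq_iff link_part_def chain_scale_def algebra_simps)
  let ?Zd = "cycles V (delete_vertex v \<Gamma>) (Suc q) :: ('v set \<Rightarrow> 'k) set"
  let ?B1 = "bounds V \<Gamma> (Suc q) :: ('v set \<Rightarrow> 'k) set"
  have "z \<in> chain.span (?B1 \<union> ?Zd)" if z: "z \<in> ?U" for z
  proof -
    have zc: "z \<in> chain_space \<Gamma> (Suc q)" "bd V z = 0" using z by (auto simp: cycles_def)
    obtain e where e: "e \<in> chain_space (link v \<Gamma>) (Suc q)" "link_part v z = bd V e"
      using z unfolding bounds_def by blast
    have b: "bd V (cone_chain v e) = e - cone_chain v (bd V e)"
      by (rule bd_cone_chain_link[OF \<Gamma> v e(1)])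
    have eq: "z + bd V (cone_chain v e) = delete_part v z + e"
      unfolding b e(2)[symmetric] using chain_split[of z v] by (metis (no_types, lifting) add.assoc add_diff_cancel_left' diff_add_cancel add.commute)
    have "cone_chain v e \<in> chain_space \<Gamma> (Suc (Suc q))" by (rule cone_chain_in[OF e(1) \<Gamma>])
    then have B: "bd V (cone_chain v e) \<in> ?B1" unfolding bounds_def by blast
    have "bd V (z + bd V (cone_chain v e)) = 0"
      using zc(2) bd_bd[OF \<Gamma> \<open>cone_chain v e \<in> _\<close>] by (simp add: bd_add)
    moreover have "delete_part v z + e \<in> chain_space (delete_vertex v \<Gamma>) (Suc q)"
      using delete_part_in[OF zc(1)] e(1) chain_space_mono[OF link_subset_delete_vertex[OF \<Gamma>]]
      by (intro chain.subspace_add subspace_chain_space) blast+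
    ultimately have "z + bd V (cone_chain v e) \<in> ?Zd" unfolding cycles_def eq by simp
    with B have "(z + bd V (cone_chain v e)) - bd V (cone_chain v e) \<in> chain.span (?B1 \<union> ?Zd)"
      by (intro chain.span_diff chain.span_base) auto
    then show ?thesis by simp
  qed
  moreover have "codim_le (chain.span (?B1 \<union> ?Zd)) ?B1 k"
  proof -
    obtain F where F: "finite F" "card F \<le> k" "?Zd \<subseteq> chain.span (bounds V (delete_vertex v \<Gamma>) (Suc q) \<union> F)"
      using del unfolding betti_le_def codim_le_def by blast
    have "bounds V (delete_vertex v \<Gamma>) (Suc q) \<subseteq> ?B1" by (rule bounds_mono) (auto simp: delete_vertex_def)
    then have "?B1 \<union> ?Zd \<subseteq> chain.span (?B1 \<union> F)"
      using F(3) chain.span_superset[of "?B1 \<union> F"]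
        chain.span_mono[of "bounds V (delete_vertex v \<Gamma>) (Suc q) \<union> F" "?B1 \<union> F"] by blast
    then have "chain.span (?B1 \<union> ?Zd) \<subseteq> chain.span (?B1 \<union> F)"
      by (intro chain.span_minimal chain.subspace_span)
    then show ?thesis unfolding codim_le_def using F by blast
  qed
  ultimately have "codim_le ?U ?B1 k" unfolding codim_le_def by (meson subset_iff)
  from codim_le_trans[OF 1 this] show ?thesis unfolding betti_le_def by (simp add: add.commute)
qed

text \<open>The link equals the deletion, so the part z0 of a cycle can be coned off. As the link
  part is - bd z0, the boundary of that cone is the whole cycle.\<close>

lemma betti_le_cone:
  assumes \<Gamma>: "complex_on V \<Gamma>" and v: "v \<in> V" "\<And>\<sigma>. \<sigma> \<in> \<Gamma> \<Longrightarrow> insert v \<sigma> \<in> \<Gamma>"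
  shows "betti_le TYPE('k::field) V \<Gamma> q 0"
proof -
  have lnk: "link v \<Gamma> = delete_vertex v \<Gamma>"
    using v(2) link_subset_delete_vertex[OF \<Gamma>] by (auto simp: link_def delete_vertex_def)
  have "z \<in> bounds V \<Gamma> q" if z: "z \<in> cycles V \<Gamma> q" for z :: "'a set \<Rightarrow> 'k"
  proof -
    have zc: "z \<in> chain_space \<Gamma> q" "bd V z = 0" using z by (auto simp: cycles_def)
    let ?z0 = "delete_part v z"
    have z0: "?z0 \<in> chain_space (link v \<Gamma>) q" using delete_part_in[OF zc(1)] lnk by simp
    have "link_part v z = - bd V ?z0"
    proof (cases q)
      \<comment> \<open>\<open>link_part_cycle\<close> starts at index 1. Chains of index 0 live on
        the empty face only, so both sides vanish.\<close>
      case 0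
      have fin: "finite \<sigma>" if "\<sigma> \<in> \<Gamma>" for \<sigma> using \<Gamma> that by (auto simp: complex_on_def intro: finite_subset)
      have "c (insert w \<tau>) = 0" if "c \<in> chain_space \<Gamma> 0" for c :: "'a set \<Rightarrow> 'k" and w \<tau>
      proof (rule chain_spaceD[OF that])
        show "\<not> (insert w \<tau> \<in> \<Gamma> \<and> card (insert w \<tau>) = 0)"
          using fin[of "insert w \<tau>"] card_gt_0_iff[of "insert w \<tau>"] by auto
      qed
      moreover have "?z0 \<in> chain_space \<Gamma> 0"
        using delete_part_in[OF zc(1), of v] 0 chain_space_mono[of "delete_vertex v \<Gamma>" \<Gamma>]
        by (auto simp: delete_vertex_def)
      ultimately have "link_part v z \<tau> = 0" "bd V ?z0 \<tau> = 0" for \<tau>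
        using zc(1) 0 unfolding link_part_def bd_eq_osgn by (auto intro!: sum.neutral)
      then show ?thesis by (simp add: fun_eq_iff)
    next
      case (Suc p)
      then show ?thesis using link_part_cycle(1)[OF \<Gamma> v(1), of z p] zc by simp
    qed
    moreover have "bd V (cone_chain v ?z0) = ?z0 - cone_chain v (bd V ?z0)"
      by (rule bd_cone_chain_link[OF \<Gamma> v(1) z0])
    moreover have "cone_chain v (- bd V ?z0) = - cone_chain v (bd V ?z0)" by (auto simp: cone_chain_def fun_eq_iff)
    ultimately have "bd V (cone_chain v ?z0) = ?z0 + cone_chain v (link_part v z)" by simp
    also have "\<dots> = z" by (rule chain_split[symmetric])
    finally have "bd V (cone_chain v ?z0) = z" .
    then show ?thesis using imageI[OF cone_chain_in[OF z0 \<Gamma>], of "bd V"] unfolding bounds_def by simp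
  qed
  then show ?thesis unfolding betti_le_def using chain.span_superset by (intro codim_le_0I) blast
qed

section \<open>Unions and rainbow faces\<close>

lemma mem_span_subspace: "chain.subspace W \<Longrightarrow> x \<in> chain.span W \<Longrightarrow> x \<in> W"
  using chain.span_minimal[of W W] by auto

lemma cycles_subset_span_bounds:
  fixes \<Gamma> :: "'v set set"
  assumes "betti_le TYPE('k::field) V X q k" "X \<subseteq> \<Gamma>"
  obtains F where "finite F" "card F \<le> k" "(cycles V X q :: ('v set \<Rightarrow> 'k) set) \<subseteq> chain.span (bounds V \<Gamma> q \<union> F)"
proof -
  obtain F where F: "finite F" "card F \<le> k" "(cycles V X q :: ('v set \<Rightarrow> 'k) set) \<subseteq> chain.span (bounds V X q \<union> F)"
    using assms(1) unfolding betti_le_def codim_le_def by blast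
  have "chain.span (bounds V X q \<union> F) \<subseteq> chain.span (bounds V \<Gamma> q \<union> F)"
    using bounds_mono[OF assms(2), of V q] by (intro chain.span_mono) auto
  then show thesis using F that by (meson subset_trans)
qed

text \<open>The Mayer-Vietoris argument. Cutting a cycle into its part in \<open>X\<close> and the
  rest gives two chains with opposite boundaries, supported in the intersection. There this boundary
  is also that of some \<open>w\<close>, and shifting by \<open>w\<close> makes both parts
  cycles.\<close>

lemma betti_le_Un:
  fixes X Y :: "'v set set"
  assumes XY: "complex_on V X" "complex_on V Y"
    and int: "betti_le TYPE('k::field) V (X \<inter> Y) q 0"
    and X: "betti_le TYPE('k) V X (Suc q) k" and Y: "betti_le TYPE('k) V Y (Suc q) m"
  shows "betti_le TYPE('k) V (X \<union> Y) (Suc q) (k + m)"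
proof -
  let ?B = "bounds V (X \<union> Y) (Suc q) :: ('v set \<Rightarrow> 'k) set"
  obtain F where F: "finite F" "card F \<le> k" "cycles V X (Suc q) \<subseteq> chain.span (?B \<union> F)"
    using cycles_subset_span_bounds[OF X, of "X \<union> Y"] by auto
  obtain G where G: "finite G" "card G \<le> m" "cycles V Y (Suc q) \<subseteq> chain.span (?B \<union> G)"
    using cycles_subset_span_bounds[OF Y, of "X \<union> Y"] by auto
  let ?S = "chain.span (?B \<union> (F \<union> G))"
  have sub: "cycles V X (Suc q) \<subseteq> ?S" "cycles V Y (Suc q) \<subseteq> ?S"
    using F(3) G(3) chain.span_mono[of "?B \<union> F" "?B \<union> (F \<union> G)"] chain.span_mono[of "?B \<union> G" "?B \<union> (F \<union> G)"]
    by blast+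
  have "z \<in> ?S" if z: "z \<in> cycles V (X \<union> Y) (Suc q)" for z
  proof -
    define x where "x \<sigma> = (if \<sigma> \<in> X then z \<sigma> else 0)" for \<sigma>
    have zc: "z \<in> chain_space (X \<union> Y) (Suc q)" "bd V z = 0" using z by (auto simp: cycles_def)
    have x: "x \<in> chain_space X (Suc q)" using zc(1) unfolding chain_space_def x_def by auto
    have y: "z - x \<in> chain_space Y (Suc q)"
      using zc(1) unfolding chain_space_def x_def by (auto split: if_splits)
    have neg: "bd V (z - x) = - bd V x" using zc(2) by (simp add: bd_diff)
    have "bd V x \<in> chain_space X q" by (rule bd_in_chain_space[OF XY(1) x])
    moreover have "- bd V x \<in> chain_space Y q" using bd_in_chain_space[OF XY(2) y] neg by simp
    then have "bd V x \<in> chain_space Y q" using chain.subspace_neg[OF subspace_chain_space] by fastforce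
    ultimately have "bd V x \<in> chain_space (X \<inter> Y) q" unfolding chain_space_def by auto
    then have "bd V x \<in> cycles V (X \<inter> Y) q" using bd_bd[OF XY(1) x] by (simp add: cycles_def)
    then have "bd V x \<in> chain.span (bounds V (X \<inter> Y) q)"
      using int unfolding betti_le_def codim_le_def by auto
    then have "bd V x \<in> bounds V (X \<inter> Y) q" by (rule mem_span_subspace[OF subspace_bounds])
    then obtain w where w: "w \<in> chain_space (X \<inter> Y) (Suc q)" "bd V x = bd V w" unfolding bounds_def by auto
    have wX: "w \<in> chain_space X (Suc q)" and wY: "w \<in> chain_space Y (Suc q)"
      using w(1) unfolding chain_space_def by auto
    have "x - w \<in> cycles V X (Suc q)"
      using chain.subspace_diff[OF subspace_chain_space x wX] w(2) by (simp add: cycles_def bd_diff)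
    moreover have "(z - x) + w \<in> cycles V Y (Suc q)"
      using chain.subspace_add[OF subspace_chain_space y wY] w(2) neg by (simp add: cycles_def bd_add)
    ultimately have "(x - w) + ((z - x) + w) \<in> ?S"
      by (intro chain.span_add[of "x - w" _ "(z - x) + w"] subsetD[OF sub(1)] subsetD[OF sub(2)])
    then show ?thesis by simp
  qed
  moreover have "card (F \<union> G) \<le> k + m" using card_Un_le[of F G] F(2) G(2) by linarith
  ultimately show ?thesis
    unfolding betti_le_def codim_le_def using F(1) G(1) by (intro exI[of _ "F \<union> G"]) auto
qed

lemma betti_le_index_0: "complex_on V \<Gamma> \<Longrightarrow> betti_le TYPE('k::field) V \<Gamma> 0 1"
proof -
  assume "complex_on V \<Gamma>"
  then have "{\<sigma> \<in> \<Gamma>. card \<sigma> = 0} \<subseteq> {{}}" "finite \<Gamma>"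
    using finite_subset[of _ V] finite_subset[of \<Gamma> "Pow V"] by (auto simp: complex_on_def)
  let ?E = "(\<lambda>\<sigma> \<tau>. if \<tau> = \<sigma> then 1 else (0::'k)) ` {\<sigma> \<in> \<Gamma>. card \<sigma> = 0}"
  have "card ?E \<le> card {\<sigma> \<in> \<Gamma>. card \<sigma> = 0}" by (rule card_image_le) (use \<open>finite \<Gamma>\<close> in simp)
  also have "\<dots> \<le> card {{} :: 'a set}" by (rule card_mono) (use \<open>_ \<subseteq> {{}}\<close> in auto)
  finally have "card ?E \<le> 1" by simp
  moreover have "(cycles V \<Gamma> 0 :: ('a set \<Rightarrow> 'k) set) \<subseteq> chain.span (bounds V \<Gamma> 0 \<union> ?E)"
    using chain_space_subset_span[OF \<open>finite \<Gamma>\<close>, of 0, where 'k = 'k] chain.span_mono[of ?E "bounds V \<Gamma> 0 \<union> ?E"]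
    unfolding cycles_def by auto
  ultimately show ?thesis unfolding betti_le_def codim_le_def using \<open>finite \<Gamma>\<close> by (intro exI[of _ ?E]) auto
qed

text \<open>The empty face is the boundary of any vertex: reduced homology in dimension -1 only sees
  whether there is one.\<close>

lemma betti_le_index_0_vertex:
  assumes \<Gamma>: "complex_on V \<Gamma>" and x: "{x} \<in> \<Gamma>"
  shows "betti_le TYPE('k::field) V \<Gamma> 0 0"
proof -
  have xV: "x \<in> V" using assms by (auto simp: complex_on_def)
  have "z \<in> bounds V \<Gamma> 0" if z: "z \<in> cycles V \<Gamma> 0" for z :: "'a set \<Rightarrow> 'k"
  proof -
    have zc: "z \<in> chain_space \<Gamma> 0" using z by (auto simp: cycles_def)
    have supp: "\<sigma> = {}" if "z \<sigma> \<noteq> 0" for \<sigma>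
    proof -
      have "\<sigma> \<in> \<Gamma>" "card \<sigma> = 0" using zc that unfolding chain_space_def by auto
      then show ?thesis using \<Gamma> finite_subset[of \<sigma> V] by (auto simp: complex_on_def)
    qed
    have "z \<in> chain_space (link x \<Gamma>) 0"
      unfolding chain_space_def link_def using x by (auto dest!: supp)
    then have c: "cone_chain x z \<in> chain_space \<Gamma> (Suc 0)" "bd V (cone_chain x z) = z - cone_chain x (bd V z)"
      using cone_chain_in[OF _ \<Gamma>] bd_cone_chain_link[OF \<Gamma> xV] by auto
    have "bd V z = 0" using z by (simp add: cycles_def)
    then have "bd V (cone_chain x z) = z" using c(2) by (simp add: cone_chain_def fun_eq_iff)
    then show ?thesis using imageI[OF c(1), of "bd V"] unfolding bounds_def by simp
  qed
  then show ?thesis unfolding betti_le_def using chain.span_superset by (intro codim_le_0I) blast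
qed

section \<open>Faces with pairwise distinct colours\<close>

definition rainbow :: "'v set set \<Rightarrow> ('v \<Rightarrow> 'c) \<Rightarrow> nat \<Rightarrow> 'v set set" where
  "rainbow \<Gamma> \<kappa> n = {\<tau> \<in> \<Gamma>. card \<tau> = n \<and> inj_on \<kappa> \<tau>}"

text \<open>An exchange of one vertex for another of its colour inside a common coface. The boundary
  of that coface expresses either face by the other one and by faces with fewer colours.\<close>

definition rainbow_adj :: "'v set set \<Rightarrow> ('v \<Rightarrow> 'c) \<Rightarrow> nat \<Rightarrow> 'v set rel" where
  "rainbow_adj \<Gamma> \<kappa> n = {(\<tau>, \<tau>'). \<tau> \<in> rainbow \<Gamma> \<kappa> n \<and> \<tau>' \<in> rainbow \<Gamma> \<kappa> n \<and> \<kappa> ` \<tau> = \<kappa> ` \<tau>' \<and>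
     \<tau> \<union> \<tau>' \<in> \<Gamma> \<and> card (\<tau> \<union> \<tau>') = Suc n}"

lemma sym_rainbow_adj: "sym (rainbow_adj \<Gamma> \<kappa> n)"
  unfolding sym_def rainbow_adj_def by (auto simp: Un_commute)

definition indicator_chain :: "'v set \<Rightarrow> 'v set \<Rightarrow> 'k::field" where
  "indicator_chain \<sigma> \<tau> = (if \<tau> = \<sigma> then 1 else 0)"

lemma rainbow_adjE:
  assumes "(\<tau>, \<tau>') \<in> rainbow_adj \<Gamma> \<kappa> n"
  obtains x y where "x \<notin> \<tau>" "y \<notin> \<tau>'" "x \<in> \<tau>'" "y \<in> \<tau>" "\<tau> \<union> \<tau>' = insert x \<tau>" "\<tau> \<union> \<tau>' = insert y \<tau>'" "\<kappa> x = \<kappa> y"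
proof -
  have a: "card \<tau> = n" "card \<tau>' = n" "inj_on \<kappa> \<tau>" "inj_on \<kappa> \<tau>'" "\<kappa> ` \<tau> = \<kappa> ` \<tau>'" "card (\<tau> \<union> \<tau>') = Suc n"
    using assms unfolding rainbow_adj_def rainbow_def by auto
  have fin: "finite (\<tau> \<union> \<tau>')" using a(6) card_ge_0_finite[of "\<tau> \<union> \<tau>'"] by simp
  have "card ((\<tau> \<union> \<tau>') - \<tau>) = 1" "card ((\<tau> \<union> \<tau>') - \<tau>') = 1"
    using a fin by (simp_all add: card_Diff_subset)
  then obtain x y where x: "(\<tau> \<union> \<tau>') - \<tau> = {x}" and y: "(\<tau> \<union> \<tau>') - \<tau>' = {y}"
    by (metis card_1_singletonE)
  have x': "x \<notin> \<tau>" "x \<in> \<tau>'" and y': "y \<notin> \<tau>'" "y \<in> \<tau>" using x y by auto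
  then obtain w where w: "w \<in> \<tau>" "\<kappa> x = \<kappa> w" using a(5) by (metis image_iff)
  have "w \<notin> \<tau>'" using inj_onD[OF a(4) w(2) x'(2)] w(1) x'(1) by auto
  then have "w = y" using y w(1) by auto
  then show thesis using that[of x y] x y x' y' w by blast
qed

text \<open>In the boundary of the union, a facet other than \<open>\<tau>\<close> and
  \<open>\<tau>'\<close> contains both exchanged vertices, hence repeats a colour and belongs to the
  first part of \<open>W\<close>.\<close>

lemma indicator_chain_rainbow_adj:
  fixes \<Gamma> :: "'v set set" and \<kappa> :: "'v \<Rightarrow> 'c"
  assumes \<Gamma>: "complex_on V \<Gamma>" and adj: "(\<tau>, \<tau>') \<in> rainbow_adj \<Gamma> \<kappa> (Suc k)"
  defines "W \<equiv> chain_space {\<sigma> \<in> \<Gamma>. card (\<kappa> ` \<sigma>) \<le> k} (Suc k) \<union> bounds V \<Gamma> (Suc k) :: ('v set \<Rightarrow> 'k::field) set"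
  shows "indicator_chain \<tau> \<in> chain.span (W \<union> {indicator_chain \<tau>'})"
proof -
  obtain x y where xy: "x \<notin> \<tau>" "y \<notin> \<tau>'" "x \<in> \<tau>'" "y \<in> \<tau>" "\<tau> \<union> \<tau>' = insert x \<tau>" "\<tau> \<union> \<tau>' = insert y \<tau>'" "\<kappa> x = \<kappa> y"
    using rainbow_adjE[OF adj] by metis
  define \<rho> where "\<rho> = \<tau> \<union> \<tau>'"
  have \<rho>: "\<rho> \<in> \<Gamma>" "card \<rho> = Suc (Suc k)" and \<tau>: "card \<tau> = Suc k" "card \<tau>' = Suc k"
    using adj unfolding rainbow_adj_def rainbow_def \<rho>_def by auto
  have \<rho>V: "\<rho> \<subseteq> V" "finite V" using \<rho>(1) \<Gamma> by (auto simp: complex_on_def)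
  have xV: "x \<in> V" using xy \<rho>V by (auto simp: \<rho>_def)
  define b where "b = bd V (indicator_chain \<rho> :: 'v set \<Rightarrow> 'k)"
  have "indicator_chain \<rho> \<in> chain_space \<Gamma> (Suc (Suc k))"
    using \<rho> unfolding chain_space_def indicator_chain_def by auto
  then have bW: "b \<in> W" unfolding W_def b_def bounds_def by blast
  have "indicator_chain \<rho> \<in> chain_space (Pow \<rho>) (Suc (Suc k))"
    using \<rho> unfolding chain_space_def indicator_chain_def by auto
  then have supp: "b \<in> chain_space (Pow \<rho>) (Suc k)"
    unfolding b_def by (rule bd_in_chain_space[rotated]) (use \<rho>V in \<open>auto simp: complex_on_def\<close>)
  have "b \<tau> = (\<Sum>v\<in>{x}. osgn v \<tau> * indicator_chain \<rho> (insert v \<tau>))"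
    unfolding b_def bd_eq_osgn
  proof (rule sum.mono_neutral_right)
    show "\<forall>i\<in>V - \<tau> - {x}. osgn i \<tau> * indicator_chain \<rho> (insert i \<tau>) = 0"
    proof
      fix i assume i: "i \<in> V - \<tau> - {x}"
      then have "i \<notin> \<rho>" using xy(5) unfolding \<rho>_def by auto
      then have "insert i \<tau> \<noteq> \<rho>" by auto
      then show "osgn i \<tau> * indicator_chain \<rho> (insert i \<tau>) = 0" by (simp add: indicator_chain_def)
    qed
  qed (use \<rho>V xV xy(1) in auto)
  also have "\<dots> = osgn x \<tau>" using xy(5) by (simp add: indicator_chain_def \<rho>_def)
  finally have b\<tau>: "b \<tau> \<noteq> 0" using osgn_square[of x \<tau>, where 'k = 'k] by auto
  define r where "r = b - chain_scale (b \<tau>) (indicator_chain \<tau>) - chain_scale (b \<tau>') (indicator_chain \<tau>')"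
  have "\<tau> \<noteq> \<tau>'" using xy by auto
  have "\<sigma> \<in> \<Gamma> \<and> card (\<kappa> ` \<sigma>) \<le> k \<and> card \<sigma> = Suc k" if "r \<sigma> \<noteq> 0" for \<sigma>
  proof -
    have ne: "\<sigma> \<noteq> \<tau>" "\<sigma> \<noteq> \<tau>'" "b \<sigma> \<noteq> 0"
      using that \<open>\<tau> \<noteq> \<tau>'\<close> by (auto simp: r_def chain_scale_def indicator_chain_def split: if_splits)
    then have \<sigma>: "\<sigma> \<subseteq> \<rho>" "card \<sigma> = Suc k" using supp unfolding chain_space_def by auto
    have fin: "finite \<sigma>" and fin\<tau>: "finite \<tau>" "finite \<tau>'"
      using \<sigma>(2) \<tau> by (simp_all add: card_ge_0_finite)
    have "x \<in> \<sigma>"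
    proof (rule ccontr)
      assume "x \<notin> \<sigma>"
      then have "\<sigma> \<subseteq> \<tau>" using \<sigma>(1) xy(5) unfolding \<rho>_def by auto
      then show False using card_subset_eq[OF fin\<tau>(1), of \<sigma>] ne(1) \<sigma>(2) \<tau>(1) by simp
    qed
    moreover have "y \<in> \<sigma>"
    proof (rule ccontr)
      assume "y \<notin> \<sigma>"
      then have "\<sigma> \<subseteq> \<tau>'" using \<sigma>(1) xy(6) unfolding \<rho>_def by auto
      then show False using card_subset_eq[OF fin\<tau>(2), of \<sigma>] ne(2) \<sigma>(2) \<tau>(2) by simp
    qed
    moreover have "x \<noteq> y" using xy by auto
    ultimately have "\<not> inj_on \<kappa> \<sigma>" using xy(7) by (auto dest: inj_onD)
    then have "card (\<kappa> ` \<sigma>) \<noteq> card \<sigma>" using fin eq_card_imp_inj_on by blast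
    then have "card (\<kappa> ` \<sigma>) \<le> k" using card_image_le[OF fin, of \<kappa>] \<sigma>(2) by simp
    then show ?thesis using \<sigma> \<rho>(1) \<Gamma> unfolding complex_on_def by blast
  qed
  then have rW: "r \<in> W" unfolding W_def chain_space_def by auto
  have eq: "indicator_chain \<tau> = chain_scale (inverse (b \<tau>)) (b - chain_scale (b \<tau>') (indicator_chain \<tau>') - r)"
    using b\<tau> by (simp add: r_def chain_scale_def fun_eq_iff)
  show ?thesis
    by (subst eq) (intro chain.span_scale chain.span_diff chain.span_base; use bW rW in auto)
qed

text \<open>Modulo boundaries and faces with at most \<open>k\<close> colours, all chains are
  spanned by \<open>F\<close>. A cycle that vanishes in this quotient is c + b with a boundary
  \<open>b\<close>; then \<open>c\<close> is itself a cycle, in the complex to which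
  \<open>low\<close> applies.\<close>

lemma betti_le_rainbow:
  fixes \<Gamma> :: "'v set set" and \<kappa> :: "'v \<Rightarrow> 'c"
  assumes \<Gamma>: "complex_on V \<Gamma>"
    and low: "betti_le TYPE('k::field) V {\<sigma> \<in> \<Gamma>. card (\<kappa> ` \<sigma>) \<le> k} (Suc k) m"
    and F: "finite F" "\<And>\<tau>. \<tau> \<in> rainbow \<Gamma> \<kappa> (Suc k) \<Longrightarrow> \<exists>\<tau>'\<in>F. (\<tau>, \<tau>') \<in> (rainbow_adj \<Gamma> \<kappa> (Suc k))\<^sup>*"
  shows "betti_le TYPE('k) V \<Gamma> (Suc k) (card F + m)"
proof -
  let ?L = "{\<sigma> \<in> \<Gamma>. card (\<kappa> ` \<sigma>) \<le> k}"
  let ?C = "chain_space ?L (Suc k) :: ('v set \<Rightarrow> 'k) set" and ?B = "bounds V \<Gamma> (Suc k) :: ('v set \<Rightarrow> 'k) set"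
  let ?W = "chain.span (?C \<union> ?B)" and ?Z = "cycles V \<Gamma> (Suc k) :: ('v set \<Rightarrow> 'k) set"
  let ?S = "chain.span (?W \<union> indicator_chain ` F)"
  have finG: "finite \<Gamma>" using \<Gamma> finite_subset[of \<Gamma> "Pow V"] by (auto simp: complex_on_def)
  have star: "indicator_chain \<tau> \<in> chain.span ((?C \<union> ?B) \<union> {indicator_chain \<tau>'})"
    if "(\<tau>, \<tau>') \<in> (rainbow_adj \<Gamma> \<kappa> (Suc k))\<^sup>*" for \<tau> \<tau>'
    using that
  proof (induction rule: converse_rtrancl_induct)
    case base
    show ?case by (intro chain.span_base) auto
  next
    case (step \<tau> \<rho>)
    have "(?C \<union> ?B) \<union> {indicator_chain \<rho>} \<subseteq> chain.span ((?C \<union> ?B) \<union> {indicator_chain \<tau>'})"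
      using step.IH chain.span_superset[of "(?C \<union> ?B) \<union> {indicator_chain \<tau>'}"] by auto
    then have "chain.span ((?C \<union> ?B) \<union> {indicator_chain \<rho>}) \<subseteq> chain.span ((?C \<union> ?B) \<union> {indicator_chain \<tau>'})"
      by (intro chain.span_minimal chain.subspace_span)
    then show ?case using indicator_chain_rainbow_adj[OF \<Gamma> step.hyps(1)] by auto
  qed
  have ind: "(indicator_chain \<sigma> :: 'v set \<Rightarrow> 'k) \<in> ?S" if \<sigma>: "\<sigma> \<in> \<Gamma>" "card \<sigma> = Suc k" for \<sigma>
  proof (cases "inj_on \<kappa> \<sigma>")
    case True
    then have "\<sigma> \<in> rainbow \<Gamma> \<kappa> (Suc k)" using \<sigma> by (simp add: rainbow_def)
    then obtain \<tau> where \<tau>: "\<tau> \<in> F" "(\<sigma>, \<tau>) \<in> (rainbow_adj \<Gamma> \<kappa> (Suc k))\<^sup>*" using F(2) by blast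
    have "(?C \<union> ?B) \<union> {indicator_chain \<tau>} \<subseteq> ?W \<union> indicator_chain ` F"
      using \<tau>(1) chain.span_superset[of "?C \<union> ?B"] by auto
    then show ?thesis using chain.span_mono[of _ "?W \<union> indicator_chain ` F"] star[OF \<tau>(2)] by blast
  next
    case False
    have "finite \<sigma>" using \<sigma>(2) card_ge_0_finite[of \<sigma>] by simp
    then have "card (\<kappa> ` \<sigma>) \<noteq> card \<sigma>" using False eq_card_imp_inj_on by blast
    then have "card (\<kappa> ` \<sigma>) \<le> k" using card_image_le[OF \<open>finite \<sigma>\<close>, of \<kappa>] \<sigma>(2) by simp
    then have "(indicator_chain \<sigma> :: 'v set \<Rightarrow> 'k) \<in> ?C"
      using \<sigma> unfolding chain_space_def indicator_chain_def by auto
    then show ?thesis by (intro chain.span_base UnI1) auto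
  qed
  have "(\<lambda>\<sigma> \<tau>. if \<tau> = \<sigma> then 1 else (0::'k)) ` {\<sigma> \<in> \<Gamma>. card \<sigma> = Suc k} \<subseteq> ?S"
    using ind unfolding indicator_chain_def by auto
  then have "chain_space \<Gamma> (Suc k) \<subseteq> ?S"
    using chain_space_subset_span[OF finG, of "Suc k", where 'k = 'k] chain.span_minimal[OF _ chain.subspace_span] by blast
  then have ZS: "?Z \<subseteq> ?S" unfolding cycles_def by auto
  have "card (indicator_chain ` F :: ('v set \<Rightarrow> 'k) set) \<le> card F" by (rule card_image_le[OF F(1)])
  \<comment> \<open>The preimage under the identity intersects \<open>?W\<close> with the cycles, at
    a cost of at most \<open>card F\<close>.\<close>
  with ZS have "codim_le (id ` ?Z) ?W (card F)"
    unfolding codim_le_def using F(1) by (intro exI[of _ "indicator_chain ` F"]) auto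
  then have 1: "codim_le ?Z {z \<in> ?Z. id z \<in> ?W} (card F)"
    by (intro codim_le_preimage subspace_cycles chain.subspace_span) auto
  obtain G where G: "finite G" "card G \<le> m" "(cycles V ?L (Suc k) :: ('v set \<Rightarrow> 'k) set) \<subseteq> chain.span (?B \<union> G)"
    using cycles_subset_span_bounds[OF low, of \<Gamma>] by auto
  have "z \<in> chain.span (?B \<union> G)" if z: "z \<in> ?Z" "z \<in> ?W" for z
  proof -
    obtain c b where cb: "z = c + b" "c \<in> ?C" "b \<in> ?B"
      using z(2) mem_span_subspace[OF subspace_chain_space] mem_span_subspace[OF subspace_bounds]
      unfolding chain.span_Un by blast
    have "b \<in> ?Z" using cb(3) bounds_subset_cycles[OF \<Gamma>] by auto
    then have "bd V c = 0" using z(1) unfolding cb(1) cycles_def by (simp add: bd_add)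
    then have "c \<in> cycles V ?L (Suc k)" using cb(2) by (simp add: cycles_def)
    then have "c \<in> chain.span (?B \<union> G)" using G(3) by auto
    moreover have "b \<in> chain.span (?B \<union> G)" using cb(3) by (intro chain.span_base) auto
    ultimately show ?thesis unfolding cb(1) by (rule chain.span_add)
  qed
  then have "codim_le {z \<in> ?Z. id z \<in> ?W} ?B m" unfolding codim_le_def using G(1,2) by (intro exI[of _ G]) auto
  from codim_le_trans[OF 1 this] show ?thesis unfolding betti_le_def .
qed

section \<open>Clique complexes\<close>

definition clique_complex :: "('v \<Rightarrow> 'v \<Rightarrow> bool) \<Rightarrow> 'v set \<Rightarrow> 'v set set" where
  "clique_complex E T = {\<sigma>. \<sigma> \<subseteq> T \<and> (\<forall>x\<in>\<sigma>. \<forall>y\<in>\<sigma>. E x y)}"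

lemma complex_on_clique_complex: "finite V \<Longrightarrow> T \<subseteq> V \<Longrightarrow> complex_on V (clique_complex E T)"
  unfolding complex_on_def clique_complex_def by blast

lemma delete_vertex_clique_complex: "v \<notin> T \<Longrightarrow> delete_vertex v (clique_complex E (insert v T)) = clique_complex E T"
  unfolding delete_vertex_def clique_complex_def by auto

lemma link_clique_complex:
  assumes "reflp E" "symp E" "v \<notin> T"
  shows "link v (clique_complex E (insert v T)) = clique_complex E {x \<in> T. E v x}"
  using reflpD[OF assms(1)] sympD[OF assms(2)] assms(3) unfolding link_def clique_complex_def by fastforce

lemma betti_le_clique_insert:
  assumes E: "reflp E" "symp E" and V: "finite V" "insert v T \<subseteq> V" "v \<notin> T"
    and del: "betti_le TYPE('k::field) V (clique_complex E T) (Suc q) k"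
    and lnk: "betti_le TYPE('k) V (clique_complex E {x \<in> T. E v x}) q m"
  shows "betti_le TYPE('k) V (clique_complex E (insert v T)) (Suc q) (k + m)"
  using betti_le_delete_vertex[OF complex_on_clique_complex[OF V(1,2)], of v E q k m] V del lnk
  by (simp add: delete_vertex_clique_complex link_clique_complex E)

lemma betti_le_clique_apex:
  assumes E: "reflp E" "symp E" and V: "finite V" "T \<subseteq> V" "v \<in> T" "\<And>x. x \<in> T \<Longrightarrow> E v x"
  shows "betti_le TYPE('k::field) V (clique_complex E T) q 0"
proof (rule betti_le_cone[OF complex_on_clique_complex[OF V(1,2)]])
  show "v \<in> V" using V by auto
  show "insert v \<sigma> \<in> clique_complex E T" if "\<sigma> \<in> clique_complex E T" for \<sigma>
    using that V sympD[OF E(2)] unfolding clique_complex_def by auto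
qed

lemma betti_le_clique_empty: "betti_le TYPE('k::field) V (clique_complex E {}) (Suc q) 0"
  by (rule betti_le_no_faces) (auto simp: clique_complex_def)

text \<open>A disjoint union of simplices has reduced homology in dimension at most 0, that is,
  below index 2. In the induction, transitivity makes any neighbour of \<open>v\<close> an apex of
  its link.\<close>

lemma betti_le_clique_transitive:
  assumes E: "reflp E" "symp E" and V: "finite V" "T \<subseteq> V"
    and tr: "\<And>x y z. x \<in> T \<Longrightarrow> y \<in> T \<Longrightarrow> z \<in> T \<Longrightarrow> E x y \<Longrightarrow> E y z \<Longrightarrow> E x z"
  shows "betti_le TYPE('k::field) V (clique_complex E T) (Suc (Suc q)) 0"
proof -
  have "finite T" using V finite_subset by auto
  then show ?thesis using V(2) tr
  proof (induction T rule: finite_induct)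
    case empty
    show ?case by (rule betti_le_clique_empty)
  next
    case (insert v T)
    let ?N = "{x \<in> T. E v x}"
    have IH: "betti_le TYPE('k) V (clique_complex E T) (Suc (Suc q)) 0"
      using insert.prems by (intro insert.IH) auto
    have "betti_le TYPE('k) V (clique_complex E ?N) (Suc q) 0"
    proof (cases "?N = {}")
      case True
      show ?thesis unfolding True by (rule betti_le_clique_empty)
    next
      case False
      then obtain w where w: "w \<in> ?N" by blast
      have "E w x" if "x \<in> ?N" for x
        using insert.prems(2)[of w v x] w that sympD[OF E(2)] by auto
      then show ?thesis using insert.prems(1) w by (intro betti_le_clique_apex[OF E V(1), of _ w]) auto
    qed
    from betti_le_clique_insert[OF E V(1) insert.prems(1) insert.hyps(2) IH this] show ?case by simp
  qed
qed

text \<open>The vertices of \<open>D\<close> are added one at a time. Each link is taken among the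
  vertices already present, hence the arbitrary \<open>U\<close> in the hypothesis.\<close>

lemma betti_le_clique_Un:
  assumes E: "reflp E" "symp E" and V: "finite V" "T \<union> D \<subseteq> V"
    and T: "betti_le TYPE('k::field) V (clique_complex E T) (Suc q) k"
    and lnk: "\<And>v U. v \<in> D \<Longrightarrow> U \<subseteq> T \<union> D \<Longrightarrow> v \<notin> U \<Longrightarrow> betti_le TYPE('k) V (clique_complex E {x \<in> U. E v x}) q m"
  shows "betti_le TYPE('k) V (clique_complex E (T \<union> D)) (Suc q) (k + m * card D)"
proof -
  have "finite D" using V finite_subset[of D V] by auto
  then have "D \<subseteq> D' \<Longrightarrow> T \<union> D' \<subseteq> V \<Longrightarrow>
      (\<And>v U. v \<in> D' \<Longrightarrow> U \<subseteq> T \<union> D' \<Longrightarrow> v \<notin> U \<Longrightarrow> betti_le TYPE('k) V (clique_complex E {x \<in> U. E v x}) q m) \<Longrightarrow>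
      betti_le TYPE('k) V (clique_complex E (T \<union> D)) (Suc q) (k + m * card D)" for D'
  proof (induction D rule: finite_induct)
    case empty
    then show ?case using T by simp
  next
    case (insert v D)
    have IH: "betti_le TYPE('k) V (clique_complex E (T \<union> D)) (Suc q) (k + m * card D)"
      using insert by auto
    show ?case
    proof (cases "v \<in> T")
      case True
      then show ?thesis using IH insert.hyps by (auto simp: insert_absorb intro: betti_le_mono)
    next
      case False
      have "betti_le TYPE('k) V (clique_complex E (insert v (T \<union> D))) (Suc q) (k + m * card D + m)"
      proof (rule betti_le_clique_insert[OF E V(1) _ _ IH])
        show "betti_le TYPE('k) V (clique_complex E {x \<in> T \<union> D. E v x}) q m"
          using insert.prems(1) insert.hyps(2) False by (intro insert.prems(3)) auto
      qed (use insert.prems insert.hyps False in auto)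
      then show ?thesis using insert.hyps by (simp add: algebra_simps)
    qed
  qed
  from this[OF subset_refl V(2) lnk] show ?thesis .
qed

lemma betti_le_clique_vertices:
  assumes E: "reflp E" "symp E" and V: "finite V" "D \<subseteq> V"
    and lnk: "\<And>v U. v \<in> D \<Longrightarrow> U \<subseteq> D \<Longrightarrow> v \<notin> U \<Longrightarrow> betti_le TYPE('k::field) V (clique_complex E {x \<in> U. E v x}) q m"
  shows "betti_le TYPE('k) V (clique_complex E D) (Suc q) (m * card D)"
proof -
  have "betti_le TYPE('k) V (clique_complex E ({} \<union> D)) (Suc q) (0 + m * card D)"
    by (rule betti_le_clique_Un[OF E V(1)]) (use V(2) lnk betti_le_clique_empty in auto)
  then show ?thesis by simp
qed

text \<open>A new vertex of an old colour has a neighbour, so its link is nonempty and costs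
  nothing; a new colour adds at most one component.\<close>

lemma betti_le_1_colours:
  fixes \<kappa> :: "'v \<Rightarrow> 'c"
  assumes E: "reflp E" "symp E" and V: "finite V" "T \<subseteq> V"
    and col: "\<And>x y. x \<in> T \<Longrightarrow> y \<in> T \<Longrightarrow> \<kappa> x = \<kappa> y \<Longrightarrow> E x y"
  shows "betti_le TYPE('k::field) V (clique_complex E T) (Suc 0) (card (\<kappa> ` T))"
proof -
  have "finite T" using V finite_subset by auto
  then show ?thesis using V(2) col
  proof (induction T rule: finite_induct)
    case empty
    show ?case using betti_le_clique_empty by simp
  next
    case (insert v T)
    let ?N = "{x \<in> T. E v x}"
    have IH: "betti_le TYPE('k) V (clique_complex E T) (Suc 0) (card (\<kappa> ` T))"
      using insert.prems by (intro insert.IH) auto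
    have N: "complex_on V (clique_complex E ?N)"
      using insert.prems(1) by (intro complex_on_clique_complex V) auto
    note ins = betti_le_clique_insert[OF E V(1) insert.prems(1) insert.hyps(2) IH]
    show ?case
    proof (cases "\<kappa> v \<in> \<kappa> ` T")
      case True
      then obtain x where x: "x \<in> T" "\<kappa> v = \<kappa> x" by auto
      then have "{x} \<in> clique_complex E ?N"
        using insert.prems(2)[of v x] reflpD[OF E(1)] by (auto simp: clique_complex_def)
      then have "betti_le TYPE('k) V (clique_complex E ?N) 0 0" by (rule betti_le_index_0_vertex[OF N])
      from ins[OF this] True show ?thesis by (simp add: insert_absorb)
    next
      case False
      from ins[OF betti_le_index_0[OF N]] False insert.hyps show ?thesis by simp
    qed
  qed
qed

text \<open>Within the neighbourhood of a point each colour class is a clique, and there are at most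
  \<open>K\<close> of them. The bounds in this context use no metric, only this and explicit
  combinatorial hypotheses.\<close>

locale coloured_graph =
  fixes E :: "'v \<Rightarrow> 'v \<Rightarrow> bool" and \<kappa> :: "'v \<Rightarrow> 'c" and S :: "'v set" and K :: nat
  assumes reflE: "reflp E" and symE: "symp E" and finS: "finite S"
    and common_neighbour: "\<And>x y z. x \<in> S \<Longrightarrow> y \<in> S \<Longrightarrow> z \<in> S \<Longrightarrow> E z x \<Longrightarrow> E z y \<Longrightarrow> \<kappa> x = \<kappa> y \<Longrightarrow> E x y"
    and card_colours: "card (\<kappa> ` S) \<le> K"
begin

lemma betti_le_1_link:
  assumes "v \<in> S" "U \<subseteq> S"
  shows "betti_le TYPE('k::field) S (clique_complex E {x \<in> U. E v x}) (Suc 0) K"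
proof -
  have "betti_le TYPE('k::field) S (clique_complex E {x \<in> U. E v x}) (Suc 0) (card (\<kappa> ` {x \<in> U. E v x}))"
    using assms common_neighbour[of _ _ v] by (intro betti_le_1_colours reflE symE finS) auto
  moreover have "card (\<kappa> ` {x \<in> U. E v x}) \<le> card (\<kappa> ` S)"
    using assms finS by (intro card_mono) auto
  ultimately show ?thesis using card_colours by (auto intro: betti_le_mono)
qed

lemma betti_le_2:
  assumes "T \<subseteq> S"
  shows "betti_le TYPE('k::field) S (clique_complex E T) (Suc (Suc 0)) (K * card T)"
  by (rule betti_le_clique_vertices[OF reflE symE finS assms]) (use assms betti_le_1_link in blast)

text \<open>The common neighbours of \<open>v\<close> and \<open>w\<close> form a cone with apex
  \<open>w\<close> once \<open>w\<close> is one of them, and by \<open>common_neighbour\<close> a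
  single common neighbour already makes \<open>v\<close> and \<open>w\<close> adjacent. Each of the
  at most \<open>D\<close> other vertices of the link costs \<open>K\<close>.\<close>

lemma betti_le_2_link:
  assumes v: "v \<in> S" "w \<in> S" "U \<subseteq> S" "w \<in> U" "\<kappa> v = \<kappa> w"
    and D: "card {x \<in> S. E v x \<and> \<not> E w x} \<le> D"
  shows "betti_le TYPE('k::field) S (clique_complex E {x \<in> U. E v x}) (Suc (Suc 0)) (K * D)"
proof -
  let ?D = "{x \<in> U. E v x \<and> \<not> E w x}" and ?T = "{x \<in> U. E v x \<and> E w x}"
  have "card ?D \<le> card {x \<in> S. E v x \<and> \<not> E w x}" using v finS by (intro card_mono) auto
  then have cD: "K * card ?D \<le> K * D" using D by simp
  show ?thesis
  proof (cases "?T = {}")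
    \<comment> \<open>Here \<open>w\<close> is missing from the link, but then the whole link has at
      most \<open>D\<close> vertices.\<close>
    case True
    then have "{x \<in> U. E v x} = ?D" by auto
    then show ?thesis using v(3) by (simp only:) (rule betti_le_mono[OF betti_le_2 cD], auto)
  next
    case False
    then obtain x where x: "x \<in> U" "E v x" "E w x" by auto
    have "E v w" using common_neighbour[of v w x] x v sympD[OF symE] by auto
    then have w: "w \<in> ?T" using v reflpD[OF reflE] by auto
    have "betti_le TYPE('k) S (clique_complex E (?T \<union> ?D)) (Suc (Suc 0)) (0 + K * card ?D)"
    proof (rule betti_le_clique_Un[OF reflE symE finS])
      show "betti_le TYPE('k) S (clique_complex E ?T) (Suc (Suc 0)) 0"
        using v(3) w by (intro betti_le_clique_apex[OF reflE symE finS, of _ w]) auto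
      show "betti_le TYPE('k) S (clique_complex E {x \<in> U'. E u x}) (Suc 0) K"
        if "u \<in> ?D" "U' \<subseteq> ?T \<union> ?D" for u U'
        using that v(3) by (intro betti_le_1_link) auto
    qed (use v in auto)
    moreover have "?T \<union> ?D = {x \<in> U. E v x}" by auto
    ultimately show ?thesis using cD by (auto intro: betti_le_mono)
  qed
qed

text \<open>A vertex \<open>v\<close> whose class (its value under \<open>\<theta>\<close>) still contains another vertex \<open>w\<close> is cheap to
  delete: its link is a cone with apex \<open>w\<close> up to at most \<open>D\<close> vertices.\<close>

lemma betti_le_3_classes:
  fixes \<theta> :: "'v \<Rightarrow> 'b"
  assumes D: "\<And>v w. v \<in> S \<Longrightarrow> w \<in> S \<Longrightarrow> \<theta> v = \<theta> w \<Longrightarrow> \<kappa> v = \<kappa> w \<and> card {x \<in> S. E v x \<and> \<not> E w x} \<le> D"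
    and n: "card S \<le> n"
  shows "betti_le TYPE('k::field) S (clique_complex E S) (Suc (Suc (Suc 0))) (K * D * card S + card (\<theta> ` S) * (K * n))"
proof -
  have "betti_le TYPE('k::field) S (clique_complex E T) (Suc (Suc (Suc 0))) (K * D * card T + card (\<theta> ` T) * (K * n))"
    if "T \<subseteq> S" for T
  proof -
    have "finite T" using that finS finite_subset by auto
    then show ?thesis using that
    proof (induction T rule: finite_induct)
      case empty
      then show ?case using betti_le_clique_empty by simp
    next
      case (insert v T)
      let ?N = "{x \<in> T. E v x}"
      have IH: "betti_le TYPE('k) S (clique_complex E T) (Suc (Suc (Suc 0))) (K * D * card T + card (\<theta> ` T) * (K * n))"
        using insert by auto
      note ins = betti_le_clique_insert[OF reflE symE finS insert.prems insert.hyps(2) IH]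
      show ?case
      proof (cases "\<theta> v \<in> \<theta> ` T")
        case True
        then obtain w where w: "w \<in> T" "\<theta> v = \<theta> w" by auto
        then have "betti_le TYPE('k) S (clique_complex E ?N) (Suc (Suc 0)) (K * D)"
          using D[of v w] insert.prems by (intro betti_le_2_link[of v w]) auto
        from ins[OF this] True insert.hyps show ?thesis by (simp add: insert_absorb algebra_simps)
      next
        \<comment> \<open>No partner is present for the first vertex of a class; the linear bound on
          \<beta>_1 of its link is paid once per class.\<close>
        case False
        have "card ?N \<le> card S" using insert.prems finS by (intro card_mono) auto
        then have "K * card ?N \<le> K * n" using n by simp
        then have "betti_le TYPE('k) S (clique_complex E ?N) (Suc (Suc 0)) (K * n)"
          using insert.prems by (intro betti_le_mono[OF betti_le_2]) auto
        from ins[OF this] False insert.hyps show ?thesis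
          by (auto simp: algebra_simps intro: betti_le_mono)
      qed
    qed
  qed
  from this[OF subset_refl] show ?thesis .
qed

end

section \<open>Ball traces, hitting sets and grid colourings\<close>

text \<open>Averaging: every set not yet hit has more than \<open>\<epsilon> * n\<close> of the at
  most \<open>n\<close> points, so some point lies in at least an \<epsilon>-fraction of these sets,
  and choosing it leaves at most the fraction 1 - \<epsilon>.\<close>

lemma greedy_hitting_set:
  fixes \<epsilon> :: real
  assumes fin: "finite S" "finite \<F>" and n: "card S \<le> n" "n > 0" and \<epsilon>: "0 \<le> \<epsilon>" "\<epsilon> \<le> 1"
    and \<F>: "\<And>F. F \<in> \<F> \<Longrightarrow> F \<subseteq> S \<and> \<epsilon> * real n < real (card F)"
  shows "\<exists>T\<subseteq>S. card T \<le> s \<and> real (card {F \<in> \<F>. F \<inter> T = {}}) \<le> (1 - \<epsilon>) ^ s * real (card \<F>)"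
proof (induction s)
  case 0
  show ?case by (intro exI[of _ "{}"]) auto
next
  case (Suc s)
  then obtain T where T: "T \<subseteq> S" "card T \<le> s"
    "real (card {F \<in> \<F>. F \<inter> T = {}}) \<le> (1 - \<epsilon>) ^ s * real (card \<F>)" by blast
  let ?G = "{F \<in> \<F>. F \<inter> T = {}}"
  have finG: "finite ?G" using fin by simp
  show ?case
  proof (cases "?G = {}")
    case True
    have "(0::real) \<le> (1 - \<epsilon>) ^ Suc s * real (card \<F>)" using \<epsilon> by simp
    then show ?thesis using T(1,2) unfolding True[symmetric] by (intro exI[of _ T]) (simp add: True)
  next
    case False
    have "\<exists>x\<in>S. \<epsilon> * real (card ?G) \<le> real (card {F \<in> ?G. x \<in> F})"
    proof (rule ccontr)
      assume "\<not> ?thesis"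
      then have lt: "\<And>x. x \<in> S \<Longrightarrow> real (card {F \<in> ?G. x \<in> F}) \<le> \<epsilon> * real (card ?G)" by force
      have "(\<Sum>F\<in>?G. \<epsilon> * real n) < (\<Sum>F\<in>?G. real (card F))"
        using \<F> False finG by (intro sum_strict_mono) auto
      also have "\<dots> = (\<Sum>F\<in>?G. \<Sum>x\<in>S. if x \<in> F then 1 else 0)"
      proof (rule sum.cong)
        fix F assume "F \<in> ?G"
        then have "F \<subseteq> S" using \<F> by auto
        then have "S \<inter> {x. x \<in> F} = F" by auto
        then show "real (card F) = (\<Sum>x\<in>S. if x \<in> F then 1 else 0)"
          using fin(1) by (simp add: sum.If_cases)
      qed simp
      also have "\<dots> = (\<Sum>x\<in>S. \<Sum>F\<in>?G. if x \<in> F then 1 else 0)" by (rule sum.swap)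
      also have "\<dots> = (\<Sum>x\<in>S. real (card {F \<in> ?G. x \<in> F}))"
        using finG by (intro sum.cong) (auto simp: sum.If_cases Int_def)
      also have "\<dots> \<le> (\<Sum>x\<in>S. \<epsilon> * real (card ?G))" by (intro sum_mono lt)
      also have "\<dots> = real (card S) * (\<epsilon> * real (card ?G))" by simp
      also have "\<dots> \<le> real n * (\<epsilon> * real (card ?G))" using n \<epsilon> by (intro mult_right_mono) auto
      finally show False by (simp add: algebra_simps)
    qed
    then obtain x where x: "x \<in> S" "\<epsilon> * real (card ?G) \<le> real (card {F \<in> ?G. x \<in> F})" by blast
    have "{F \<in> \<F>. F \<inter> insert x T = {}} = ?G - {F \<in> ?G. x \<in> F}" by auto
    moreover have "card (?G - {F \<in> ?G. x \<in> F}) = card ?G - card {F \<in> ?G. x \<in> F}"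
      by (rule card_Diff_subset) (use fin(2) in auto)
    ultimately have "card {F \<in> \<F>. F \<inter> insert x T = {}} = card ?G - card {F \<in> ?G. x \<in> F}"
      by (simp only:)
    moreover have "card {F \<in> ?G. x \<in> F} \<le> card ?G" using finG by (intro card_mono) auto
    ultimately have "real (card {F \<in> \<F>. F \<inter> insert x T = {}}) \<le> (1 - \<epsilon>) * real (card ?G)"
      using x(2) by (simp add: of_nat_diff algebra_simps)
    also have "\<dots> \<le> (1 - \<epsilon>) * ((1 - \<epsilon>) ^ s * real (card \<F>))" using T(3) \<epsilon> by (intro mult_left_mono) auto
    finally have "real (card {F \<in> \<F>. F \<inter> insert x T = {}}) \<le> (1 - \<epsilon>) ^ Suc s * real (card \<F>)" by (simp add: mult.assoc)
    moreover have "card (insert x T) \<le> Suc s" using T(2) card_insert_le_m1[of "Suc s" T x] by simp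
    ultimately show ?thesis using T(1) x(1) by (intro exI[of _ "insert x T"]) auto
  qed
qed

section \<open>Shattering and traces of balls\<close>

definition shatters :: "'a set set \<Rightarrow> 'a set \<Rightarrow> bool" where
  "shatters \<F> Y \<longleftrightarrow> (\<forall>Z\<subseteq>Y. \<exists>F\<in>\<F>. F \<inter> Y = Z)"

text \<open>Pajor's form of the Sauer--Shelah lemma.\<close>

lemma shattersE: "shatters \<F> Y \<Longrightarrow> Z \<subseteq> Y \<Longrightarrow> (\<And>F. F \<in> \<F> \<Longrightarrow> F \<inter> Y = Z \<Longrightarrow> thesis) \<Longrightarrow> thesis"
  unfolding shatters_def by blast

text \<open>Split the family by membership of \<open>x\<close> and remove \<open>x\<close>. What one
  half shatters is shattered by \<open>\<F>\<close>, and a set \<open>Y\<close> shattered by both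
  halves counts twice, as \<open>Y\<close> and as \<open>insert x Y\<close>, so the two bounds add
  up.\<close>

lemma card_le_card_shattered:
  assumes "finite X" "\<F> \<subseteq> Pow X"
  shows "card \<F> \<le> card {Y. Y \<subseteq> X \<and> shatters \<F> Y}"
  using assms
proof (induction X arbitrary: \<F> rule: finite_induct)
  case empty
  then have "\<F> = {} \<or> \<F> = {{}}" by auto
  then show ?case
  proof
    assume "\<F> = {{}}"
    then have "{Y. Y \<subseteq> {} \<and> shatters \<F> Y} = {{}}" by (auto simp: shatters_def)
    then show ?thesis using \<open>\<F> = {{}}\<close> by simp
  qed simp
next
  case (insert x X)
  let ?FA = "{F \<in> \<F>. x \<notin> F}" and ?G = "{F \<in> \<F>. x \<in> F}"
  let ?FB = "(\<lambda>F. F - {x}) ` ?G"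
  let ?SA = "{Y. Y \<subseteq> X \<and> shatters ?FA Y}" and ?SB = "{Y. Y \<subseteq> X \<and> shatters ?FB Y}"
  let ?S = "{Y. Y \<subseteq> insert x X \<and> shatters \<F> Y}"
  have finF: "finite \<F>" using insert.prems insert.hyps(1) finite_subset[of \<F> "Pow (insert x X)"] by auto
  have finS: "finite ?SA" "finite ?SB" "finite ?S" using insert.hyps(1) by auto
  have "inj_on (\<lambda>F. F - {x}) ?G" by (auto simp: inj_on_def)
  then have "card ?FB = card ?G" by (rule card_image)
  moreover have "card \<F> = card ?FA + card ?G"
  proof -
    have "\<F> = ?FA \<union> ?G" by auto
    then show ?thesis using card_Un_disjoint[of ?FA ?G] finF by auto
  qed
  moreover have "card ?FA \<le> card ?SA" "card ?FB \<le> card ?SB"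
    using insert.prems by (auto intro!: insert.IH)
  moreover have "card ?SA + card ?SB = card (?SA \<union> ?SB) + card (?SA \<inter> ?SB)"
    using finS by (intro card_Un_Int)
  moreover have "card (?SA \<inter> ?SB) = card (insert x ` (?SA \<inter> ?SB))"
  proof (rule card_image[symmetric])
    show "inj_on (insert x) (?SA \<inter> ?SB)"
      using insert.hyps(2) by (intro inj_onI) (metis (no_types, lifting) Int_iff insert_ident mem_Collect_eq subsetD)
  qed
  moreover have "card (?SA \<union> ?SB) + card (insert x ` (?SA \<inter> ?SB)) = card ((?SA \<union> ?SB) \<union> insert x ` (?SA \<inter> ?SB))"
    using finS insert.hyps(2) by (intro card_Un_disjoint[symmetric]) auto
  moreover have "(?SA \<union> ?SB) \<union> insert x ` (?SA \<inter> ?SB) \<subseteq> ?S"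
  proof -
    have a: "shatters \<F> Y" if "Y \<in> ?SA" for Y
      using that unfolding shatters_def by blast
    have b: "shatters \<F> Y" if Y: "Y \<in> ?SB" for Y
      unfolding shatters_def
    proof (intro allI impI)
      fix Z assume "Z \<subseteq> Y"
      moreover have "shatters ?FB Y" using Y by simp
      ultimately obtain F where F: "F \<in> ?G" "(F - {x}) \<inter> Y = Z" by (auto elim!: shattersE[of ?FB Y Z])
      then have "F \<inter> Y = Z" using Y insert.hyps(2) by auto
      then show "\<exists>F\<in>\<F>. F \<inter> Y = Z" using F(1) by auto
    qed
    have c: "shatters \<F> (insert x Y)" if Y: "Y \<in> ?SA \<inter> ?SB" for Y
      unfolding shatters_def
    proof (intro allI impI)
      fix Z assume Z: "Z \<subseteq> insert x Y"
      have xY: "x \<notin> Y" using Y insert.hyps(2) by auto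
      show "\<exists>F\<in>\<F>. F \<inter> insert x Y = Z"
      proof (cases "x \<in> Z")
        case True
        have "Z - {x} \<subseteq> Y" using Z by auto
        moreover have "shatters ?FB Y" using Y by simp
        ultimately obtain F where F: "F \<in> ?G" "(F - {x}) \<inter> Y = Z - {x}" by (auto elim!: shattersE[of ?FB Y "Z - {x}"])
        then have "F \<inter> insert x Y = Z" using True xY by auto
        then show ?thesis using F(1) by auto
      next
        case False
        then have "Z \<subseteq> Y" using Z by auto
        moreover have "shatters ?FA Y" using Y by simp
        ultimately obtain F where F: "F \<in> ?FA" "F \<inter> Y = Z" by (auto elim!: shattersE[of ?FA Y Z])
        then have "F \<inter> insert x Y = Z" by auto
        then show ?thesis using F(1) by auto
      qed
    qed
    show ?thesis using a b c by auto
  qed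
  then have "card ((?SA \<union> ?SB) \<union> insert x ` (?SA \<inter> ?SB)) \<le> card ?S" by (rule card_mono[OF finS(3)])
  ultimately show ?case by linarith
qed

text \<open>Radon's theorem gives disjoint parts \<open>M\<close> and \<open>P\<close> of
  \<open>Y\<close> with meeting hulls. Both are cut out by balls of the same radius, so the bisector
  hyperplane of the two centres separates them.\<close>

lemma card_shattered_by_balls:
  fixes Y :: "'a::euclidean_space set"
  assumes sh: "shatters ((\<lambda>a. T \<inter> cball a r) ` A) Y" and Y: "finite Y" "Y \<subseteq> T"
  shows "card Y \<le> DIM('a) + 1"
proof (rule ccontr)
  assume "\<not> ?thesis"
  then have "affine_dependent Y" using affine_dependent_biggerset[OF Y(1)] by simp
  from Radon[OF this] obtain M P where MP: "M \<subseteq> Y" "P \<subseteq> Y" "M \<inter> P = {}" "convex hull M \<inter> convex hull P \<noteq> {}" .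
  obtain a where a: "T \<inter> cball a r \<inter> Y = M" using shattersE[OF sh MP(1)] by auto
  obtain b where b: "T \<inter> cball b r \<inter> Y = P" using shattersE[OF sh MP(2)] by auto
  have in_ball: "x \<in> cball c r \<longleftrightarrow> x \<in> Z" if "T \<inter> cball c r \<inter> Y = Z" "x \<in> Y" for x c Z
    using that Y(2) by auto
  have less: "(norm x)\<^sup>2 - 2 * (c \<bullet> x) + (norm c)\<^sup>2 < (norm x)\<^sup>2 - 2 * (d \<bullet> x) + (norm d)\<^sup>2"
    if "x \<in> cball c r" "x \<notin> cball d r" for x c d :: 'a
  proof -
    have "(dist c x)\<^sup>2 < (dist d x)\<^sup>2" using that by (intro power_strict_mono) auto
    then show ?thesis by (simp add: dist_norm power2_norm_eq_inner inner_diff inner_commute algebra_simps)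
  qed
  define h where "h = (norm a)\<^sup>2 - (norm b)\<^sup>2"
  have "M \<subseteq> {x. (2 *\<^sub>R (a - b)) \<bullet> x > h}"
  proof
    fix x assume x: "x \<in> M"
    then have "x \<in> cball a r" "x \<notin> cball b r" using in_ball[OF a, of x] in_ball[OF b, of x] MP by auto
    from less[OF this] show "x \<in> {x. (2 *\<^sub>R (a - b)) \<bullet> x > h}" by (simp add: h_def inner_diff_left algebra_simps)
  qed
  then have hM: "convex hull M \<subseteq> {x. (2 *\<^sub>R (a - b)) \<bullet> x > h}" by (intro hull_minimal convex_halfspace_gt)
  have "P \<subseteq> {x. (2 *\<^sub>R (a - b)) \<bullet> x < h}"
  proof
    fix x assume x: "x \<in> P"
    then have "x \<in> cball b r" "x \<notin> cball a r" using in_ball[OF a, of x] in_ball[OF b, of x] MP by auto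
    from less[OF this] show "x \<in> {x. (2 *\<^sub>R (a - b)) \<bullet> x < h}" by (simp add: h_def inner_diff_left algebra_simps)
  qed
  then have hP: "convex hull P \<subseteq> {x. (2 *\<^sub>R (a - b)) \<bullet> x < h}" by (intro hull_minimal convex_halfspace_lt)
  show False using hM hP MP(4) by force
qed

lemma card_subsets_le:
  assumes "finite T" "card T \<le> s"
  shows "card {Y. Y \<subseteq> T \<and> card Y \<le> k} \<le> (k + 1) * (s + 1) ^ k"
proof -
  have "{Y. Y \<subseteq> T \<and> card Y \<le> k} = (\<Union>i\<in>{..k}. {Y. Y \<subseteq> T \<and> card Y = i})" by auto
  then have "card {Y. Y \<subseteq> T \<and> card Y \<le> k} \<le> (\<Sum>i\<le>k. card {Y. Y \<subseteq> T \<and> card Y = i})"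
    using card_UN_le[of "{..k}" "\<lambda>i. {Y. Y \<subseteq> T \<and> card Y = i}"] by simp
  also have "\<dots> \<le> (\<Sum>i\<le>k. (s + 1) ^ k)"
  proof (rule sum_mono)
    fix i assume i: "i \<in> {..k}"
    have "card {Y. Y \<subseteq> T \<and> card Y = i} = card T choose i" by (rule n_subsets[OF assms(1)])
    also have "\<dots> \<le> card T ^ i" by (cases "i \<le> card T") (auto simp: binomial_le_pow binomial_eq_0)
    also have "\<dots> \<le> (s + 1) ^ i" using assms(2) by (intro power_mono) auto
    also have "\<dots> \<le> (s + 1) ^ k" using i by (intro power_increasing) auto
    finally show "card {Y. Y \<subseteq> T \<and> card Y = i} \<le> (s + 1) ^ k" .
  qed
  finally show ?thesis by simp
qed

lemma card_ball_traces_le: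
  fixes T :: "'a::euclidean_space set"
  assumes "finite T" "card T \<le> s"
  shows "card ((\<lambda>a. T \<inter> cball a r) ` A) \<le> (DIM('a) + 2) * (s + 1) ^ (DIM('a) + 1)"
proof -
  let ?F = "(\<lambda>a. T \<inter> cball a r) ` A"
  have "card ?F \<le> card {Y. Y \<subseteq> T \<and> shatters ?F Y}" by (rule card_le_card_shattered[OF assms(1)]) auto
  also have "\<dots> \<le> card {Y. Y \<subseteq> T \<and> card Y \<le> DIM('a) + 1}"
  proof (rule card_mono)
    show "{Y. Y \<subseteq> T \<and> shatters ?F Y} \<subseteq> {Y. Y \<subseteq> T \<and> card Y \<le> DIM('a) + 1}"
      using card_shattered_by_balls[of T r A] assms(1) finite_subset[of _ T] by auto
  qed (use assms(1) in auto)
  also have "\<dots> \<le> (DIM('a) + 1 + 1) * (s + 1) ^ (DIM('a) + 1)" by (rule card_subsets_le[OF assms])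
  finally show ?thesis by simp
qed

text \<open>The colours are the residue classes of the cells of a fine grid; a pair of nearby points then
  determines, by its colours alone, the difference of its cells.\<close>

lemma grid_colouring:
  fixes \<epsilon> :: real
  assumes "\<epsilon> > 0"
  obtains \<kappa> :: "real ^ 'n \<Rightarrow> 'n \<Rightarrow> int" where "finite (range \<kappa>)"
    "\<And>a c a' c'. \<kappa> a = \<kappa> a' \<Longrightarrow> \<kappa> c = \<kappa> c' \<Longrightarrow> dist a c \<le> 3 \<Longrightarrow> dist a' c' \<le> 3 \<Longrightarrow> dist (c - a) (c' - a') \<le> \<epsilon>"
proof -
  \<comment> \<open>Cells have side \<open>1 / N\<close>. Equal cell displacements leave an error of
    at most \<open>2 / N\<close> per coordinate, which sums to \<epsilon>.\<close>
  define N where "N = 2 * real CARD('n) / \<epsilon>"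
  \<comment> \<open>A displacement of length at most 3 spans less than \<open>3 * N + 1\<close>
    cells per coordinate up to sign; two of these differ by less than \<open>M\<close>, so
    congruence forces equality.\<close>
  define M where "M = \<lceil>6 * N\<rceil> + 4"
  define \<kappa> :: "real ^ 'n \<Rightarrow> 'n \<Rightarrow> int" where "\<kappa> x i = \<lfloor>N * x $ i\<rfloor> mod M" for x i
  have N: "N > 0" using assms by (simp add: N_def)
  then have M: "M > 0" "real_of_int M \<ge> 6 * N + 4" unfolding M_def by linarith+
  have "range \<kappa> \<subseteq> UNIV \<rightarrow>\<^sub>E {0..<M}" using M(1) by (auto simp: \<kappa>_def)
  moreover have "finite (UNIV \<rightarrow>\<^sub>E {0..<M} :: ('n \<Rightarrow> int) set)" by (intro finite_PiE) auto
  ultimately have 1: "finite (range \<kappa>)" by (rule finite_subset)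
  have "dist (c - a) (c' - a') \<le> \<epsilon>"
    if h: "\<kappa> a = \<kappa> a'" "\<kappa> c = \<kappa> c'" "dist a c \<le> 3" "dist a' c' \<le> 3" for a c a' c'
  proof -
    have comp: "\<bar>((c - a) - (c' - a')) $ i\<bar> \<le> 2 / N" for i
    proof -
      have near: "\<bar>N * y $ i - N * x $ i\<bar> \<le> 3 * N" if "dist x y \<le> 3" for x y :: "real ^ 'n"
      proof -
        have "\<bar>(y - x) $ i\<bar> \<le> 3"
          using component_le_norm_cart[of "y - x" i] that by (simp add: dist_norm norm_minus_commute)
        then have "N * \<bar>(y - x) $ i\<bar> \<le> N * 3" using N by (intro mult_left_mono) auto
        then show ?thesis using N by (simp add: abs_mult[symmetric] algebra_simps abs_mult_pos')
      qed
      let ?p = "\<lfloor>N * c $ i\<rfloor> - \<lfloor>N * a $ i\<rfloor>" and ?q = "\<lfloor>N * c' $ i\<rfloor> - \<lfloor>N * a' $ i\<rfloor>"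
      have "?p mod M = ?q mod M"
        using fun_cong[OF h(1), of i] fun_cong[OF h(2), of i] unfolding \<kappa>_def by (intro mod_diff_cong) auto
      then have dvd: "M dvd ?p - ?q" by (simp add: mod_eq_dvd_iff)
      have "\<bar>real_of_int (?p - ?q)\<bar> < real_of_int M"
        using near[OF h(3)] near[OF h(4)] M(2) unfolding of_int_diff by linarith
      then have "\<bar>?p - ?q\<bar> < M" by linarith
      then have "?p - ?q = 0" using dvd_imp_le_int[of "?p - ?q" M] dvd M(1) by force
      then have "real_of_int ?p = real_of_int ?q" by simp
      then have "\<bar>(N * c $ i - N * a $ i) - (N * c' $ i - N * a' $ i)\<bar> \<le> 2"
        unfolding of_int_diff by linarith
      moreover have "\<bar>(N * c $ i - N * a $ i) - (N * c' $ i - N * a' $ i)\<bar> = N * \<bar>((c - a) - (c' - a')) $ i\<bar>"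
      proof -
        have "(N * c $ i - N * a $ i) - (N * c' $ i - N * a' $ i) = N * ((c - a) - (c' - a')) $ i"
          by (simp add: algebra_simps)
        then show ?thesis using N by (simp only: abs_mult)
      qed
      ultimately have "N * \<bar>((c - a) - (c' - a')) $ i\<bar> \<le> 2" by simp
      then show ?thesis using N by (simp add: pos_le_divide_eq mult.commute)
    qed
    have "dist (c - a) (c' - a') \<le> (\<Sum>i\<in>UNIV. \<bar>((c - a) - (c' - a')) $ i\<bar>)"
      unfolding dist_norm by (rule norm_le_l1_cart)
    also have "\<dots> \<le> (\<Sum>i\<in>(UNIV :: 'n set). 2 / N)" by (intro sum_mono comp)
    also have "\<dots> = \<epsilon>" using assms by (simp add: N_def field_simps)
    finally show ?thesis .
  qed
  with 1 that show thesis by blast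
qed

section \<open>Rips complexes in dimension d\<close>

abbreviation rips_adj :: "'a::metric_space \<Rightarrow> 'a \<Rightarrow> bool" where
  "rips_adj x y \<equiv> dist x y \<le> 1"

lemma rips_adj_rel: "reflp rips_adj" "symp rips_adj"
  by (auto simp: reflp_def symp_def dist_commute)

lemma rips_eq_clique_complex:
  fixes S :: "'a::real_normed_vector set"
  assumes "finite S"
  shows "rips S = clique_complex rips_adj S"
proof -
  have "diameter \<sigma> \<le> 1 \<longleftrightarrow> (\<forall>x\<in>\<sigma>. \<forall>y\<in>\<sigma>. dist x y \<le> 1)" if "\<sigma> \<subseteq> S" for \<sigma>
  proof
    assume d: "diameter \<sigma> \<le> 1"
    have "bounded \<sigma>" using that assms finite_subset finite_imp_bounded by metis
    then show "\<forall>x\<in>\<sigma>. \<forall>y\<in>\<sigma>. dist x y \<le> 1" using diameter_bounded_bound[of \<sigma>] d by force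
  qed (auto intro!: diameter_le simp: dist_norm)
  then show ?thesis unfolding rips_def clique_complex_def by auto
qed

lemma coloured_graph_rips:
  fixes S :: "(real ^ 'n) set" and \<kappa> :: "real ^ 'n \<Rightarrow> 'n \<Rightarrow> int"
  assumes "finite S" "finite (range \<kappa>)"
    and col: "\<And>a c a' c'. \<kappa> a = \<kappa> a' \<Longrightarrow> \<kappa> c = \<kappa> c' \<Longrightarrow> dist a c \<le> 3 \<Longrightarrow> dist a' c' \<le> 3 \<Longrightarrow> dist (c - a) (c' - a') \<le> 1"
  shows "coloured_graph rips_adj \<kappa> S (card (range \<kappa>))"
proof
  show "reflp (rips_adj :: real ^ 'n \<Rightarrow> _)" "symp (rips_adj :: real ^ 'n \<Rightarrow> _)" by (rule rips_adj_rel)+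
  show "finite S" by fact
  show "card (\<kappa> ` S) \<le> card (range \<kappa>)" using assms(2) by (intro card_mono) auto
  fix x y z assume h: "dist z x \<le> 1" "dist z y \<le> 1" "\<kappa> x = \<kappa> y"
  have "dist x y \<le> 3" using h(1,2) dist_triangle[of x y z] by (simp add: dist_commute)
  \<comment> \<open>The pair \<open>x\<close>, \<open>y\<close> is compared with the pair
    \<open>x\<close>, \<open>x\<close>, whose displacement is 0.\<close>
  then have "dist (y - x) (x - x) \<le> 1" using h(3) by (intro col) simp_all
  then show "dist x y \<le> 1" by (simp add: dist_norm norm_minus_commute)
qed

text \<open>\<open>T\<close> is chosen to hit the large differences of neighbourhoods, one for each
  ordered pair, which explains the square of \<open>n\<close>. Fewer than one is missed, so none is,
  and points with equal traces on \<open>T\<close> have a small difference.\<close>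

lemma rips_classes:
  fixes S :: "'a::euclidean_space set" and \<epsilon> :: real
  assumes S: "finite S" "card S \<le> n" "n > 0" and \<epsilon>: "0 < \<epsilon>" "\<epsilon> \<le> 1"
    and s: "(1 - \<epsilon>) ^ s * real n ^ 2 < 1"
  obtains T where "card ((\<lambda>a. T \<inter> cball a 1) ` S) \<le> (DIM('a) + 2) * (s + 1) ^ (DIM('a) + 1)"
    "\<forall>v\<in>S. \<forall>w\<in>S. T \<inter> cball v 1 = T \<inter> cball w 1 \<longrightarrow>
      real (card {x \<in> S. rips_adj v x \<and> \<not> rips_adj w x}) \<le> \<epsilon> * real n"
proof -
  let ?d = "\<lambda>(v, w). {x \<in> S. rips_adj v x \<and> \<not> rips_adj w x}"
  let ?F = "?d ` {vw \<in> S \<times> S. \<epsilon> * real n < real (card (?d vw))}"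
  have F: "F \<subseteq> S \<and> \<epsilon> * real n < real (card F)" if "F \<in> ?F" for F using that by auto
  have finF: "finite ?F" using S(1) by (intro finite_imageI finite_Collect_conjI) simp
  obtain T where T: "T \<subseteq> S" "card T \<le> s" "real (card {F \<in> ?F. F \<inter> T = {}}) \<le> (1 - \<epsilon>) ^ s * real (card ?F)"
    using greedy_hitting_set[OF S(1) finF S(2,3) _ \<epsilon>(2) F, of s] \<epsilon>(1) by auto
  have "card ?F \<le> card {vw \<in> S \<times> S. \<epsilon> * real n < real (card (?d vw))}"
    using S(1) by (intro card_image_le finite_Collect_conjI) simp
  also have "\<dots> \<le> card (S \<times> S)" using S(1) by (intro card_mono) auto
  also have "\<dots> \<le> n ^ 2" using S(2) by (simp add: card_cartesian_product power2_eq_square mult_mono)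
  finally have "real (card ?F) \<le> real (n ^ 2)" by (rule of_nat_mono)
  then have "real (card ?F) \<le> real n ^ 2" by (simp only: of_nat_power)
  then have "(1 - \<epsilon>) ^ s * real (card ?F) \<le> (1 - \<epsilon>) ^ s * real n ^ 2" using \<epsilon> by (intro mult_left_mono) auto
  then have "card {F \<in> ?F. F \<inter> T = {}} = 0" using T(3) s by linarith
  then have hit: "F \<inter> T \<noteq> {}" if "F \<in> ?F" for F using that finF by auto
  have finT: "finite T" using T(1) S(1) finite_subset by auto
  show thesis
  proof (rule that)
    show "card ((\<lambda>a. T \<inter> cball a 1) ` S) \<le> (DIM('a) + 2) * (s + 1) ^ (DIM('a) + 1)"
      by (rule card_ball_traces_le[OF finT T(2)])
    show "\<forall>v\<in>S. \<forall>w\<in>S. T \<inter> cball v 1 = T \<inter> cball w 1 \<longrightarrow>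
      real (card {x \<in> S. rips_adj v x \<and> \<not> rips_adj w x}) \<le> \<epsilon> * real n"
    proof (intro ballI impI, rule ccontr)
      fix v w assume vw: "v \<in> S" "w \<in> S" "T \<inter> cball v 1 = T \<inter> cball w 1"
      assume "\<not> real (card {x \<in> S. rips_adj v x \<and> \<not> rips_adj w x}) \<le> \<epsilon> * real n"
      then have "?d (v, w) \<in> ?F" using vw by (intro imageI) auto
      from hit[OF this] obtain x where "x \<in> T" "rips_adj v x" "\<not> rips_adj w x" by auto
      then show False using vw(3) by (auto simp: set_eq_iff)
    qed
  qed
qed

text \<open>By 1 - \<epsilon> \<le> exp (- \<epsilon>) a logarithmic sample suffices; the
  \<open>+ 1\<close> makes the inequality strict.\<close>

lemma exp_sample_size:
  fixes \<epsilon> :: real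
  assumes "0 < \<epsilon>" "\<epsilon> \<le> 1" "n > 0"
  shows "(1 - \<epsilon>) ^ (nat \<lceil>2 * ln (real n) / \<epsilon>\<rceil> + 1) * real n ^ 2 < 1"
proof -
  define s where "s = nat \<lceil>2 * ln (real n) / \<epsilon>\<rceil> + 1"
  have "2 * ln (real n) / \<epsilon> < real s" unfolding s_def by linarith
  then have "2 * ln (real n) < \<epsilon> * real s" using assms(1) by (simp add: field_simps)
  then have lt: "- \<epsilon> * real s + 2 * ln (real n) < 0" by simp
  have "(1 - \<epsilon>) ^ s \<le> exp (- \<epsilon>) ^ s"
    using assms exp_ge_add_one_self[of "- \<epsilon>"] by (intro power_mono) auto
  also have "\<dots> = exp (- \<epsilon> * real s)" by (simp add: exp_of_nat_mult[symmetric] mult.commute)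
  finally have "(1 - \<epsilon>) ^ s * real n ^ 2 \<le> exp (- \<epsilon> * real s) * real n ^ 2" by (intro mult_right_mono) auto
  also have "\<dots> = exp (- \<epsilon> * real s + 2 * ln (real n))" using assms(3) unfolding exp_add by (simp add: exp_double)
  also have "\<dots> < 1" using lt by simp
  finally show ?thesis unfolding s_def .
qed

lemma betti_le_3_rips:
  fixes \<delta> :: real
  assumes "\<delta> > 0"
  shows "\<forall>\<^sub>F n in sequentially. \<forall>S :: (real ^ 'd) set. finite S \<longrightarrow> card S \<le> n \<longrightarrow>
    betti_le TYPE('k::field) S (clique_complex rips_adj S) 3 (nat \<lfloor>\<delta> * real n ^ 2\<rfloor>)"
proof -
  obtain \<kappa> :: "real ^ 'd \<Rightarrow> 'd \<Rightarrow> int" where \<kappa>: "finite (range \<kappa>)"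
    "\<And>a c a' c'. \<kappa> a = \<kappa> a' \<Longrightarrow> \<kappa> c = \<kappa> c' \<Longrightarrow> dist a c \<le> 3 \<Longrightarrow> dist a' c' \<le> 3 \<Longrightarrow> dist (c - a) (c' - a') \<le> 1"
    using grid_colouring[of 1] by auto
  define K where "K = card (range \<kappa>)"
  have K: "K > 0" unfolding K_def using \<kappa>(1) by (simp add: card_gt_0_iff)
  \<comment> \<open>Half of \<delta> pays for the cheap deletions, at most
    \<open>K * \<epsilon> * n\<close> each; \<open>c\<close> below is fitted so that the other half
    pays for the first vertices of the classes.\<close>
  define \<epsilon> where "\<epsilon> = min 1 (\<delta> / (2 * real K))"
  have \<epsilon>: "0 < \<epsilon>" "\<epsilon> \<le> 1" "real K * \<epsilon> \<le> \<delta> / 2"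
    using assms K by (auto simp: \<epsilon>_def min_def field_simps)
  define d where "d = CARD('d)"
  define c where "c = \<delta> / (2 * real K * real K * real (d + 2))"
  have c: "c > 0" using assms K by (simp add: c_def)
  have "2 / \<epsilon> > 0" using \<epsilon> by simp
  then have "\<forall>\<^sub>F n in sequentially. (2 / \<epsilon> * ln (real n) + 3) ^ (d + 1) \<le> c * real n"
    using c by real_asymp
  moreover have "\<forall>\<^sub>F n in sequentially. n > (0::nat)" by (rule eventually_gt_at_top)
  ultimately show ?thesis
  proof eventually_elim
    case (elim n)
    show ?case
    proof (intro allI impI)
      fix S :: "(real ^ 'd) set" assume S: "finite S" "card S \<le> n"
      define s where "s = nat \<lceil>2 * ln (real n) / \<epsilon>\<rceil> + 1"
      have "(1 - \<epsilon>) ^ s * real n ^ 2 < 1" unfolding s_def by (rule exp_sample_size[OF \<epsilon>(1,2) elim(2)])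
      from rips_classes[OF S elim(2) \<epsilon>(1,2) this] obtain T where T: "card ((\<lambda>a. T \<inter> cball a 1) ` S) \<le> (DIM(real ^ 'd) + 2) * (s + 1) ^ (DIM(real ^ 'd) + 1)"
        "\<forall>v\<in>S. \<forall>w\<in>S. T \<inter> cball v 1 = T \<inter> cball w 1 \<longrightarrow>
          real (card {x \<in> S. rips_adj v x \<and> \<not> rips_adj w x}) \<le> \<epsilon> * real n" .
      interpret coloured_graph rips_adj \<kappa> S K
        unfolding K_def by (rule coloured_graph_rips[OF S(1) \<kappa>])
      \<comment> \<open>The colour is part of the class, because \<open>betti_le_2_link\<close>
        needs a partner of equal colour.\<close>
      let ?\<theta> = "\<lambda>v. (\<kappa> v, T \<inter> cball v 1)" and ?D = "nat \<lfloor>\<epsilon> * real n\<rfloor>"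
      have "betti_le TYPE('k) S (clique_complex rips_adj S) (Suc (Suc (Suc 0)))
          (K * ?D * card S + card (?\<theta> ` S) * (K * n))"
        using T(2) by (intro betti_le_3_classes S(2)) (auto simp: le_nat_floor)
      moreover have "K * ?D * card S + card (?\<theta> ` S) * (K * n) \<le> nat \<lfloor>\<delta> * real n ^ 2\<rfloor>"
      proof (rule le_nat_floor)
        have "real ?D \<le> \<epsilon> * real n" using \<epsilon>(1) by simp
        then have "real K * real ?D * real (card S) \<le> real K * (\<epsilon> * real n) * real n"
          using S(2) \<epsilon>(1) by (intro mult_mono mult_left_mono) auto
        also have "\<dots> = (real K * \<epsilon>) * real n ^ 2" by (simp add: power2_eq_square)
        also have "\<dots> \<le> \<delta> / 2 * real n ^ 2" using \<epsilon>(3) by (intro mult_right_mono) auto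
        finally have 1: "real K * real ?D * real (card S) \<le> \<delta> / 2 * real n ^ 2" .
        have "?\<theta> ` S \<subseteq> \<kappa> ` S \<times> (\<lambda>a. T \<inter> cball a 1) ` S" by auto
        then have "card (?\<theta> ` S) \<le> card (\<kappa> ` S \<times> (\<lambda>a. T \<inter> cball a 1) ` S)"
          using S(1) by (intro card_mono) auto
        also have "\<dots> \<le> K * ((d + 2) * (s + 1) ^ (d + 1))"
          unfolding card_cartesian_product using T(1) card_colours by (intro mult_mono) (auto simp: d_def)
        finally have "real (card (?\<theta> ` S)) \<le> real (K * ((d + 2) * (s + 1) ^ (d + 1)))" by (rule of_nat_mono)
        also have "\<dots> = real K * (real (d + 2) * real (s + 1) ^ (d + 1))"
          by (simp only: of_nat_mult of_nat_power)
        also have "\<dots> \<le> real K * (real (d + 2) * (c * real n))"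
        proof -
          have "0 \<le> 2 * ln (real n) / \<epsilon>" using elim(2) \<epsilon>(1) by simp
          \<comment> \<open>The 3 collects the ceiling, the \<open>+ 1\<close> in \<open>s\<close>
            and the one in \<open>s + 1\<close>.\<close>
          then have "real (s + 1) \<le> 2 / \<epsilon> * ln (real n) + 3" unfolding s_def by simp linarith
          then have "real (s + 1) ^ (d + 1) \<le> (2 / \<epsilon> * ln (real n) + 3) ^ (d + 1)" by (intro power_mono) auto
          then show ?thesis using elim(1) by (intro mult_left_mono) auto
        qed
        finally have "real (card (?\<theta> ` S)) * (real K * real n) \<le> real K * (real (d + 2) * (c * real n)) * (real K * real n)"
          by (intro mult_right_mono) auto
        also have "\<dots> = (2 * real K * real K * real (d + 2)) * c * (real n ^ 2 / 2)"
          by (simp add: power2_eq_square)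
        also have "(2 * real K * real K * real (d + 2)) * c = \<delta>" using K by (simp add: c_def)
        finally have "real (card (?\<theta> ` S)) * (real K * real n) \<le> \<delta> * (real n ^ 2 / 2)" .
        with 1 show "real (K * ?D * card S + card (?\<theta> ` S) * (K * n)) \<le> \<delta> * real n ^ 2"
          by simp
      qed
      ultimately show "betti_le TYPE('k) S (clique_complex rips_adj S) 3 (nat \<lfloor>\<delta> * real n ^ 2\<rfloor>)"
        unfolding numeral_3_eq_3 by (rule betti_le_mono)
    qed
  qed
qed

text \<open>Chains vanish off \<Gamma>, so further vertices add only zero terms to a boundary. This
  lets a neighbourhood be treated as a Rips complex on its own points.\<close>

lemma betti_le_universe:
  assumes "complex_on V \<Gamma>" "complex_on V' \<Gamma>" "betti_le TYPE('k::field) V \<Gamma> q m"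
  shows "betti_le TYPE('k) V' \<Gamma> q m"
proof -
  have eq: "bd V c = bd V' c" if "c \<in> chain_space \<Gamma> r" for c :: "'a set \<Rightarrow> 'k" and r
    using boundary_map_eq_bd[OF assms(1) that] boundary_map_eq_bd[OF assms(2) that] by simp
  have "cycles V \<Gamma> q = (cycles V' \<Gamma> q :: ('a set \<Rightarrow> 'k) set)"
    unfolding cycles_def using eq by auto
  moreover have "bounds V \<Gamma> q = (bounds V' \<Gamma> q :: ('a set \<Rightarrow> 'k) set)"
    unfolding bounds_def by (rule image_cong) (auto simp: eq)
  ultimately show ?thesis using assms(3) by (simp add: betti_le_def)
qed

lemma betti_le_rips_Suc:
  fixes S :: "'a::metric_space set"
  assumes S: "finite S" "card S \<le> n"
    and le: "\<And>T :: 'a set. finite T \<Longrightarrow> card T \<le> n \<Longrightarrow> betti_le TYPE('k::field) T (clique_complex rips_adj T) q m"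
  shows "betti_le TYPE('k) S (clique_complex rips_adj S) (Suc q) (m * n)"
proof (rule betti_le_mono)
  show "betti_le TYPE('k) S (clique_complex rips_adj S) (Suc q) (m * card S)"
  proof (rule betti_le_clique_vertices[OF rips_adj_rel S(1) subset_refl])
    fix v U assume U: "U \<subseteq> S"
    let ?N = "{x \<in> U. rips_adj v x}"
    have N: "?N \<subseteq> S" using U by auto
    have "card ?N \<le> n" using card_mono[OF S(1) N] S(2) by simp
    then have "betti_le TYPE('k) ?N (clique_complex rips_adj ?N) q m"
      using finite_subset[OF N S(1)] by (intro le) auto
    then show "betti_le TYPE('k) S (clique_complex rips_adj ?N) q m"
      using N S(1) finite_subset[OF N S(1)]
      by (intro betti_le_universe[of ?N _ S] complex_on_clique_complex) auto
  qed
qed (use S(2) in simp)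

lemma max_betti_le:
  assumes "\<And>S :: (real ^ 'd) set. finite S \<Longrightarrow> card S \<le> n \<Longrightarrow> betti_le TYPE('k::field) S (clique_complex rips_adj S) (Suc p) m"
  shows "max_betti TYPE('k) TYPE('d::finite) p n \<le> m"
  unfolding max_betti_def
proof (rule Max.boundedI)
  show "finite {reduced_betti TYPE('k) p (rips S) | S :: (real ^ 'd) set. finite S \<and> card S \<le> n}"
    by (rule finite_betti_values)
  have "reduced_betti TYPE('k) p (rips ({} :: (real ^ 'd) set))
      \<in> {reduced_betti TYPE('k) p (rips S) | S :: (real ^ 'd) set. finite S \<and> card S \<le> n}"
    by (intro CollectI exI[of _ "{}"]) auto
  then show "{reduced_betti TYPE('k) p (rips S) | S :: (real ^ 'd) set. finite S \<and> card S \<le> n} \<noteq> {}" by blast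
  fix b assume "b \<in> {reduced_betti TYPE('k) p (rips S) | S :: (real ^ 'd) set. finite S \<and> card S \<le> n}"
  then obtain S :: "(real ^ 'd) set" where S: "finite S" "card S \<le> n" and b: "b = reduced_betti TYPE('k) p (rips S)"
    by blast
  show "b \<le> m"
    unfolding b rips_eq_clique_complex[OF S(1)]
    by (rule reduced_betti_le_if_betti_le[OF complex_on_clique_complex[OF S(1) subset_refl] assms[OF S]])
qed

lemma max_betti_small_o:
  fixes \<delta> :: real
  assumes "p \<ge> 2" "\<delta> > 0"
  shows "\<forall>\<^sub>F n in sequentially. real (max_betti TYPE('k::field) TYPE('d::finite) p n) < \<delta> * real n ^ p"
proof -
  have "\<forall>\<^sub>F n in sequentially. \<forall>S :: (real ^ 'd) set. finite S \<longrightarrow> card S \<le> n \<longrightarrow>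
    betti_le TYPE('k) S (clique_complex rips_adj S) (Suc p) (nat \<lfloor>\<delta> / 2 * real n ^ p\<rfloor>)"
    using assms(1)
  proof (induction p rule: dec_induct)
    case base
    show ?case using betti_le_3_rips[of "\<delta> / 2", where 'd = 'd and 'k = 'k] assms(2) by simp
  next
    case (step p)
    from step.IH show ?case
    proof eventually_elim
      case (elim n)
      show ?case
      proof (intro allI impI)
        fix S :: "(real ^ 'd) set" assume S: "finite S" "card S \<le> n"
        have "betti_le TYPE('k) S (clique_complex rips_adj S) (Suc (Suc p)) (nat \<lfloor>\<delta> / 2 * real n ^ p\<rfloor> * n)"
          using elim by (intro betti_le_rips_Suc[OF S]) auto
        moreover have "nat \<lfloor>\<delta> / 2 * real n ^ p\<rfloor> * n \<le> nat \<lfloor>\<delta> / 2 * real n ^ Suc p\<rfloor>"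
        proof (rule le_nat_floor)
          have "real (nat \<lfloor>\<delta> / 2 * real n ^ p\<rfloor>) \<le> \<delta> / 2 * real n ^ p"
            using assms(2) by (intro of_nat_floor) simp
          then have "real (nat \<lfloor>\<delta> / 2 * real n ^ p\<rfloor>) * real n \<le> \<delta> / 2 * real n ^ p * real n"
            by (intro mult_right_mono) auto
          then show "real (nat \<lfloor>\<delta> / 2 * real n ^ p\<rfloor> * n) \<le> \<delta> / 2 * real n ^ Suc p" by (simp add: algebra_simps)
        qed
        ultimately show "betti_le TYPE('k) S (clique_complex rips_adj S) (Suc (Suc p)) (nat \<lfloor>\<delta> / 2 * real n ^ Suc p\<rfloor>)"
          by (rule betti_le_mono)
      qed
    qed
  qed
  moreover have "\<forall>\<^sub>F n in sequentially. n > (0::nat)" by (rule eventually_gt_at_top)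
  ultimately show ?thesis
  proof eventually_elim
    case (elim n)
    have "max_betti TYPE('k) TYPE('d) p n \<le> nat \<lfloor>\<delta> / 2 * real n ^ p\<rfloor>"
      using elim(1) by (intro max_betti_le) blast
    then have "real (max_betti TYPE('k) TYPE('d) p n) \<le> real (nat \<lfloor>\<delta> / 2 * real n ^ p\<rfloor>)" by simp
    also have "\<dots> \<le> \<delta> / 2 * real n ^ p" using assms(2) by (intro of_nat_floor) simp
    also have "\<dots> < \<delta> * real n ^ p" using assms(2) elim(2) by simp
    finally show ?case .
  qed
qed

section \<open>Two-coloured complexes\<close>

text \<open>The minimiser is chosen from the class as a set, so it is constant on classes and its
  fixed points form a transversal. The two-coloured count exploits the minimality of
  \<open>key\<close>.\<close>

lemma class_representatives:
  fixes key :: "'x \<Rightarrow> nat"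
  assumes R: "finite R" and r: "sym r" "r \<subseteq> R \<times> R"
  obtains F where "F \<subseteq> R" "\<And>\<tau>. \<tau> \<in> R \<Longrightarrow> \<exists>\<sigma>\<in>F. (\<tau>, \<sigma>) \<in> r\<^sup>*"
    "\<And>\<sigma> \<sigma>'. \<sigma> \<in> F \<Longrightarrow> \<sigma>' \<in> F \<Longrightarrow> (\<sigma>, \<sigma>') \<in> r\<^sup>* \<Longrightarrow> \<sigma> = \<sigma>'"
    "\<And>\<sigma> \<tau>. \<sigma> \<in> F \<Longrightarrow> (\<sigma>, \<tau>) \<in> r\<^sup>* \<Longrightarrow> key \<sigma> \<le> key \<tau>"
proof -
  define cls where "cls \<tau> = {\<sigma>. (\<tau>, \<sigma>) \<in> r\<^sup>*}" for \<tau>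
  define rep where "rep \<tau> = arg_min_on key (cls \<tau>)" for \<tau>
  have symr: "sym (r\<^sup>*)" by (rule sym_rtrancl[OF r(1)])
  have cls_eq: "cls \<sigma> = cls \<tau>" if "(\<sigma>, \<tau>) \<in> r\<^sup>*" for \<sigma> \<tau>
    using that symD[OF symr that] unfolding cls_def by (auto intro: rtrancl_trans)
  have clsR: "cls \<tau> \<subseteq> R" if "\<tau> \<in> R" for \<tau>
  proof
    fix \<sigma> assume "\<sigma> \<in> cls \<tau>"
    then have "(\<tau>, \<sigma>) \<in> r\<^sup>*" by (simp add: cls_def)
    then show "\<sigma> \<in> R" using that r(2) by (induction rule: rtrancl_induct) auto
  qed
  have fin: "finite (cls \<tau>)" if "\<tau> \<in> R" for \<tau> using finite_subset[OF clsR[OF that] R] .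
  have ne: "cls \<tau> \<noteq> {}" for \<tau> unfolding cls_def by auto
  have rep: "rep \<tau> \<in> cls \<tau>" if "\<tau> \<in> R" for \<tau>
    unfolding rep_def by (rule arg_min_if_finite(1)[OF fin[OF that] ne])
  show thesis
  proof (rule that[of "{\<sigma> \<in> R. rep \<sigma> = \<sigma>}"])
    show "\<exists>\<sigma>\<in>{\<sigma> \<in> R. rep \<sigma> = \<sigma>}. (\<tau>, \<sigma>) \<in> r\<^sup>*" if \<tau>: "\<tau> \<in> R" for \<tau>
    proof -
      have 1: "(\<tau>, rep \<tau>) \<in> r\<^sup>*" using rep[OF \<tau>] by (simp add: cls_def)
      have "rep (rep \<tau>) = rep \<tau>" using cls_eq[OF 1] by (simp add: rep_def)
      moreover have "rep \<tau> \<in> R" using rep[OF \<tau>] clsR[OF \<tau>] by auto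
      ultimately show ?thesis using 1 by auto
    qed
    show "\<sigma> = \<sigma>'" if "\<sigma> \<in> {\<sigma> \<in> R. rep \<sigma> = \<sigma>}" "\<sigma>' \<in> {\<sigma> \<in> R. rep \<sigma> = \<sigma>}" "(\<sigma>, \<sigma>') \<in> r\<^sup>*" for \<sigma> \<sigma>'
      using that cls_eq[OF that(3)] by (auto simp: rep_def)
    show "key \<sigma> \<le> key \<tau>" if "\<sigma> \<in> {\<sigma> \<in> R. rep \<sigma> = \<sigma>}" "(\<sigma>, \<tau>) \<in> r\<^sup>*" for \<sigma> \<tau>
    proof -
      have "key (rep \<sigma>) \<le> key \<tau>"
        unfolding rep_def using that by (intro arg_min_least fin ne) (auto simp: cls_def)
      then show ?thesis using that by simp
    qed
  qed auto
qed

lemma rainbow_adj_insert: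
  assumes "insert a (insert a' \<rho>) \<in> \<Gamma>" "complex_on V \<Gamma>" "\<kappa> a = \<kappa> a'" "a \<notin> \<rho>" "inj_on \<kappa> (insert a \<rho>)" "card (insert a \<rho>) = n"
  shows "(insert a \<rho>, insert a' \<rho>) \<in> (rainbow_adj \<Gamma> \<kappa> n)\<^sup>*"
proof (cases "a = a'")
  case False
  have \<rho>: "inj_on \<kappa> \<rho>" "\<kappa> a \<notin> \<kappa> ` \<rho>" using assms(4,5) by auto
  then have a': "a' \<notin> \<rho>" using assms(3) by auto
  have "finite V" "insert a (insert a' \<rho>) \<subseteq> V" using assms(1,2) by (auto simp: complex_on_def)
  then have fin: "finite \<rho>" using finite_subset[of "insert a (insert a' \<rho>)" V] by simp
  have sub: "insert a \<rho> \<in> \<Gamma>" "insert a' \<rho> \<in> \<Gamma>"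
    using assms(1,2) unfolding complex_on_def by (meson subset_insertI insert_mono)+
  have un: "insert a \<rho> \<union> insert a' \<rho> = insert a (insert a' \<rho>)" by auto
  have "(insert a \<rho>, insert a' \<rho>) \<in> rainbow_adj \<Gamma> \<kappa> n"
    unfolding rainbow_adj_def rainbow_def un
    using assms sub \<rho> a' fin False by (auto simp: card_insert_if)
  then show ?thesis by auto
qed simp

context coloured_graph
begin

definition mono_adj :: "'v \<Rightarrow> 'v \<Rightarrow> bool" where
  "mono_adj x y \<longleftrightarrow> E x y \<and> \<kappa> x = \<kappa> y"

lemma mono_adj_rel: "reflp mono_adj" "symp mono_adj"
  using reflE symE by (auto simp: mono_adj_def reflp_def symp_def)

lemma betti_le_mono_complex:
  assumes "T \<subseteq> S"
  shows "betti_le TYPE('k::field) S (clique_complex mono_adj T) (Suc (Suc q)) 0"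
proof (rule betti_le_clique_transitive[OF mono_adj_rel finS assms])
  fix x y z assume h: "x \<in> T" "y \<in> T" "z \<in> T" "mono_adj x y" "mono_adj y z"
  then have "E y x" "E y z" "\<kappa> x = \<kappa> z" using sympD[OF symE] by (auto simp: mono_adj_def)
  moreover have "x \<in> S" "y \<in> S" "z \<in> S" using h assms by auto
  ultimately show "mono_adj x z" using common_neighbour[of x z y] by (simp add: mono_adj_def)
qed

lemma mono_complex_eq:
  assumes "T \<subseteq> S"
  shows "{\<sigma> \<in> clique_complex E T. card (\<kappa> ` \<sigma>) \<le> 1} = clique_complex mono_adj T"
proof -
  have "card (\<kappa> ` \<sigma>) \<le> 1 \<longleftrightarrow> (\<forall>x\<in>\<sigma>. \<forall>y\<in>\<sigma>. \<kappa> x = \<kappa> y)" if "\<sigma> \<subseteq> T" for \<sigma>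
  proof -
    have "finite \<sigma>" using that assms finS finite_subset[of \<sigma> S] by auto
    then show ?thesis using card_le_Suc0_iff_eq[of "\<kappa> ` \<sigma>"] by simp
  qed
  then show ?thesis unfolding clique_complex_def mono_adj_def by auto
qed

text \<open>Pairs of colours are added one by one. Each new two-coloured complex meets the union so
  far in monochromatic faces only, where the homology needed in \<open>betti_le_Un\<close> vanishes;
  \<open>2 ^ K\<close> generously bounds the number of pairs.\<close>

lemma betti_le_two_coloured:
  assumes m: "\<And>i j. i \<noteq> j \<Longrightarrow> betti_le TYPE('k::field) S (clique_complex E {x \<in> S. \<kappa> x \<in> {i, j}}) 3 m"
  shows "betti_le TYPE('k) S {\<sigma> \<in> clique_complex E S. card (\<kappa> ` \<sigma>) \<le> 2} 3 (m * 2 ^ K)"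
proof -
  define X where "X P = {\<sigma> \<in> clique_complex E S. card (\<kappa> ` \<sigma>) \<le> 1 \<or> \<kappa> ` \<sigma> \<in> P}" for P
  let ?W = "{W. W \<subseteq> \<kappa> ` S \<and> card W = 2}"
  have \<Gamma>: "complex_on S (clique_complex E S)" by (rule complex_on_clique_complex[OF finS subset_refl])
  have fin\<sigma>: "finite \<sigma>" if "\<sigma> \<in> clique_complex E S" for \<sigma>
    using that finS finite_subset[of \<sigma> S] by (auto simp: clique_complex_def)
  have cX: "complex_on S (X P)" if P: "P \<subseteq> ?W" for P
  proof -
    have "\<tau> \<in> X P" if "\<sigma> \<in> X P" "\<tau> \<subseteq> \<sigma>" for \<sigma> \<tau>
    proof -
      have \<sigma>: "\<sigma> \<in> clique_complex E S" "card (\<kappa> ` \<sigma>) \<le> 1 \<or> \<kappa> ` \<sigma> \<in> P" using that(1) by (auto simp: X_def)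
      have \<tau>: "\<tau> \<in> clique_complex E S" using \<sigma>(1) that(2) \<Gamma> unfolding complex_on_def by auto
      have sub: "\<kappa> ` \<tau> \<subseteq> \<kappa> ` \<sigma>" "finite (\<kappa> ` \<sigma>)" using that(2) fin\<sigma>[OF \<sigma>(1)] by auto
      have le: "card (\<kappa> ` \<tau>) \<le> card (\<kappa> ` \<sigma>)" by (rule card_mono[OF sub(2,1)])
      show ?thesis
      proof (cases "\<kappa> ` \<tau> = \<kappa> ` \<sigma>")
        case True
        then show ?thesis using \<sigma>(2) \<tau> by (simp add: X_def)
      next
        case False
        then have "card (\<kappa> ` \<tau>) < card (\<kappa> ` \<sigma>)" using sub by (intro psubset_card_mono) auto
        moreover have "card (\<kappa> ` \<sigma>) \<le> 2" using \<sigma>(2) P by auto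
        ultimately show ?thesis using \<tau> by (simp add: X_def)
      qed
    qed
    then have "\<forall>\<sigma>\<in>X P. \<forall>\<tau>\<subseteq>\<sigma>. \<tau> \<in> X P" by (intro ballI allI impI)
    moreover have "X P \<subseteq> Pow S" by (auto simp: X_def clique_complex_def)
    ultimately show ?thesis using finS by (simp only: complex_on_def)
  qed
  have finW: "finite ?W" using finS by simp
  have "betti_le TYPE('k) S (X P) 3 (m * card P)" if "P \<subseteq> ?W" for P
  proof -
    have "finite P" using finite_subset[OF that finW] .
    then show ?thesis using that
    proof (induction P rule: finite_induct)
      case empty
      have "X {} = clique_complex mono_adj S" using mono_complex_eq[OF subset_refl] by (simp add: X_def)
      then show ?case using betti_le_mono_complex[OF subset_refl] by (simp add: numeral_3_eq_3)
    next
      case (insert W P)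
      then have W: "card W = 2" "W \<subseteq> \<kappa> ` S" by auto
      then obtain i j where ij: "W = {i, j}" "i \<noteq> j" unfolding card_2_iff by auto
      let ?Y = "clique_complex E {x \<in> S. \<kappa> x \<in> {i, j}}"
      have cY: "complex_on S ?Y" by (rule complex_on_clique_complex[OF finS]) auto
      have Y: "?Y = {\<sigma> \<in> clique_complex E S. \<kappa> ` \<sigma> \<subseteq> W}" unfolding clique_complex_def ij(1) by auto
      have sub: "card (\<kappa> ` \<sigma>) \<le> 1 \<or> \<kappa> ` \<sigma> = W" if "\<kappa> ` \<sigma> \<subseteq> W" for \<sigma>
      proof (cases "\<kappa> ` \<sigma> = W")
        case False
        then have "card (\<kappa> ` \<sigma>) < card W" using that ij(1) by (intro psubset_card_mono) auto
        then show ?thesis using W by simp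
      qed simp
      have card_W: "card (\<kappa> ` \<sigma>) \<le> 1 \<Longrightarrow> \<kappa> ` \<sigma> \<noteq> W" for \<sigma> using W(1) by auto
      have un: "X (insert W P) = X P \<union> ?Y"
        unfolding Y X_def using sub by blast
      have "X P \<inter> ?Y = {\<sigma> \<in> ?Y. card (\<kappa> ` \<sigma>) \<le> 1}"
        unfolding Y X_def using sub insert.hyps(2) by blast
      also have "\<dots> = clique_complex mono_adj {x \<in> S. \<kappa> x \<in> {i, j}}" by (rule mono_complex_eq) auto
      finally have int: "betti_le TYPE('k) S (X P \<inter> ?Y) (Suc (Suc 0)) 0"
        using betti_le_mono_complex[of "{x \<in> S. \<kappa> x \<in> {i, j}}" 0, where 'k = 'k] by simp
      have "betti_le TYPE('k) S (X P \<union> ?Y) (Suc (Suc (Suc 0))) (m * card P + m)"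
        using insert m[OF ij(2)] cX[of P] by (intro betti_le_Un cY int) (auto simp: numeral_3_eq_3)
      then show ?case using insert.hyps un by (simp add: numeral_3_eq_3 algebra_simps)
    qed
  qed
  from this[OF subset_refl] have "betti_le TYPE('k) S (X ?W) 3 (m * card ?W)" .
  moreover have "X ?W = {\<sigma> \<in> clique_complex E S. card (\<kappa> ` \<sigma>) \<le> 2}"
  proof -
    have "card (\<kappa> ` \<sigma>) \<le> 1 \<or> \<kappa> ` \<sigma> \<in> ?W \<longleftrightarrow> card (\<kappa> ` \<sigma>) \<le> 2" if "\<sigma> \<in> clique_complex E S" for \<sigma>
    proof -
      have "\<kappa> ` \<sigma> \<subseteq> \<kappa> ` S" using that by (auto simp: clique_complex_def)
      then show ?thesis by auto
    qed
    then show ?thesis unfolding X_def by auto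
  qed
  moreover have "m * card ?W \<le> m * 2 ^ K"
  proof (rule mult_left_mono)
    have "card ?W \<le> card (Pow (\<kappa> ` S))" using finS by (intro card_mono) auto
    also have "\<dots> = 2 ^ card (\<kappa> ` S)" using finS by (simp add: card_Pow)
    also have "\<dots> \<le> 2 ^ K" using card_colours by (intro power_increasing) auto
    finally show "card ?W \<le> 2 ^ K" .
  qed simp
  ultimately show ?thesis by (auto intro: betti_le_mono)
qed

text \<open>Vertices of \<open>C\<close> are deleted in increasing order of \<open>idx\<close>, down
  to the monochromatic complex on \<open>A\<close>. The cost is amortised: a class of edges in the
  link of \<open>v\<close> is charged to \<open>v\<close> if its key is the largest there, and to
  its key if \<open>v\<close> is the first vertex with a representative of that key. A class charged
  to neither would produce an alternation.\<close>

lemma betti_le_two_colours: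
  fixes idx :: "'v \<Rightarrow> nat" and i j :: 'c
  defines "A \<equiv> {x \<in> S. \<kappa> x = i}" and "C \<equiv> {x \<in> S. \<kappa> x = j}"
  assumes ij: "i \<noteq> j" and idx: "inj_on idx C"
    and no_alternation: "\<And>a b p q r. a \<in> A \<Longrightarrow> b \<in> A \<Longrightarrow> p \<in> C \<Longrightarrow> q \<in> C \<Longrightarrow> r \<in> C \<Longrightarrow> E a b \<Longrightarrow> E p q \<Longrightarrow> E q r \<Longrightarrow>
      idx p < idx q \<Longrightarrow> idx q < idx r \<Longrightarrow>
      E a p \<Longrightarrow> \<not> E b p \<Longrightarrow> E b q \<Longrightarrow> \<not> E a q \<Longrightarrow> E a r \<Longrightarrow> \<not> E b r \<Longrightarrow> False"
  shows "betti_le TYPE('k::field) S (clique_complex E (A \<union> C)) 3 (2 * card C)"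
proof -
  have sE: "E x y \<Longrightarrow> E y x" for x y using sympD[OF symE] .
  have rE: "E x x" for x using reflpD[OF reflE] .
  have AS: "A \<subseteq> S" and CS: "C \<subseteq> S" and AC: "A \<inter> C = {}" using ij by (auto simp: A_def C_def)
  have finC: "finite C" using CS finS finite_subset by auto
  have \<kappa>A: "\<kappa> x = i" if "x \<in> A" for x using that by (simp add: A_def)
  have \<kappa>C: "\<kappa> x = j" if "x \<in> C" for x using that by (simp add: C_def)
  have Acom: "E x y" if "x \<in> A" "y \<in> A" "z \<in> S" "E z x" "E z y" for x y z
    using common_neighbour[of x y z] that AS \<kappa>A by auto
  have Ccom: "E x y" if "x \<in> C" "y \<in> C" "z \<in> S" "E z x" "E z y" for x y z
    using common_neighbour[of x y z] that CS \<kappa>C by auto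
  \<comment> \<open>The neighbours of \<open>v\<close> at its deletion, when the earlier vertices of
    \<open>C\<close> are gone.\<close>
  define N where "N v = {x \<in> A \<union> {c \<in> C. idx v < idx c}. E v x}" for v
  define \<Gamma> where "\<Gamma> v = clique_complex E (N v)" for v
  define r where "r v = rainbow_adj (\<Gamma> v) \<kappa> 2" for v
  define R where "R v = rainbow (\<Gamma> v) \<kappa> 2" for v
  define key where "key \<tau> = (THE k. \<exists>c\<in>\<tau> \<inter> C. k = idx c)" for \<tau>
  have key: "key {a, c} = idx c" if "a \<in> A" "c \<in> C" for a c
    unfolding key_def using that AC by (intro the_equality) auto
  have NS: "N v \<subseteq> S" for v using AS CS by (auto simp: N_def)
  have c\<Gamma>: "complex_on S (\<Gamma> v)" for v unfolding \<Gamma>_def by (rule complex_on_clique_complex[OF finS NS])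
  have finR: "finite (R v)" for v
    using c\<Gamma>[of v] finS finite_subset[of "R v" "Pow S"] unfolding complex_on_def R_def rainbow_def by auto
  have tri: "insert a (insert a' {c}) \<in> \<Gamma> v" if "a \<in> N v" "a' \<in> N v" "c \<in> N v" "E a c" "E a' c" "E a a'" for a a' c v
    using that rE sE by (auto simp: \<Gamma>_def clique_complex_def)
  \<comment> \<open>Two edges of the link with a common end are equivalent: their other ends have
    one colour, so they are adjacent and complete a triangle.\<close>
  have conA: "({a, c}, {a', c}) \<in> (r v)\<^sup>*"
    if "a \<in> A" "a' \<in> A" "c \<in> C" "a \<in> N v" "a' \<in> N v" "c \<in> N v" "E a c" "E a' c" for a a' c v
  proof -
    have "E a a'" using Acom[OF that(1,2) _ sE[OF that(7)] sE[OF that(8)]] that(3) CS by auto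
    moreover have "a \<noteq> c" using that(1,3) AC by auto
    moreover from this have "card {a, c} = 2" by simp
    ultimately show ?thesis unfolding r_def using that \<kappa>A \<kappa>C ij
      by (intro rainbow_adj_insert[OF tri[of a v a' c] c\<Gamma>]) auto
  qed
  have conC: "({a, c}, {a, c'}) \<in> (r v)\<^sup>*"
    if "a \<in> A" "c \<in> C" "c' \<in> C" "a \<in> N v" "c \<in> N v" "c' \<in> N v" "E a c" "E a c'" for a c c' v
  proof -
    have "E c c'" using Ccom[OF that(2,3) _ that(7,8)] that(1) AS by auto
    moreover have "c \<noteq> a" using that(1,2) AC by auto
    moreover from this have "card {c, a} = 2" by simp
    ultimately have "(insert c {a}, insert c' {a}) \<in> (r v)\<^sup>*" unfolding r_def using that sE[OF that(7)] sE[OF that(8)] \<kappa>A \<kappa>C ij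
      by (intro rainbow_adj_insert[OF tri[of c v c' a] c\<Gamma>]) auto
    then show ?thesis by (simp add: insert_commute)
  qed
  have RE: "\<exists>a c. \<tau> = {a, c} \<and> a \<in> A \<and> c \<in> C \<and> a \<in> N v \<and> c \<in> N v \<and> E a c" if "\<tau> \<in> R v" for \<tau> v
  proof -
    have \<tau>: "\<tau> \<in> \<Gamma> v" "card \<tau> = 2" "inj_on \<kappa> \<tau>" using that by (auto simp: R_def rainbow_def)
    then obtain x y where xy: "\<tau> = {x, y}" "x \<noteq> y" unfolding card_2_iff by auto
    have "\<kappa> x \<noteq> \<kappa> y" using \<tau>(3) xy by auto
    moreover have "x \<in> N v" "y \<in> N v" "E x y" "E y x" using \<tau>(1) xy by (auto simp: \<Gamma>_def clique_complex_def)
    moreover have "x \<in> A \<or> x \<in> C" "y \<in> A \<or> y \<in> C" using \<open>x \<in> N v\<close> \<open>y \<in> N v\<close> by (auto simp: N_def)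
    ultimately have "x \<in> A \<and> y \<in> C \<or> x \<in> C \<and> y \<in> A" using \<kappa>A \<kappa>C by metis
    then show ?thesis using xy \<open>x \<in> N v\<close> \<open>y \<in> N v\<close> \<open>E x y\<close> \<open>E y x\<close> by (auto simp: insert_commute)
  qed
  have "\<exists>F. F \<subseteq> R v \<and> (\<forall>\<tau>\<in>R v. \<exists>\<sigma>\<in>F. (\<tau>, \<sigma>) \<in> (r v)\<^sup>*) \<and>
      (\<forall>\<sigma>\<in>F. \<forall>\<sigma>'\<in>F. (\<sigma>, \<sigma>') \<in> (r v)\<^sup>* \<longrightarrow> \<sigma> = \<sigma>') \<and> (\<forall>\<sigma>\<in>F. \<forall>\<tau>. (\<sigma>, \<tau>) \<in> (r v)\<^sup>* \<longrightarrow> key \<sigma> \<le> key \<tau>)" for v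
  proof -
    have "r v \<subseteq> R v \<times> R v" unfolding r_def R_def rainbow_adj_def by auto
    from class_representatives[OF finR[of v] sym_rainbow_adj[of "\<Gamma> v" \<kappa> 2, folded r_def] this, of key]
    obtain F where "F \<subseteq> R v" "\<And>\<tau>. \<tau> \<in> R v \<Longrightarrow> \<exists>\<sigma>\<in>F. (\<tau>, \<sigma>) \<in> (r v)\<^sup>*"
      "\<And>\<sigma> \<sigma>'. \<sigma> \<in> F \<Longrightarrow> \<sigma>' \<in> F \<Longrightarrow> (\<sigma>, \<sigma>') \<in> (r v)\<^sup>* \<Longrightarrow> \<sigma> = \<sigma>'"
      "\<And>\<sigma> \<tau>. \<sigma> \<in> F \<Longrightarrow> (\<sigma>, \<tau>) \<in> (r v)\<^sup>* \<Longrightarrow> key \<sigma> \<le> key \<tau>" by metis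
    then show ?thesis by (intro exI[of _ F]) simp
  qed
  then obtain F where F: "\<And>v. F v \<subseteq> R v" "\<And>v \<tau>. \<tau> \<in> R v \<Longrightarrow> \<exists>\<sigma>\<in>F v. (\<tau>, \<sigma>) \<in> (r v)\<^sup>*"
      "\<And>v \<sigma> \<sigma>'. \<sigma> \<in> F v \<Longrightarrow> \<sigma>' \<in> F v \<Longrightarrow> (\<sigma>, \<sigma>') \<in> (r v)\<^sup>* \<Longrightarrow> \<sigma> = \<sigma>'"
      "\<And>v \<sigma> \<tau>. \<sigma> \<in> F v \<Longrightarrow> (\<sigma>, \<tau>) \<in> (r v)\<^sup>* \<Longrightarrow> key \<sigma> \<le> key \<tau>"
    by metis
  have finF: "finite (F v)" for v using F(1) finR finite_subset by metis
  have lnk: "betti_le TYPE('k) S (\<Gamma> v) (Suc (Suc 0)) (card (F v))" for v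
  proof -
    have "betti_le TYPE('k) S (\<Gamma> v) (Suc 1) (card (F v) + 0)"
    proof (rule betti_le_rainbow[OF c\<Gamma> _ finF])
      show "betti_le TYPE('k) S {\<sigma> \<in> \<Gamma> v. card (\<kappa> ` \<sigma>) \<le> 1} (Suc 1) 0"
        unfolding \<Gamma>_def mono_complex_eq[OF NS] using betti_le_mono_complex[OF NS] by simp
      show "\<exists>\<tau>'\<in>F v. (\<tau>, \<tau>') \<in> (rainbow_adj (\<Gamma> v) \<kappa> (Suc 1))\<^sup>*" if "\<tau> \<in> rainbow (\<Gamma> v) \<kappa> (Suc 1)" for \<tau>
        using F(2)[of \<tau> v] that by (simp add: R_def r_def numeral_2_eq_2)
    qed
    then show ?thesis by simp
  qed
  have main: "betti_le TYPE('k) S (clique_complex E (A \<union> {c \<in> C. n \<le> idx c})) (Suc (Suc (Suc 0)))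
      (\<Sum>v\<in>{c \<in> C. n \<le> idx c}. card (F v))" for n
  \<comment> \<open>The values of \<open>idx\<close> need not be consecutive, so the induction is on
    the number of vertices left, with the threshold \<open>n\<close> free.\<close>
  proof (induction "card {c \<in> C. n \<le> idx c}" arbitrary: n)
    case 0
    then have e: "{c \<in> C. n \<le> idx c} = {}" using finC by auto
    have "clique_complex E A = clique_complex mono_adj A"
      using \<kappa>A unfolding clique_complex_def mono_adj_def by auto
    then show ?case unfolding e using betti_le_mono_complex[OF AS] by simp
  next
    case (Suc k)
    let ?C = "{c \<in> C. n \<le> idx c}"
    have "card ?C \<noteq> 0" using Suc(2) by simp
    then have fC: "finite ?C" "?C \<noteq> {}" using finC by (simp, fastforce)
    define v where "v = arg_min_on idx ?C"
    have v: "v \<in> ?C" "\<And>c. c \<in> ?C \<Longrightarrow> idx v \<le> idx c"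
      unfolding v_def using arg_min_if_finite(1)[OF fC] arg_min_least[OF fC] by auto
    have eq: "{c \<in> C. Suc (idx v) \<le> idx c} = ?C - {v}"
    proof -
      have "idx v < idx c" if "c \<in> ?C" "c \<noteq> v" for c
        using v(2)[OF that(1)] inj_onD[OF idx, of v c] that v(1) by force
      then show ?thesis using v(1) by (auto simp: Suc_le_eq)
    qed
    have IH: "betti_le TYPE('k) S (clique_complex E (A \<union> (?C - {v}))) (Suc (Suc (Suc 0))) (\<Sum>v\<in>?C - {v}. card (F v))"
      using Suc(1)[of "Suc (idx v)"] Suc(2) v(1) fC unfolding eq by simp
    have Nv: "{x \<in> A \<union> (?C - {v}). E v x} = N v"
      unfolding N_def eq[symmetric] by (auto simp: Suc_le_eq)
    have "betti_le TYPE('k) S (clique_complex E (insert v (A \<union> (?C - {v})))) (Suc (Suc (Suc 0))) ((\<Sum>v\<in>?C - {v}. card (F v)) + card (F v))"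
    proof (rule betti_le_clique_insert[OF reflE symE finS _ _ IH])
      show "betti_le TYPE('k) S (clique_complex E {x \<in> A \<union> (?C - {v}). E v x}) (Suc (Suc 0)) (card (F v))"
        unfolding Nv using lnk[of v] by (simp add: \<Gamma>_def)
    qed (use AS CS v(1) AC in auto)
    moreover have "insert v (A \<union> (?C - {v})) = A \<union> ?C" using v(1) by auto
    moreover have "(\<Sum>v\<in>?C - {v}. card (F v)) + card (F v) = (\<Sum>v\<in>?C. card (F v))"
      using sum.remove[OF fC(1) v(1), of "\<lambda>v. card (F v)"] by simp
    ultimately show ?case by simp
  qed
  \<comment> \<open>By \<open>conA\<close>, representatives with the same vertex in \<open>C\<close>
    are equivalent, hence equal.\<close>
  have same: "\<sigma> = \<sigma>'" if h: "\<sigma> \<in> F v" "\<sigma>' \<in> F v" "key \<sigma> = key \<sigma>'" for v \<sigma> \<sigma>'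
  proof -
    obtain a c where ac: "\<sigma> = {a, c}" "a \<in> A" "c \<in> C" "a \<in> N v" "c \<in> N v" "E a c"
      using RE[of \<sigma> v] F(1)[of v] h(1) by blast
    obtain a' c' where ac': "\<sigma>' = {a', c'}" "a' \<in> A" "c' \<in> C" "a' \<in> N v" "c' \<in> N v" "E a' c'"
      using RE[of \<sigma>' v] F(1)[of v] h(2) by blast
    have "c' = c" using h(3) ac ac' key inj_onD[OF idx, of c' c] by simp
    then have "(\<sigma>, \<sigma>') \<in> (r v)\<^sup>*" using ac ac' conA[of a a' c v] by simp
    then show ?thesis using F(3)[OF h(1,2)] by simp
  qed
  define Q where "Q = Sigma C F"
  \<comment> \<open>\<open>Q1\<close> injects into \<open>C\<close> by its first component,
    \<open>Q2\<close> by the key.\<close>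
  define Q1 where "Q1 = {(v, \<sigma>) \<in> Q. \<forall>\<sigma>'\<in>F v. key \<sigma>' \<le> key \<sigma>}"
  define Q2 where "Q2 = {(v, \<sigma>) \<in> Q. \<forall>w \<sigma>'. (w, \<sigma>') \<in> Q \<longrightarrow> key \<sigma>' = key \<sigma> \<longrightarrow> idx v \<le> idx w}"
  have keyC: "key \<sigma> \<in> idx ` C" if "\<sigma> \<in> F v" for v \<sigma>
    using RE[of \<sigma> v] F(1)[of v] that key by auto
  have "card Q1 = card (fst ` Q1)"
  proof (rule card_image[symmetric], rule inj_onI, clarify)
    fix v \<sigma> v' \<sigma>' assume h: "(v, \<sigma>) \<in> Q1" "(v', \<sigma>') \<in> Q1" "fst (v, \<sigma>) = fst (v', \<sigma>')"
    then have vv: "v' = v" "\<sigma> \<in> F v" "\<sigma>' \<in> F v" by (auto simp: Q1_def Q_def)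
    then have "key \<sigma> = key \<sigma>'" using h by (auto simp: Q1_def intro: le_antisym)
    then show "v = v' \<and> \<sigma> = \<sigma>'" using same[OF vv(2,3)] vv(1) by simp
  qed
  also have "\<dots> \<le> card C" using finC by (intro card_mono) (auto simp: Q1_def Q_def)
  finally have c1: "card Q1 \<le> card C" .
  have "card Q2 = card ((\<lambda>(v, \<sigma>). key \<sigma>) ` Q2)"
  proof (rule card_image[symmetric], rule inj_onI, clarify)
    fix v \<sigma> v' \<sigma>' assume h: "(v, \<sigma>) \<in> Q2" "(v', \<sigma>') \<in> Q2" "key \<sigma> = key \<sigma>'"
    then have q: "(v, \<sigma>) \<in> Q" "(v', \<sigma>') \<in> Q" by (auto simp: Q2_def)
    have "idx v \<le> idx v'" "idx v' \<le> idx v" using h q unfolding Q2_def by auto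
    then have "v = v'" using inj_onD[OF idx, of v v'] q by (auto simp: Q_def)
    then show "v = v' \<and> \<sigma> = \<sigma>'" using same[of \<sigma> v \<sigma>'] h(3) q by (auto simp: Q_def)
  qed
  also have "\<dots> \<le> card (idx ` C)" using finC keyC by (intro card_mono) (auto simp: Q2_def Q_def)
  also have "\<dots> = card C" by (rule card_image[OF idx])
  finally have c2: "card Q2 \<le> card C" .
  \<comment> \<open>Otherwise w < v < c < c2 in the order of \<open>C\<close>, where
    \<open>c\<close> is also a key of the earlier \<open>w\<close>, and \<open>c2\<close> a larger
    key of \<open>v\<close>.\<close>
  have "Q \<subseteq> Q1 \<union> Q2"
  proof (rule subrelI, rule ccontr)
    fix v \<sigma> assume vQ: "(v, \<sigma>) \<in> Q" and not: "(v, \<sigma>) \<notin> Q1 \<union> Q2"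
    have v: "v \<in> C" "\<sigma> \<in> F v" using vQ by (auto simp: Q_def)
    obtain \<sigma>2 where \<sigma>2: "\<sigma>2 \<in> F v" "key \<sigma> < key \<sigma>2" using not vQ by (auto simp: Q1_def not_le)
    obtain w \<sigma>' where w: "w \<in> C" "\<sigma>' \<in> F w" "key \<sigma>' = key \<sigma>" "idx w < idx v"
      using not vQ by (auto simp: Q2_def Q_def not_le)
    obtain a c where ac: "\<sigma> = {a, c}" "a \<in> A" "c \<in> C" "a \<in> N v" "c \<in> N v" "E a c"
      using RE[of \<sigma> v] F(1)[of v] v(2) by blast
    obtain a2 c2 where ac2: "\<sigma>2 = {a2, c2}" "a2 \<in> A" "c2 \<in> C" "a2 \<in> N v" "c2 \<in> N v" "E a2 c2"
      using RE[of \<sigma>2 v] F(1)[of v] \<sigma>2(1) by blast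
    obtain b c' where bc': "\<sigma>' = {b, c'}" "b \<in> A" "c' \<in> C" "b \<in> N w" "c' \<in> N w" "E b c'"
      using RE[of \<sigma>' w] F(1)[of w] w(2) by blast
    have "idx c' = idx c" using w(3) key ac bc' by simp
    then have cc: "c' = c" using inj_onD[OF idx] ac(3) bc'(3) by auto
    note bc = bc'[unfolded cc]
    have lt: "idx v < idx c" "idx c < idx c2" using ac(5,3) AC \<sigma>2(2) key ac ac2 by (auto simp: N_def)
    have nb: "E v a" "E v c" "E v a2" "E v c2" "E w b" "E w c" using ac ac2 bc by (auto simp: N_def)
    have S: "a \<in> S" "a2 \<in> S" "b \<in> S" "v \<in> S" "w \<in> S" "c \<in> S" "c2 \<in> S"
      using AS CS ac(2,3) ac2(2,3) bc(2) v(1) w(1) by auto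
    have wv: "v \<in> N w" if "x \<in> A" "E x w" "E x v" for x
      using Ccom[OF w(1) v(1) _ that(2,3)] that(1) AS v(1) w(4) by (auto simp: N_def)
    have min: "idx c \<le> idx v" if "({b, c}, {x, v}) \<in> (r w)\<^sup>*" "x \<in> A" for x
      using F(4)[OF w(2), of "{x, v}"] that bc(1) key[OF bc(2,3)] key[OF that(2) v(1)] by simp
    \<comment> \<open>The key of \<open>c\<close> is minimal in its class at \<open>w\<close>; an
      edge from \<open>a\<close> to \<open>w\<close>, or from \<open>b\<close> to \<open>v\<close>,
      would bring an edge with the smaller key of \<open>v\<close> into that class.\<close>
    have naw: "\<not> E a w"
    proof
      assume aw: "E a w"
      have vw: "v \<in> N w" by (rule wv[OF ac(2) aw sE[OF nb(1)]])
      have aN: "a \<in> N w" using ac(2) sE[OF aw] by (simp add: N_def)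
      have "({b, c}, {a, c}) \<in> (r w)\<^sup>*" using bc ac aN by (intro conA) auto
      also have "({a, c}, {a, v}) \<in> (r w)\<^sup>*" using ac bc(5) aN vw v(1) sE[OF nb(1)] by (intro conC) auto
      finally show False using min ac(2) lt by force
    qed
    have nbv: "\<not> E b v"
    proof
      assume bv: "E b v"
      have vw: "v \<in> N w" by (rule wv[OF bc(2) sE[OF nb(5)] bv])
      have "({b, c}, {b, v}) \<in> (r w)\<^sup>*" using bc vw v(1) bv by (intro conC) auto
      then show False using min bc(2) lt by force
    qed
    \<comment> \<open>\<open>\<sigma>\<close> and \<open>\<sigma>2\<close> represent different
      classes at \<open>v\<close>, so neither cross edge can exist.\<close>
    have nac2: "\<not> E a c2"
    proof
      assume h: "E a c2"
      have "({a, c}, {a, c2}) \<in> (r v)\<^sup>*" using ac ac2 h by (intro conC) auto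
      also have "({a, c2}, {a2, c2}) \<in> (r v)\<^sup>*" using ac ac2 h by (intro conA) auto
      finally show False using F(3)[OF v(2) \<sigma>2(1)] ac(1) ac2(1) \<sigma>2(2) by auto
    qed
    have na2c: "\<not> E a2 c"
    proof
      assume h: "E a2 c"
      have "({a, c}, {a2, c}) \<in> (r v)\<^sup>*" using ac ac2 h by (intro conA) auto
      also have "({a2, c}, {a2, c2}) \<in> (r v)\<^sup>*" using ac ac2 h by (intro conC) auto
      finally show False using F(3)[OF v(2) \<sigma>2(1)] ac(1) ac2(1) \<sigma>2(2) by auto
    qed
    have ab: "E a b" by (rule Acom[OF ac(2) bc(2) S(6) sE[OF ac(6)] sE[OF bc(6)]])
    have "E a a2" by (rule Acom[OF ac(2) ac2(2) S(4) nb(1,3)])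
    then have a2b: "E a2 b" by (rule Acom[OF ac2(2) bc(2) S(1) _ ab])
    have ccc: "E c c2" by (rule Ccom[OF ac(3) ac2(3) S(4) nb(2,4)])
    have Ewv: "E w v" by (rule Ccom[OF w(1) v(1) S(6) sE[OF nb(6)] sE[OF nb(2)]])
    \<comment> \<open>If \<open>b\<close> misses \<open>c2\<close>, then \<open>a2\<close> and
      \<open>b\<close> alternate on v, c, c2; otherwise \<open>b\<close> and \<open>a\<close>
      alternate on w, v, c2.\<close>
    have bc2: "E b c2"
    proof (rule ccontr)
      assume "\<not> E b c2"
      then show False
        by (rule no_alternation[OF ac2(2) bc(2) v(1) ac(3) ac2(3) a2b nb(2) ccc lt sE[OF nb(3)] nbv bc(6) na2c ac2(6)])
    qed
    show False
      by (rule no_alternation[OF bc(2) ac(2) w(1) v(1) ac2(3) sE[OF ab] Ewv nb(4) w(4) less_trans[OF lt]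
            sE[OF nb(5)] naw sE[OF nb(1)] nbv bc2 nac2])
  qed
  then have "card Q \<le> card (Q1 \<union> Q2)"
    using finC finF by (intro card_mono finite_UnI) (auto simp: Q_def Q1_def Q2_def intro: finite_subset[of _ "Sigma C F"])
  also have "\<dots> \<le> 2 * card C" using card_Un_le[of Q1 Q2] c1 c2 by linarith
  finally have "(\<Sum>v\<in>C. card (F v)) \<le> 2 * card C" using finC finF by (simp add: Q_def card_SigmaI)
  moreover have "{c \<in> C. 0 \<le> idx c} = C" by simp
  ultimately show ?thesis using main[of 0] unfolding numeral_3_eq_3 by (auto intro: betti_le_mono)
qed

end

section \<open>Geometry of the plane\<close>

text \<open>The right-hand arcs of two circles of equal radius, as graphs over the height, cross at
  most once. In terms of discs: convexity yields a point of the first disc level with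
  \<open>q\<close> and to its left, which forces \<open>a1 < b1\<close>; the position of
  \<open>b2\<close> then decides whether \<open>p\<close> or \<open>r\<close> falls into the second
  disc.\<close>

lemma no_alternation_real:
  fixes a1 a2 b1 b2 p1 p2 q1 q2 r1 r2 R :: real
  assumes gap: "a1 \<le> q1" "b1 \<le> p1" "b1 \<le> q1" "b1 \<le> r1"
    and ord: "p2 \<le> q2" "q2 \<le> r2"
    and ap: "(p1 - a1)\<^sup>2 + (p2 - a2)\<^sup>2 \<le> R" and bp: "(p1 - b1)\<^sup>2 + (p2 - b2)\<^sup>2 > R"
    and bq: "(q1 - b1)\<^sup>2 + (q2 - b2)\<^sup>2 \<le> R" and aq: "(q1 - a1)\<^sup>2 + (q2 - a2)\<^sup>2 > R"
    and ar: "(r1 - a1)\<^sup>2 + (r2 - a2)\<^sup>2 \<le> R" and br: "(r1 - b1)\<^sup>2 + (r2 - b2)\<^sup>2 > R"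
  shows False
proof -
  obtain t where t: "0 \<le> t" "t \<le> 1" "q2 = (1 - t) * p2 + t * r2"
  proof (cases "p2 = r2")
    case True
    then show thesis using ord that[of 0] by simp
  next
    case False
    then have "p2 < r2" using ord by simp
    define t where "t = (q2 - p2) / (r2 - p2)"
    have "t * (r2 - p2) = q2 - p2" using False by (simp add: t_def)
    then have "q2 = (1 - t) * p2 + t * r2" by (simp add: algebra_simps)
    moreover have "0 \<le> t" "t \<le> 1" using \<open>p2 < r2\<close> ord by (auto simp: t_def)
    ultimately show thesis by (intro that)
  qed
  \<comment> \<open>The point of the segment from \<open>p\<close> to \<open>r\<close> at the height
    of \<open>q\<close>.\<close>
  define m1 where "m1 = (1 - t) * p1 + t * r1"
  have cvx: "((1 - t) * x + t * y)\<^sup>2 \<le> (1 - t) * x\<^sup>2 + t * y\<^sup>2" for x y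
  proof -
    have "(1 - t) * x\<^sup>2 + t * y\<^sup>2 - ((1 - t) * x + t * y)\<^sup>2 = t * (1 - t) * (x - y)\<^sup>2"
      by (simp add: power2_eq_square algebra_simps)
    moreover have "0 \<le> t * (1 - t) * (x - y)\<^sup>2" using t by simp
    ultimately show ?thesis by linarith
  qed
  have "(m1 - a1)\<^sup>2 + (q2 - a2)\<^sup>2 \<le> (1 - t) * (p1 - a1)\<^sup>2 + t * (r1 - a1)\<^sup>2 + ((1 - t) * (p2 - a2)\<^sup>2 + t * (r2 - a2)\<^sup>2)"
    using cvx[of "p1 - a1" "r1 - a1"] cvx[of "p2 - a2" "r2 - a2"] by (simp add: m1_def t(3) algebra_simps)
  also have "\<dots> = (1 - t) * ((p1 - a1)\<^sup>2 + (p2 - a2)\<^sup>2) + t * ((r1 - a1)\<^sup>2 + (r2 - a2)\<^sup>2)"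
    by (simp add: algebra_simps)
  also have "\<dots> \<le> (1 - t) * R + t * R" using t ap ar by (intro add_mono mult_left_mono) auto
  finally have am: "(m1 - a1)\<^sup>2 + (q2 - a2)\<^sup>2 \<le> R" by (simp add: algebra_simps)
  have qm: "m1 < q1"
  proof (rule ccontr)
    assume "\<not> m1 < q1"
    then have "(q1 - a1)\<^sup>2 \<le> (m1 - a1)\<^sup>2" using gap by (intro power_mono) auto
    then show False using am aq by linarith
  qed
  \<comment> \<open>The difference of the squared distances to the two centres is affine. It is
    positive at \<open>q\<close> but not at the point to the left of \<open>q\<close>, so it grows
    to the right.\<close>
  have g: "(z1 - a1)\<^sup>2 + (z2 - a2)\<^sup>2 - ((z1 - b1)\<^sup>2 + (z2 - b2)\<^sup>2)
      = 2 * (b1 - a1) * z1 + 2 * (b2 - a2) * z2 + (a1\<^sup>2 + a2\<^sup>2 - b1\<^sup>2 - b2\<^sup>2)" for z1 z2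
    by (simp add: power2_eq_square algebra_simps)
  define h where "h = a1\<^sup>2 + a2\<^sup>2 - b1\<^sup>2 - b2\<^sup>2"
  have gp: "2 * (b1 - a1) * p1 + 2 * (b2 - a2) * p2 + h < 0" using g[of p1 p2] ap bp by (simp add: h_def)
  have gr: "2 * (b1 - a1) * r1 + 2 * (b2 - a2) * r2 + h < 0" using g[of r1 r2] ar br by (simp add: h_def)
  have gq: "2 * (b1 - a1) * q1 + 2 * (b2 - a2) * q2 + h > 0" using g[of q1 q2] aq bq by (simp add: h_def)
  have "2 * (b1 - a1) * m1 + 2 * (b2 - a2) * q2 + h =
      (1 - t) * (2 * (b1 - a1) * p1 + 2 * (b2 - a2) * p2 + h) + t * (2 * (b1 - a1) * r1 + 2 * (b2 - a2) * r2 + h)"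
    by (simp add: m1_def t(3) algebra_simps)
  also have "\<dots> \<le> (1 - t) * 0 + t * 0" using t gp gr by (intro add_mono mult_left_mono) auto
  finally have "(b1 - a1) * (q1 - m1) > 0" using gq by (simp add: algebra_simps)
  then have ba: "a1 < b1" using qm by (simp add: zero_less_mult_iff)
  have closer: "\<bar>z2 - a2\<bar> < \<bar>z2 - b2\<bar>"
    if "b1 \<le> z1" "(z1 - a1)\<^sup>2 + (z2 - a2)\<^sup>2 \<le> R" "(z1 - b1)\<^sup>2 + (z2 - b2)\<^sup>2 > R" for z1 z2
  proof -
    have "(z1 - b1)\<^sup>2 \<le> (z1 - a1)\<^sup>2" using that ba by (intro power_mono) auto
    then have "(z2 - a2)\<^sup>2 < (z2 - b2)\<^sup>2" using that by linarith
    then show ?thesis using abs_le_square_iff[of "z2 - b2" "z2 - a2"] by linarith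
  qed
  note p = closer[OF gap(2) ap bp] and r = closer[OF gap(4) ar br]
  \<comment> \<open>\<open>b2\<close> cannot lie between \<open>p2\<close> and \<open>r2\<close>,
    since \<open>a2\<close> is closer to both. If it lies above, \<open>r\<close> is at least as
    close to \<open>b\<close> as \<open>q\<close> in both coordinates; if below, \<open>p\<close>
    is.\<close>
  consider "b2 > r2" | "b2 < p2" using p r ord by linarith
  then show False
  proof cases
    case 1
    have "a2 < b2" using 1 r by linarith
    then have "(b2 - a2) * (q2 - r2) \<le> 0" using ord by (simp add: mult_nonneg_nonpos)
    moreover have "(b1 - a1) * (q1 - r1) + (b2 - a2) * (q2 - r2) > 0" using gq gr by (simp add: algebra_simps)
    ultimately have "(b1 - a1) * (q1 - r1) > 0" by linarith
    then have "r1 < q1" using ba by (simp add: zero_less_mult_iff)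
    then have "(r1 - b1)\<^sup>2 \<le> (q1 - b1)\<^sup>2" using gap by (intro power_mono) auto
    moreover have "(b2 - r2)\<^sup>2 \<le> (b2 - q2)\<^sup>2" using 1 ord by (intro power_mono) auto
    ultimately show False using br bq by (simp add: power2_commute)
  next
    case 2
    have "b2 < a2" using 2 p by linarith
    then have "(b2 - a2) * (q2 - p2) \<le> 0" using ord by (simp add: mult_nonpos_nonneg)
    moreover have "(b1 - a1) * (q1 - p1) + (b2 - a2) * (q2 - p2) > 0" using gq gp by (simp add: algebra_simps)
    ultimately have "(b1 - a1) * (q1 - p1) > 0" by linarith
    then have "p1 < q1" using ba by (simp add: zero_less_mult_iff)
    then have "(p1 - b1)\<^sup>2 \<le> (q1 - b1)\<^sup>2" using gap by (intro power_mono) auto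
    moreover have "(p2 - b2)\<^sup>2 \<le> (q2 - b2)\<^sup>2" using 2 ord by (intro power_mono) auto
    ultimately show False using bp bq by linarith
  qed
qed

text \<open>The apex \<open>a\<close> is the origin, \<open>b' = b + P\<close> and \<open>v' = v + Q\<close>. To first order \<open>P\<close> and \<open>Q\<close> are parallel and
  orthogonal to \<open>v - b\<close>, so that one of the two thin triangles lies above the other.\<close>

lemma opposite_edge_longest_real:
  fixes b1 b2 v1 v2 P1 P2 Q1 Q2 :: real
  defines "\<beta> \<equiv> b1\<^sup>2 + b2\<^sup>2" and "\<nu> \<equiv> v1\<^sup>2 + v2\<^sup>2" and "\<mu> \<equiv> (v1 - b1)\<^sup>2 + (v2 - b2)\<^sup>2"
    and "\<beta>' \<equiv> (b1 + P1)\<^sup>2 + (b2 + P2)\<^sup>2" and "\<nu>' \<equiv> (v1 + Q1)\<^sup>2 + (v2 + Q2)\<^sup>2"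
    and "\<mu>' \<equiv> (v1 + Q1 - b1 - P1)\<^sup>2 + (v2 + Q2 - b2 - P2)\<^sup>2"
  assumes lo: "49/50 \<le> \<beta>" "49/50 \<le> \<nu>" "49/50 \<le> \<mu>" and hi: "\<beta> \<le> 1" "\<nu> \<le> 1" "\<mu> \<le> 1" "\<beta>' \<le> 1" "\<nu>' \<le> 1" "\<mu>' \<le> 1"
    and PQ: "P1\<^sup>2 + P2\<^sup>2 \<le> (1/100)\<^sup>2" "Q1\<^sup>2 + Q2\<^sup>2 \<le> (1/100)\<^sup>2"
    and far: "(v1 + Q1 - b1)\<^sup>2 + (v2 + Q2 - b2)\<^sup>2 > 1" "(v1 - b1 - P1)\<^sup>2 + (v2 - b2 - P2)\<^sup>2 > 1"
  shows "(\<beta> < \<mu> \<and> \<nu> < \<mu>) \<or> (\<beta>' < \<mu>' \<and> \<nu>' < \<mu>')"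
proof -
  define n1 n2 where "n1 = v1 - b1" and "n2 = v2 - b2"
  define p q where "p = sqrt (P1\<^sup>2 + P2\<^sup>2)" and "q = sqrt (Q1\<^sup>2 + Q2\<^sup>2)"
  define D where "D = P1 * Q1 + P2 * Q2"
  define x x' where "x = P1 * n1 + P2 * n2" and "x' = Q1 * n1 + Q2 * n2"
  define y y' where "y = P2 * n1 - P1 * n2" and "y' = Q2 * n1 - Q1 * n2"
  define h where "h = b2 * n1 - b1 * n2"
  have p: "p \<ge> 0" "p\<^sup>2 = P1\<^sup>2 + P2\<^sup>2" and q: "q \<ge> 0" "q\<^sup>2 = Q1\<^sup>2 + Q2\<^sup>2" by (auto simp: p_def q_def)
  have pe: "p \<le> 1/100" using PQ(1) p by (intro power2_le_imp_le[of p "1/100"]) auto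
  have qe: "q \<le> 1/100" using PQ(2) q by (intro power2_le_imp_le[of q "1/100"]) auto
  have Dpq: "\<bar>D\<bar> \<le> p * q"
  proof -
    have "(p * q)\<^sup>2 - D\<^sup>2 = (P1 * Q2 - P2 * Q1)\<^sup>2"
      unfolding power_mult_distrib p(2) q(2) D_def by (simp add: power2_eq_square algebra_simps)
    then have "D\<^sup>2 \<le> (p * q)\<^sup>2" using zero_le_power2[of "P1 * Q2 - P2 * Q1"] by linarith
    then show ?thesis using abs_le_square_iff[of D "p * q"] p(1) q(1) by simp
  qed
  have \<mu>: "\<mu> = n1\<^sup>2 + n2\<^sup>2" by (simp add: \<mu>_def n1_def n2_def)
  have f1: "\<mu> + 2 * x' + q\<^sup>2 > 1"
    using far(1) unfolding q(2) \<mu>_def x'_def n1_def n2_def by (simp add: power2_eq_square algebra_simps)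
  have f2: "\<mu> - 2 * x + p\<^sup>2 > 1"
    using far(2) unfolding p(2) \<mu>_def x_def n1_def n2_def by (simp add: power2_eq_square algebra_simps)
  have f3: "\<mu>' = \<mu> + 2 * x' - 2 * x + p\<^sup>2 + q\<^sup>2 - 2 * D"
    unfolding p(2) q(2) \<mu>'_def \<mu>_def x_def x'_def n1_def n2_def D_def by (simp add: power2_eq_square algebra_simps)
  \<comment> \<open>The squared diagonals add up to \<open>\<mu> + \<mu>' + 2 * D\<close> and exceed
    2 in total, so both edges miss 1 by less than \<open>2 * D\<close>, a quantity of second order
    by \<open>Dpq\<close>.\<close>
  have D1: "1 - \<mu> < 2 * D" using f1 f2 f3 hi(6) by linarith
  have D2: "1 - \<mu>' < 2 * D" using f1 f2 f3 hi(3) by linarith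
  have Dpos: "D > 0" using D1 hi(3) by linarith
  then have pq: "p > 0" "q > 0" using Dpq p(1) q(1) by (auto simp: less_le)
  have small: "p * q \<le> p / 100" "p * q \<le> q / 100" "p\<^sup>2 \<le> p / 100" "q\<^sup>2 \<le> q / 100"
    using mult_left_mono[OF qe p(1)] mult_right_mono[OF pe q(1)] mult_left_mono[OF pe p(1)] mult_left_mono[OF qe q(1)]
    by (simp_all add: power2_eq_square)
  \<comment> \<open>\<open>x\<close> and \<open>x'\<close> measure the displacements along the edge
    and are of second order; hence \<open>y\<close> and \<open>y'\<close>, across it, carry almost
    the full length.\<close>
  have xb: "\<bar>x\<bar> \<le> p / 100"
    using f1 f2 f3 hi(3,6) Dpq small zero_le_power2[of p] by linarith
  have x'b: "\<bar>x'\<bar> \<le> q / 100"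
    using f1 f2 f3 hi(3,6) Dpq small zero_le_power2[of q] by linarith
  have ysq: "\<mu> * p\<^sup>2 = x\<^sup>2 + y\<^sup>2" "\<mu> * q\<^sup>2 = x'\<^sup>2 + y'\<^sup>2"
    unfolding \<mu> p(2) q(2) x_def y_def x'_def y'_def by (simp_all add: power2_eq_square algebra_simps)
  have ylow: "\<bar>y\<bar> \<ge> 98/100 * p" "\<bar>y'\<bar> \<ge> 98/100 * q"
  proof -
    have "x\<^sup>2 \<le> p\<^sup>2 / 10000" using power_mono[OF xb, of 2] by (simp add: power_divide)
    moreover have "49/50 * p\<^sup>2 \<le> \<mu> * p\<^sup>2" using lo(3) by (intro mult_right_mono) auto
    moreover have "(98/100 * p)\<^sup>2 = 9604/10000 * p\<^sup>2" by (simp add: power2_eq_square)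
    ultimately have "(98/100 * p)\<^sup>2 \<le> y\<^sup>2" using ysq(1) zero_le_power2[of p] by linarith
    then show "\<bar>y\<bar> \<ge> 98/100 * p" using abs_le_square_iff[of "98/100 * p" y] p(1) by simp
    have "x'\<^sup>2 \<le> q\<^sup>2 / 10000" using power_mono[OF x'b, of 2] by (simp add: power_divide)
    moreover have "49/50 * q\<^sup>2 \<le> \<mu> * q\<^sup>2" using lo(3) by (intro mult_right_mono) auto
    moreover have "(98/100 * q)\<^sup>2 = 9604/10000 * q\<^sup>2" by (simp add: power2_eq_square)
    ultimately have "(98/100 * q)\<^sup>2 \<le> y'\<^sup>2" using ysq(2) zero_le_power2[of q] by linarith
    then show "\<bar>y'\<bar> \<ge> 98/100 * q" using abs_le_square_iff[of "98/100 * q" y'] q(1) by simp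
  qed
  \<comment> \<open>With opposite signs, the dominant term of \<open>\<mu> * D\<close> would be
    negative, against \<open>D > 0\<close>.\<close>
  have yy: "y * y' > 0"
  proof (rule ccontr)
    assume "\<not> y * y' > 0"
    then have "y * y' = - (\<bar>y\<bar> * \<bar>y'\<bar>)" by (simp add: abs_mult[symmetric])
    moreover have "(98/100 * p) * (98/100 * q) \<le> \<bar>y\<bar> * \<bar>y'\<bar>" using ylow p(1) q(1) by (intro mult_mono) auto
    moreover have "\<bar>x\<bar> * \<bar>x'\<bar> \<le> (p / 100) * (q / 100)" using xb x'b p(1) by (intro mult_mono) auto
    moreover have "x * x' \<le> \<bar>x\<bar> * \<bar>x'\<bar>" by (simp add: abs_mult[symmetric])
    moreover have "\<mu> * D = x * x' + y * y'"
      unfolding \<mu> x_def y_def x'_def y'_def D_def by (simp add: power2_eq_square algebra_simps)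
    moreover have "\<mu> * D > 0" using Dpos lo(3) by simp
    moreover have "p * q > 0" using pq by simp
    ultimately show False by simp
  qed
  define bn vn where "bn = b1 * n1 + b2 * n2" and "vn = v1 * n1 + v2 * n2"
  have bn: "bn = (\<nu> - \<beta> - \<mu>) / 2" unfolding bn_def \<nu>_def \<beta>_def \<mu>_def n1_def n2_def by (simp add: power2_eq_square field_simps)
  have vn: "vn = (\<nu> - \<beta> + \<mu>) / 2" unfolding vn_def \<nu>_def \<beta>_def \<mu>_def n1_def n2_def by (simp add: power2_eq_square field_simps)
  have "\<bar>bn\<bar> \<le> 51/100" unfolding bn abs_le_iff using lo hi(1-3) by (simp add: field_simps)
  moreover have "\<bar>vn\<bar> \<le> 51/100" unfolding vn abs_le_iff using lo hi(1-3) by (simp add: field_simps)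
  ultimately have bvn: "\<bar>bn\<bar> \<le> 51/100" "\<bar>vn\<bar> \<le> 51/100" .
  \<comment> \<open>Up to sign, \<open>h\<close> is twice the area of the triangle, which would be
    sqrt 3 / 2 for an equilateral one.\<close>
  have hh: "\<bar>h\<bar> \<ge> 83/100"
  proof -
    have "\<beta> * \<mu> = bn\<^sup>2 + h\<^sup>2" unfolding \<mu> \<beta>_def bn_def h_def by (simp add: power2_eq_square algebra_simps)
    moreover have "bn\<^sup>2 \<le> (51/100)\<^sup>2" using bvn(1) abs_le_square_iff[of bn "51/100"] by simp
    moreover have "(49/50) * (49/50) \<le> \<beta> * \<mu>" using lo by (intro mult_mono) auto
    ultimately have "(83/100)\<^sup>2 \<le> h\<^sup>2" by (simp add: power2_eq_square)
    then show ?thesis using abs_le_square_iff[of "83/100" h] by simp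
  qed
  have Pb: "\<mu> * (P1 * b1 + P2 * b2) = x * bn + y * h"
    unfolding \<mu> x_def y_def bn_def h_def by (simp add: power2_eq_square algebra_simps)
  have Qv: "\<mu> * (Q1 * v1 + Q2 * v2) = x' * vn + y' * h"
    unfolding \<mu> x'_def y'_def vn_def h_def n1_def n2_def by (simp add: power2_eq_square algebra_simps)
  have xbn: "\<bar>x * bn\<bar> \<le> p / 100"
    using mult_mono[OF xb bvn(1)] p(1) by (simp add: abs_mult)
  have xvn: "\<bar>x' * vn\<bar> \<le> q / 100"
    using mult_mono[OF x'b bvn(2)] q(1) by (simp add: abs_mult)
  have yh: "\<bar>y * h\<bar> \<ge> 81/100 * p"
    using mult_mono[OF ylow(1) hh] p(1) by (simp add: abs_mult)
  have y'h: "\<bar>y' * h\<bar> \<ge> 81/100 * q"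
    using mult_mono[OF ylow(2) hh] q(1) by (simp add: abs_mult)
  define B where "B = P1 * b1 + P2 * b2"
  define G where "G = Q1 * v1 + Q2 * v2"
  have \<beta>': "\<beta>' = \<beta> + 2 * B + p\<^sup>2" unfolding \<beta>'_def \<beta>_def B_def p(2) by (simp add: power2_eq_square algebra_simps)
  have \<nu>': "\<nu>' = \<nu> + 2 * G + q\<^sup>2" unfolding \<nu>'_def \<nu>_def G_def q(2) by (simp add: power2_eq_square algebra_simps)
  have mul: "z \<ge> 8/10 * r" if "\<mu> * z \<ge> 8/10 * r" "r \<ge> 0" for z r
  proof (cases "z \<ge> 0")
    case True
    then have "\<mu> * z \<le> 1 * z" using hi(3) by (intro mult_right_mono) auto
    then show ?thesis using that by simp
  next
    case False
    then have "\<mu> * z < 0" using lo(3) by (simp add: mult_pos_neg)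
    then show ?thesis using that by simp
  qed
  have sgn: "y * h > 0 \<longleftrightarrow> y' * h > 0" using yy by (auto simp: zero_less_mult_iff)
  show ?thesis
  proof (cases "y * h > 0")
    \<comment> \<open>\<open>P\<close> and \<open>Q\<close> point away from the apex: \<beta>' \<le>
      1 pushes \<open>\<beta>\<close> below 1 by at least \<open>1.6 * p\<close>, while
      \<open>\<mu>\<close> misses 1 by less than \<open>p / 50\<close>. The other case is analogous,
      with primed and unprimed edges exchanged.\<close>
    case True
    have "\<mu> * B \<ge> 8/10 * p" unfolding B_def Pb using True yh xbn pq by (simp add: abs_if split: if_splits)
    then have "B \<ge> 8/10 * p" using mul p(1) by blast
    then have 1: "\<beta> < \<mu>" using \<beta>' hi(4) D1 Dpq small pq zero_le_power2[of p] by linarith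
    have "\<mu> * G \<ge> 8/10 * q" unfolding G_def Qv using True sgn y'h xvn pq by (simp add: abs_if split: if_splits)
    then have "G \<ge> 8/10 * q" using mul q(1) by blast
    then have "\<nu> < \<mu>" using \<nu>' hi(5) D1 Dpq small pq zero_le_power2[of q] by linarith
    with 1 show ?thesis by simp
  next
    case False
    have "\<mu> * (- B) \<ge> 8/10 * p" unfolding B_def mult_minus_right Pb using False yh xbn pq by (simp add: abs_if split: if_splits)
    then have "- B \<ge> 8/10 * p" using mul p(1) by blast
    then have 1: "\<beta>' < \<mu>'" using \<beta>' hi(1) D2 Dpq small pq by linarith
    have "\<mu> * (- G) \<ge> 8/10 * q" unfolding G_def mult_minus_right Qv using False sgn y'h xvn pq by (simp add: abs_if split: if_splits)
    then have "- G \<ge> 8/10 * q" using mul q(1) by blast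
    then have "\<nu>' < \<mu>'" using \<nu>' hi(2) D2 Dpq small pq by linarith
    with 1 show ?thesis by simp
  qed
qed

lemma dist_square_2: "(dist x y)\<^sup>2 = (x $ 1 - y $ 1)\<^sup>2 + (x $ 2 - y $ 2)\<^sup>2" for x y :: "real ^ 2"
  unfolding dist_vec_def L2_set_def by (simp add: sum_2 dist_real_def)

lemma opposite_edge_longest:
  fixes a b v b' v' :: "real ^ 2"
  assumes lo: "99/100 \<le> dist a b" "99/100 \<le> dist a v" "99/100 \<le> dist b v"
    and hi: "dist a b \<le> 1" "dist a v \<le> 1" "dist b v \<le> 1" "dist a b' \<le> 1" "dist a v' \<le> 1" "dist b' v' \<le> 1"
    and near: "dist b b' \<le> 1/100" "dist v v' \<le> 1/100" and far: "dist b v' > 1" "dist b' v > 1"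
  shows "(dist a b < dist b v \<and> dist a v < dist b v) \<or> (dist a b' < dist b' v' \<and> dist a v' < dist b' v')"
proof -
  have sq_hi: "(dist x y)\<^sup>2 \<le> 1" if "dist x y \<le> 1" for x y :: "real ^ 2"
    using power_mono[OF that, of 2] by simp
  have sq_lo: "49/50 \<le> (dist x y)\<^sup>2" if "99/100 \<le> dist x y" for x y :: "real ^ 2"
    using power_mono[OF that, of 2] by (simp add: power2_eq_square)
  have sq_near: "(dist x y)\<^sup>2 \<le> (1/100)\<^sup>2" if "dist x y \<le> 1/100" for x y :: "real ^ 2"
    using power_mono[OF that, of 2] by simp
  have sq_far: "(dist x y)\<^sup>2 > 1" if "dist x y > 1" for x y :: "real ^ 2"
    using power_strict_mono[OF that, of 2] by simp
  have less: "(dist x y)\<^sup>2 < (dist z w)\<^sup>2 \<Longrightarrow> dist x y < dist z w" for x y z w :: "real ^ 2"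
    by (rule power2_less_imp_less) auto
  have "((dist a b)\<^sup>2 < (dist b v)\<^sup>2 \<and> (dist a v)\<^sup>2 < (dist b v)\<^sup>2) \<or> ((dist a b')\<^sup>2 < (dist b' v')\<^sup>2 \<and> (dist a v')\<^sup>2 < (dist b' v')\<^sup>2)"
    using opposite_edge_longest_real[of "b $ 1 - a $ 1" "b $ 2 - a $ 2" "v $ 1 - a $ 1" "v $ 2 - a $ 2"
        "b' $ 1 - b $ 1" "b' $ 2 - b $ 2" "v' $ 1 - v $ 1" "v' $ 2 - v $ 2"]
      sq_lo[OF lo(1)] sq_lo[OF lo(2)] sq_lo[OF lo(3)] sq_hi[OF hi(1)] sq_hi[OF hi(2)] sq_hi[OF hi(3)]
      sq_hi[OF hi(4)] sq_hi[OF hi(5)] sq_hi[OF hi(6)] sq_near[OF near(1)] sq_near[OF near(2)]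
      sq_far[OF far(1)] sq_far[OF far(2)]
    unfolding dist_square_2 by (simp add: power2_commute algebra_simps)
  then show ?thesis using less by blast
qed

text \<open>\<open>X\<close> and \<open>Y\<close> are the coordinates along and across
  \<open>u\<close>, scaled by its norm, so unit discs get the squared radius \<open>R\<close>. A
  displacement within 1 of \<open>u\<close> has inner product at least |u|^2 - |u| > 0 with
  \<open>u\<close>, which supplies the gaps for \<open>no_alternation_real\<close>.\<close>

lemma no_alternation_plane:
  fixes u a b p q r :: "real ^ 2"
  defines "Y \<equiv> \<lambda>z. u $ 1 * z $ 2 - u $ 2 * z $ 1"
  assumes u: "1 < norm u"
    and near: "dist (q - a) u \<le> 1" "dist (p - b) u \<le> 1" "dist (q - b) u \<le> 1" "dist (r - b) u \<le> 1"
    and ord: "Y p \<le> Y q" "Y q \<le> Y r"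
    and adj: "dist a p \<le> 1" "dist b p > 1" "dist b q \<le> 1" "dist a q > 1" "dist a r \<le> 1" "dist b r > 1"
  shows False
proof -
  define X where "X z = u $ 1 * z $ 1 + u $ 2 * z $ 2" for z :: "real ^ 2"
  define R where "R = (u $ 1)\<^sup>2 + (u $ 2)\<^sup>2"
  have nu: "(norm u)\<^sup>2 = R" using dist_square_2[of u 0] by (simp add: R_def)
  then have R: "R > 0" using u by (metis norm_zero not_one_less_zero zero_less_power2)
  have sq: "(X z - X w)\<^sup>2 + (Y z - Y w)\<^sup>2 = R * (dist w z)\<^sup>2" for z w
    unfolding dist_square_2 X_def Y_def R_def by (simp add: power2_eq_square algebra_simps)
  have gap: "X w \<le> X z" if "dist (z - w) u \<le> 1" for z w
  proof -
    have X: "X z - X w = u \<bullet> (z - w)" by (simp add: X_def inner_vec_def sum_2 algebra_simps)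
    have "u \<bullet> (z - w) = u \<bullet> u + u \<bullet> ((z - w) - u)" by (simp add: inner_diff_right)
    moreover have "\<bar>u \<bullet> ((z - w) - u)\<bar> \<le> norm u * norm ((z - w) - u)" by (rule Cauchy_Schwarz_ineq2)
    moreover have "norm u * norm ((z - w) - u) \<le> norm u * 1" using that by (intro mult_left_mono) (auto simp: dist_norm)
    moreover have "u \<bullet> u \<ge> norm u" 
      using u mult_left_mono[of 1 "norm u" "norm u"] by (simp add: power2_norm_eq_inner[symmetric] power2_eq_square)
    ultimately show ?thesis using X by linarith
  qed
  have le: "(X z - X w)\<^sup>2 + (Y z - Y w)\<^sup>2 \<le> R" if "dist w z \<le> 1" for z w
    unfolding sq using R power_mono[OF that, of 2] by simp
  have gt: "(X z - X w)\<^sup>2 + (Y z - Y w)\<^sup>2 > R" if "dist w z > 1" for z w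
    unfolding sq using R power_strict_mono[OF that, of 2] by simp
  show False
    by (rule no_alternation_real[OF gap[OF near(1)] gap[OF near(2)] gap[OF near(3)] gap[OF near(4)] ord
          le[OF adj(1)] gt[OF adj(2)] le[OF adj(3)] gt[OF adj(4)] le[OF adj(5)] gt[OF adj(6)]])
qed

lemma finite_enumeration_by_key:
  fixes f :: "'a \<Rightarrow> real"
  assumes "finite C"
  obtains idx :: "'a \<Rightarrow> nat" where "inj_on idx C" "\<forall>p\<in>C. \<forall>q\<in>C. idx p < idx q \<longrightarrow> f p \<le> f q"
proof -
  obtain xs where xs: "set xs = C" "distinct xs" using finite_distinct_list[OF assms] by blast
  define ys where "ys = sort_key f xs"
  have ys: "set ys = C" "distinct ys" "sorted (map f ys)" using xs by (auto simp: ys_def)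
  define idx where "idx = inv_into {..<length ys} (nth ys)"
  have im: "nth ys ` {..<length ys} = C" using ys(1) by (auto simp: set_conv_nth)
  have idx: "ys ! idx c = c" "idx c < length ys" if "c \<in> C" for c
    using f_inv_into_f[of c "nth ys" "{..<length ys}"] inv_into_into[of c "nth ys" "{..<length ys}"] that im
    by (auto simp: idx_def)
  show thesis
  proof (rule that)
    show "inj_on idx C" using idx(1) by (metis inj_onI)
    show "\<forall>p\<in>C. \<forall>q\<in>C. idx p < idx q \<longrightarrow> f p \<le> f q"
    proof (intro ballI impI)
      fix p q assume "p \<in> C" "q \<in> C" "idx p < idx q"
      then show "f p \<le> f q" using sorted_nth_mono[OF ys(3), of "idx p" "idx q"] idx by simp
    qed
  qed
qed

text \<open>First \<open>z\<close> is exchanged for \<open>z'\<close>, then \<open>y\<close> for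
  \<open>y'\<close>. The intermediate triangle x, y, z' needs just one new edge, from
  \<open>y\<close> to \<open>z'\<close>.\<close>

lemma (in coloured_graph) rainbow_triangles_connected:
  assumes S: "x \<in> S" "y \<in> S" "z \<in> S" "y' \<in> S" "z' \<in> S"
    and E: "E x y" "E x z" "E y z" "E x y'" "E x z'" "E y' z'" "E y z'"
    and col: "\<kappa> y = \<kappa> y'" "\<kappa> z = \<kappa> z'" "\<kappa> x \<noteq> \<kappa> y" "\<kappa> x \<noteq> \<kappa> z" "\<kappa> y \<noteq> \<kappa> z"
  shows "({x, y, z}, {x, y', z'}) \<in> (rainbow_adj (clique_complex E S) \<kappa> 3)\<^sup>*"
proof -
  let ?G = "clique_complex E S"
  have cG: "complex_on S ?G" by (rule complex_on_clique_complex[OF finS subset_refl])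
  have zz: "E z z'" by (rule common_neighbour[OF S(3,5,1) E(2,5) col(2)])
  have yy: "E y y'" by (rule common_neighbour[OF S(2,4,1) E(1,4) col(1)])
  have "insert z (insert z' {x, y}) \<in> ?G"
    using S E zz reflpD[OF reflE] sympD[OF symE E(1)] sympD[OF symE E(2)] sympD[OF symE E(3)] sympD[OF symE E(5)]
      sympD[OF symE E(7)] sympD[OF symE zz] by (auto simp: clique_complex_def)
  then have "(insert z {x, y}, insert z' {x, y}) \<in> (rainbow_adj ?G \<kappa> 3)\<^sup>*"
    using col by (intro rainbow_adj_insert[OF _ cG]) (auto simp: card_insert_if)
  moreover have "insert y (insert y' {x, z'}) \<in> ?G"
    using S E yy reflpD[OF reflE] sympD[OF symE E(1)] sympD[OF symE E(4)] sympD[OF symE E(5)] sympD[OF symE E(6)]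
      sympD[OF symE E(7)] sympD[OF symE yy] by (auto simp: clique_complex_def)
  then have "(insert y {x, z'}, insert y' {x, z'}) \<in> (rainbow_adj ?G \<kappa> 3)\<^sup>*"
    using col by (intro rainbow_adj_insert[OF _ cG]) (auto simp: card_insert_if)
  moreover have "insert z {x, y} = {x, y, z}" "insert z' {x, y} = insert y {x, z'}" "insert y' {x, z'} = {x, y', z'}"
    by auto
  ultimately show ?thesis by (metis rtrancl_trans)
qed

section \<open>The planar bound for p = 2\<close>

locale planar_colouring =
  fixes \<kappa> :: "real ^ 2 \<Rightarrow> 2 \<Rightarrow> int"
  assumes finite_colours: "finite (range \<kappa>)"
    and grid: "\<And>a c a' c'. \<kappa> a = \<kappa> a' \<Longrightarrow> \<kappa> c = \<kappa> c' \<Longrightarrow> dist a c \<le> 3 \<Longrightarrow> dist a' c' \<le> 3 \<Longrightarrow> dist (c - a) (c' - a') \<le> 1/100"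
begin

lemma same_colour_near:
  assumes "\<kappa> x = \<kappa> y" "dist z x \<le> 1" "dist z y \<le> 1"
  shows "dist x y \<le> 1/100"
proof -
  have "dist x y \<le> 3" using assms(2,3) dist_triangle[of x y z] by (simp add: dist_commute)
  then have "dist (y - x) (x - x) \<le> 1/100" using assms(1) by (intro grid) simp_all
  then show ?thesis by (simp add: dist_norm norm_minus_commute)
qed

lemma rips_coloured_graph:
  assumes "finite S"
  shows "coloured_graph rips_adj \<kappa> S (card (range \<kappa>))"
proof (rule coloured_graph_rips[OF assms finite_colours])
  fix a c a' c' assume "\<kappa> a = \<kappa> a'" "\<kappa> c = \<kappa> c'" "dist a c \<le> 3" "dist a' c' \<le> 3"
  from grid[OF this] show "dist (c - a) (c' - a') \<le> 1" by simp
qed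

lemma betti_le_two_colours_plane:
  assumes S: "finite S" and ij: "i \<noteq> j"
  shows "betti_le TYPE('k::field) S (clique_complex rips_adj {x \<in> S. \<kappa> x \<in> {i, j}}) 3 (2 * card S)"
proof -
  interpret coloured_graph rips_adj \<kappa> S "card (range \<kappa>)" by (rule rips_coloured_graph[OF S])
  let ?A = "{x \<in> S. \<kappa> x = i}" and ?C = "{x \<in> S. \<kappa> x = j}"
  define good where "good u \<longleftrightarrow> (\<exists>a c. \<kappa> a = i \<and> \<kappa> c = j \<and> 1 < dist a c \<and> dist a c \<le> 3 \<and> u = c - a)" for u
  \<comment> \<open>Every displacement of length at most 3 from colour \<open>i\<close> to colour
    \<open>j\<close> agrees with a \<open>good\<close> vector up to 1/100. If there is none,
    \<open>u\<close> is arbitrary, but then no alternation occurs: the non-adjacent \<open>b\<close>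
    and \<open>p\<close> would supply one.\<close>
  define u where "u = (SOME u. good u)"
  have fC: "finite ?C" using S by simp
  define Y where "Y z = u $ 1 * z $ 2 - u $ 2 * z $ 1" for z :: "real ^ 2"
  obtain idx :: "real ^ 2 \<Rightarrow> nat" where idx: "inj_on idx ?C"
    and ord: "\<forall>p\<in>?C. \<forall>q\<in>?C. idx p < idx q \<longrightarrow> Y p \<le> Y q"
    using finite_enumeration_by_key[OF fC, of Y] .
  have "betti_le TYPE('k) S (clique_complex rips_adj (?A \<union> ?C)) 3 (2 * card ?C)"
  proof (rule betti_le_two_colours[OF ij idx])
    fix a b p q r
    assume A: "a \<in> ?A" "b \<in> ?A" and C: "p \<in> ?C" "q \<in> ?C" "r \<in> ?C" and ab: "dist a b \<le> 1"
      and pq: "dist p q \<le> 1" "dist q r \<le> 1" and o: "idx p < idx q" "idx q < idx r"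
      and adj: "dist a p \<le> 1" "\<not> dist b p \<le> 1" "dist b q \<le> 1" "\<not> dist a q \<le> 1" "dist a r \<le> 1" "\<not> dist b r \<le> 1"
    have d: "dist a q \<le> 3" "dist b p \<le> 3" "dist b q \<le> 3" "dist b r \<le> 3"
      using ab adj dist_triangle[of a q b] dist_triangle[of b p a] dist_triangle[of b r a] by (auto simp: dist_commute)
    have "good (p - b)" unfolding good_def using A C d adj by (intro exI[of _ b] exI[of _ p]) auto
    then have "good u" unfolding u_def by (rule someI)
    then obtain a0 c0 where u: "\<kappa> a0 = i" "\<kappa> c0 = j" "1 < dist a0 c0" "dist a0 c0 \<le> 3" "u = c0 - a0"
      unfolding good_def by blast
    have near: "dist (z - w) u \<le> 1" if "w \<in> ?A" "z \<in> ?C" "dist w z \<le> 3" for w z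
      using grid[of w a0 z c0] that u by simp
    have nu: "1 < norm u" using u by (simp add: dist_norm norm_minus_commute)
    note yo = ord[rule_format, OF C(1,2) o(1)] ord[rule_format, OF C(2,3) o(2)]
    show False
      using no_alternation_plane[OF nu near[OF A(1) C(2) d(1)] near[OF A(2) C(1) d(2)] near[OF A(2) C(2) d(3)] near[OF A(2) C(3) d(4)]
          yo[unfolded Y_def] adj(1) _ adj(3) _ adj(5)] adj by simp
  qed
  moreover have "?A \<union> ?C = {x \<in> S. \<kappa> x \<in> {i, j}}" by auto
  moreover have "card ?C \<le> card S" using S by (intro card_mono) auto
  ultimately show ?thesis by (auto intro: betti_le_mono)
qed

text \<open>In each of five subfamilies covering \<open>F\<close> one vertex determines the
  triangle. If an edge has length at most 99/100, moving an end by 1/100 keeps it an edge, so the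
  opposite vertex determines the class. Among the other triangles,
  \<open>opposite_edge_longest\<close> lets \<open>a\<close> determine those where bv is not
  strictly longest, and \<open>b\<close> those where av is shorter than bv.\<close>

lemma card_rainbow_representatives:
  assumes S: "finite S" and F: "F \<subseteq> rainbow (clique_complex rips_adj S) \<kappa> 3"
    "\<And>\<sigma> \<sigma>'. \<sigma> \<in> F \<Longrightarrow> \<sigma>' \<in> F \<Longrightarrow> (\<sigma>, \<sigma>') \<in> (rainbow_adj (clique_complex rips_adj S) \<kappa> 3)\<^sup>* \<Longrightarrow> \<sigma> = \<sigma>'"
    and W: "\<And>\<sigma>. \<sigma> \<in> F \<Longrightarrow> \<kappa> ` \<sigma> = W"
  shows "card F \<le> 5 * card S"
proof (cases "F = {}")
  case False
  interpret coloured_graph rips_adj \<kappa> S "card (range \<kappa>)" by (rule rips_coloured_graph[OF S])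
  have finF: "finite F"
    using F(1) S finite_subset[of F "Pow S"] by (auto simp: rainbow_def clique_complex_def)
  obtain \<sigma> where "\<sigma> \<in> F" using False by blast
  then have "card W = 3" using W[of \<sigma>] F(1) card_image[of \<kappa> \<sigma>] by (auto simp: rainbow_def)
  then obtain i j k where ijk: "W = {i, j, k}" "i \<noteq> j" "i \<noteq> k" "j \<noteq> k" unfolding card_3_iff by auto
  define pt where "pt l \<tau> = (SOME x. x \<in> \<tau> \<and> \<kappa> x = l)" for l \<tau>
  have pt: "pt l \<tau> \<in> \<tau> \<and> \<kappa> (pt l \<tau>) = l" if "\<tau> \<in> F" "l \<in> W" for l \<tau>
  proof -
    have "\<exists>x. x \<in> \<tau> \<and> \<kappa> x = l" using W[OF that(1)] that(2) by auto
    then show ?thesis unfolding pt_def by (rule someI_ex)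
  qed
  define a b v where "a = pt i" and "b = pt j" and "v = pt k"
  have col: "\<kappa> (a \<tau>) = i" "\<kappa> (b \<tau>) = j" "\<kappa> (v \<tau>) = k" and mem: "a \<tau> \<in> \<tau>" "b \<tau> \<in> \<tau>" "v \<tau> \<in> \<tau>" if "\<tau> \<in> F" for \<tau>
    using pt[OF that] by (auto simp: ijk(1) a_def b_def v_def)
  have inS: "x \<in> S" if "\<tau> \<in> F" "x \<in> \<tau>" for x \<tau> using that F(1) by (auto simp: rainbow_def clique_complex_def)
  have adj: "dist x y \<le> 1" if "\<tau> \<in> F" "x \<in> \<tau>" "y \<in> \<tau>" for x y \<tau>
    using that F(1) by (auto simp: rainbow_def clique_complex_def)
  have eq: "\<tau> = {a \<tau>, b \<tau>, v \<tau>}" if "\<tau> \<in> F" for \<tau>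
  proof -
    have "card {a \<tau>, b \<tau>, v \<tau>} = 3" using col[OF that] ijk by (auto simp: card_insert_if)
    moreover have "card \<tau> = 3" using F(1) that by (auto simp: rainbow_def)
    moreover have "{a \<tau>, b \<tau>, v \<tau>} \<subseteq> \<tau>" using mem[OF that] by auto
    moreover from \<open>card \<tau> = 3\<close> have "finite \<tau>" by (simp add: card_ge_0_finite)
    ultimately show ?thesis using card_subset_eq[of \<tau> "{a \<tau>, b \<tau>, v \<tau>}"] by simp
  qed
  \<comment> \<open>Contrapositively, distinct representatives with a common vertex have both cross
    edges longer than 1.\<close>
  have merge: "\<tau> = \<tau>'"
    if \<tau>: "\<tau> \<in> F" "\<tau>' \<in> F" and e: "\<tau> = {x, y, z}" "\<tau>' = {x, y', z'}" and c: "\<kappa> y = \<kappa> y'" "\<kappa> z = \<kappa> z'" "\<kappa> x \<noteq> \<kappa> y" "\<kappa> x \<noteq> \<kappa> z" "\<kappa> y \<noteq> \<kappa> z"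
      and yz: "dist y z' \<le> 1" for \<tau> \<tau>' x y z y' z'
  proof (rule F(2)[OF \<tau>])
    show "(\<tau>, \<tau>') \<in> (rainbow_adj (clique_complex rips_adj S) \<kappa> 3)\<^sup>*"
      unfolding e using inS[OF \<tau>(1)] inS[OF \<tau>(2)] adj[OF \<tau>(1)] adj[OF \<tau>(2)] c yz unfolding e
      by (intro rainbow_triangles_connected) simp_all
  qed
  have mA: "\<tau> = \<tau>'" if \<tau>: "\<tau> \<in> F" "\<tau>' \<in> F" "a \<tau> = a \<tau>'" and or: "dist (b \<tau>) (v \<tau>') \<le> 1 \<or> dist (b \<tau>') (v \<tau>) \<le> 1" for \<tau> \<tau>'
    using or
  proof
    assume "dist (b \<tau>) (v \<tau>') \<le> 1"
    then show ?thesis using eq[OF \<tau>(1)] eq[OF \<tau>(2)] \<tau>(3) col[OF \<tau>(1)] col[OF \<tau>(2)] ijk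
      by (intro merge[of \<tau> \<tau>' "a \<tau>" "b \<tau>" "v \<tau>" "b \<tau>'" "v \<tau>'"] \<tau>(1,2)) simp_all
  next
    assume "dist (b \<tau>') (v \<tau>) \<le> 1"
    then have "\<tau>' = \<tau>" using eq[OF \<tau>(1)] eq[OF \<tau>(2)] \<tau>(3) col[OF \<tau>(1)] col[OF \<tau>(2)] ijk
      by (intro merge[of \<tau>' \<tau> "a \<tau>" "b \<tau>'" "v \<tau>'" "b \<tau>" "v \<tau>"] \<tau>(1,2)) simp_all
    then show ?thesis by simp
  qed
  have mB: "\<tau> = \<tau>'" if \<tau>: "\<tau> \<in> F" "\<tau>' \<in> F" "b \<tau> = b \<tau>'" and or: "dist (a \<tau>) (v \<tau>') \<le> 1 \<or> dist (a \<tau>') (v \<tau>) \<le> 1" for \<tau> \<tau>'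
    using or
  proof
    assume "dist (a \<tau>) (v \<tau>') \<le> 1"
    then show ?thesis using eq[OF \<tau>(1)] eq[OF \<tau>(2)] \<tau>(3) col[OF \<tau>(1)] col[OF \<tau>(2)] ijk
      by (intro merge[of \<tau> \<tau>' "b \<tau>" "a \<tau>" "v \<tau>" "a \<tau>'" "v \<tau>'"] \<tau>(1,2)) (simp_all add: insert_commute)
  next
    assume "dist (a \<tau>') (v \<tau>) \<le> 1"
    then have "\<tau>' = \<tau>" using eq[OF \<tau>(1)] eq[OF \<tau>(2)] \<tau>(3) col[OF \<tau>(1)] col[OF \<tau>(2)] ijk
      by (intro merge[of \<tau>' \<tau> "b \<tau>" "a \<tau>'" "v \<tau>'" "a \<tau>" "v \<tau>"] \<tau>(1,2)) (simp_all add: insert_commute)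
    then show ?thesis by simp
  qed
  have mV: "\<tau> = \<tau>'" if \<tau>: "\<tau> \<in> F" "\<tau>' \<in> F" "v \<tau> = v \<tau>'" and "dist (a \<tau>) (b \<tau>') \<le> 1" for \<tau> \<tau>'
    using that(4) eq[OF \<tau>(1)] eq[OF \<tau>(2)] \<tau>(3) col[OF \<tau>(1)] col[OF \<tau>(2)] ijk
    by (intro merge[of \<tau> \<tau>' "v \<tau>" "a \<tau>" "b \<tau>" "a \<tau>'" "b \<tau>'"] \<tau>(1,2)) (simp_all add: insert_commute)
  have d: "dist (a \<tau>) (b \<tau>) \<le> 1" "dist (a \<tau>) (v \<tau>) \<le> 1" "dist (b \<tau>) (v \<tau>) \<le> 1" if "\<tau> \<in> F" for \<tau>
    using adj[OF that] mem[OF that] by auto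
  have near: "dist x y \<le> 1/100" if "\<tau> \<in> F" "\<tau>' \<in> F" "x \<in> \<tau>" "y \<in> \<tau>'" "z \<in> \<tau>" "z \<in> \<tau>'" "\<kappa> x = \<kappa> y" for x y z \<tau> \<tau>'
    using adj[of \<tau> z x] adj[of \<tau>' z y] that by (intro same_colour_near[of x y z]) auto
  define F1 where "F1 = {\<tau> \<in> F. dist (a \<tau>) (b \<tau>) \<le> 99/100}"
  define F2 where "F2 = {\<tau> \<in> F. dist (b \<tau>) (v \<tau>) \<le> 99/100}"
  define F3 where "F3 = {\<tau> \<in> F. dist (a \<tau>) (v \<tau>) \<le> 99/100}"
  define L where "L = F - F1 - F2 - F3"
  define F4 where "F4 = {\<tau> \<in> L. \<not> (dist (a \<tau>) (b \<tau>) < dist (b \<tau>) (v \<tau>) \<and> dist (a \<tau>) (v \<tau>) < dist (b \<tau>) (v \<tau>))}"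
  define F5 where "F5 = {\<tau> \<in> L. dist (a \<tau>) (v \<tau>) < dist (b \<tau>) (v \<tau>)}"
  have long: "\<tau> \<in> F" "99/100 \<le> dist (a \<tau>) (b \<tau>)" "99/100 \<le> dist (a \<tau>) (v \<tau>)" "99/100 \<le> dist (b \<tau>) (v \<tau>)" if "\<tau> \<in> L" for \<tau>
    using that by (auto simp: L_def F1_def F2_def F3_def)
  have i1: "inj_on v F1"
  proof (rule inj_onI)
    fix \<tau> \<tau>' assume h: "\<tau> \<in> F1" "\<tau>' \<in> F1" "v \<tau> = v \<tau>'"
    then have \<tau>: "\<tau> \<in> F" "\<tau>' \<in> F" "dist (a \<tau>) (b \<tau>) \<le> 99/100" by (auto simp: F1_def)
    have "dist (b \<tau>) (b \<tau>') \<le> 1/100"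
      using mem[OF \<tau>(1)] mem[OF \<tau>(2)] col[OF \<tau>(1)] col[OF \<tau>(2)] h(3) by (intro near[OF \<tau>(1,2), of _ _ "v \<tau>"]) auto
    then have "dist (a \<tau>) (b \<tau>') \<le> 1" using dist_triangle[of "a \<tau>" "b \<tau>'" "b \<tau>"] \<tau>(3) by linarith
    then show "\<tau> = \<tau>'" by (intro mV \<tau>(1,2) h(3))
  qed
  have i2: "inj_on a F2"
  proof (rule inj_onI)
    fix \<tau> \<tau>' assume h: "\<tau> \<in> F2" "\<tau>' \<in> F2" "a \<tau> = a \<tau>'"
    then have \<tau>: "\<tau> \<in> F" "\<tau>' \<in> F" "dist (b \<tau>) (v \<tau>) \<le> 99/100" by (auto simp: F2_def)
    have "dist (v \<tau>) (v \<tau>') \<le> 1/100"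
      using mem[OF \<tau>(1)] mem[OF \<tau>(2)] col[OF \<tau>(1)] col[OF \<tau>(2)] h(3) by (intro near[OF \<tau>(1,2), of _ _ "a \<tau>"]) auto
    then have "dist (b \<tau>) (v \<tau>') \<le> 1" using dist_triangle[of "b \<tau>" "v \<tau>'" "v \<tau>"] \<tau>(3) by linarith
    then show "\<tau> = \<tau>'" by (intro mA \<tau>(1,2) h(3) disjI1)
  qed
  have i3: "inj_on b F3"
  proof (rule inj_onI)
    fix \<tau> \<tau>' assume h: "\<tau> \<in> F3" "\<tau>' \<in> F3" "b \<tau> = b \<tau>'"
    then have \<tau>: "\<tau> \<in> F" "\<tau>' \<in> F" "dist (a \<tau>) (v \<tau>) \<le> 99/100" by (auto simp: F3_def)
    have "dist (v \<tau>) (v \<tau>') \<le> 1/100"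
      using mem[OF \<tau>(1)] mem[OF \<tau>(2)] col[OF \<tau>(1)] col[OF \<tau>(2)] h(3) by (intro near[OF \<tau>(1,2), of _ _ "b \<tau>"]) auto
    then have "dist (a \<tau>) (v \<tau>') \<le> 1" using dist_triangle[of "a \<tau>" "v \<tau>'" "v \<tau>"] \<tau>(3) by linarith
    then show "\<tau> = \<tau>'" by (intro mB \<tau>(1,2) h(3) disjI1)
  qed
  have i4: "inj_on a F4"
  proof (rule inj_onI, rule ccontr)
    fix \<tau> \<tau>' assume h: "\<tau> \<in> F4" "\<tau>' \<in> F4" "a \<tau> = a \<tau>'" "\<tau> \<noteq> \<tau>'"
    then have L: "\<tau> \<in> L" "\<tau>' \<in> L" by (auto simp: F4_def)
    note \<tau> = long(1)[OF L(1)] long(1)[OF L(2)]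
    have far: "1 < dist (b \<tau>) (v \<tau>')" "1 < dist (b \<tau>') (v \<tau>)" using mA[OF \<tau> h(3)] h(4) by (auto simp: not_le)
    have nv: "dist (v \<tau>) (v \<tau>') \<le> 1/100"
      using mem[OF \<tau>(1)] mem[OF \<tau>(2)] col[OF \<tau>(1)] col[OF \<tau>(2)] h(3) by (intro near[OF \<tau>, of _ _ "a \<tau>"]) auto
    have nx: "dist (b \<tau>) (b \<tau>') \<le> 1/100"
      using mem[OF \<tau>(1)] mem[OF \<tau>(2)] col[OF \<tau>(1)] col[OF \<tau>(2)] h(3) by (intro near[OF \<tau>, of _ _ "a \<tau>"]) auto
    from opposite_edge_longest[OF long(2-4)[OF L(1)] d[OF \<tau>(1)] d[OF \<tau>(2), folded h(3)] nx nv far]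
    show False using h by (auto simp: F4_def)
  qed
  have i5: "inj_on b F5"
  proof (rule inj_onI, rule ccontr)
    fix \<tau> \<tau>' assume h: "\<tau> \<in> F5" "\<tau>' \<in> F5" "b \<tau> = b \<tau>'" "\<tau> \<noteq> \<tau>'"
    then have L: "\<tau> \<in> L" "\<tau>' \<in> L" by (auto simp: F5_def)
    note \<tau> = long(1)[OF L(1)] long(1)[OF L(2)]
    have far: "1 < dist (a \<tau>) (v \<tau>')" "1 < dist (a \<tau>') (v \<tau>)" using mB[OF \<tau> h(3)] h(4) by (auto simp: not_le)
    have nv: "dist (v \<tau>) (v \<tau>') \<le> 1/100"
      using mem[OF \<tau>(1)] mem[OF \<tau>(2)] col[OF \<tau>(1)] col[OF \<tau>(2)] h(3) by (intro near[OF \<tau>, of _ _ "b \<tau>"]) auto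
    have nx: "dist (a \<tau>) (a \<tau>') \<le> 1/100"
      using mem[OF \<tau>(1)] mem[OF \<tau>(2)] col[OF \<tau>(1)] col[OF \<tau>(2)] h(3) by (intro near[OF \<tau>, of _ _ "b \<tau>"]) auto
    have "(dist (b \<tau>) (a \<tau>) < dist (a \<tau>) (v \<tau>) \<and> dist (b \<tau>) (v \<tau>) < dist (a \<tau>) (v \<tau>)) \<or>
        (dist (b \<tau>) (a \<tau>') < dist (a \<tau>') (v \<tau>') \<and> dist (b \<tau>) (v \<tau>') < dist (a \<tau>') (v \<tau>'))"
      using long[OF L(1)] long[OF L(2)] d[OF \<tau>(1)] d[OF \<tau>(2)] h(3) far nx nv
      by (intro opposite_edge_longest) (simp_all add: dist_commute)
    then show False using h by (auto simp: F5_def)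
  qed
  have le: "card G \<le> card S" if "inj_on f G" "G \<subseteq> F" "\<And>\<tau>. \<tau> \<in> G \<Longrightarrow> f \<tau> \<in> \<tau>" for G and f :: "_ \<Rightarrow> real ^ 2"
    using that S inS by (intro card_inj_on_le[of f]) auto
  have sub: "F1 \<subseteq> F" "F2 \<subseteq> F" "F3 \<subseteq> F" "F4 \<subseteq> F" "F5 \<subseteq> F" by (auto simp: F1_def F2_def F3_def F4_def F5_def L_def)
  have "F \<subseteq> F1 \<union> F2 \<union> F3 \<union> F4 \<union> F5" by (auto simp: L_def F4_def F5_def)
  then have "card F \<le> card (F1 \<union> F2 \<union> F3 \<union> F4 \<union> F5)"
    using sub finF by (intro card_mono) (auto intro: finite_subset)
  also have "\<dots> \<le> card F1 + card F2 + card F3 + card F4 + card F5"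
    by (meson add_mono card_Un_le order_refl order_trans)
  also have "\<dots> \<le> card S + card S + card S + card S + card S"
    using le[OF i1 sub(1)] le[OF i2 sub(2)] le[OF i3 sub(3)] le[OF i4 sub(4)] le[OF i5 sub(5)] mem sub
    by (intro add_mono) blast+
  finally show ?thesis by simp
qed simp

text \<open>The factor 7 is 5 + 2: five from the rainbow triangles of each colour set, two from each
  pair of colours, and both kinds of colour sets number at most
  \<open>2 ^ card (range \<kappa>)\<close>.\<close>

lemma betti_le_3_plane:
  fixes S :: "(real ^ 2) set"
  assumes S: "finite S"
  shows "betti_le TYPE('k::field) S (clique_complex rips_adj S) 3 (7 * 2 ^ card (range \<kappa>) * card S)"
proof -
  interpret coloured_graph rips_adj \<kappa> S "card (range \<kappa>)" by (rule rips_coloured_graph[OF S])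
  let ?K = "card (range \<kappa>)" and ?G = "clique_complex rips_adj S"
  let ?R = "rainbow ?G \<kappa> 3" and ?r = "rainbow_adj ?G \<kappa> 3"
  have cG: "complex_on S ?G" by (rule complex_on_clique_complex[OF S subset_refl])
  have finR: "finite ?R" using S finite_subset[of ?R "Pow S"] by (auto simp: rainbow_def clique_complex_def)
  have rR: "?r \<subseteq> ?R \<times> ?R" unfolding rainbow_adj_def by auto
  obtain F where F: "F \<subseteq> ?R" "\<And>\<tau>. \<tau> \<in> ?R \<Longrightarrow> \<exists>\<sigma>\<in>F. (\<tau>, \<sigma>) \<in> ?r\<^sup>*"
    "\<And>\<sigma> \<sigma>'. \<sigma> \<in> F \<Longrightarrow> \<sigma>' \<in> F \<Longrightarrow> (\<sigma>, \<sigma>') \<in> ?r\<^sup>* \<Longrightarrow> \<sigma> = \<sigma>'"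
    using class_representatives[OF finR sym_rainbow_adj rR, of "\<lambda>_. 0"] by metis
  have finF: "finite F" by (rule finite_subset[OF F(1) finR])
  have "\<sigma> \<subseteq> S" if "\<sigma> \<in> F" for \<sigma>
    using subsetD[OF F(1) that] by (simp add: rainbow_def clique_complex_def)
  then have "\<kappa> ` \<sigma> \<in> Pow (\<kappa> ` S)" if "\<sigma> \<in> F" for \<sigma> using that by (intro PowI image_mono)
  then have "F = (\<Union>W\<in>Pow (\<kappa> ` S). {\<sigma> \<in> F. \<kappa> ` \<sigma> = W})" by blast
  then have "card F \<le> (\<Sum>W\<in>Pow (\<kappa> ` S). card {\<sigma> \<in> F. \<kappa> ` \<sigma> = W})"
    using card_UN_le[of "Pow (\<kappa> ` S)" "\<lambda>W. {\<sigma> \<in> F. \<kappa> ` \<sigma> = W}"] S by simp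
  also have "\<dots> \<le> (\<Sum>W\<in>Pow (\<kappa> ` S). 5 * card S)"
    using F(1,3) by (intro sum_mono card_rainbow_representatives[OF S]) auto
  also have "\<dots> = 2 ^ card (\<kappa> ` S) * (5 * card S)" using S by (simp add: card_Pow)
  also have "\<dots> \<le> 2 ^ ?K * (5 * card S)" using card_colours by (intro mult_right_mono power_increasing) auto
  finally have cF: "card F \<le> 5 * card S * 2 ^ ?K" by (simp add: algebra_simps)
  have "betti_le TYPE('k) S ?G (Suc 2) (card F + 2 * card S * 2 ^ ?K)"
  proof (rule betti_le_rainbow[OF cG _ finF])
    show "betti_le TYPE('k) S {\<sigma> \<in> ?G. card (\<kappa> ` \<sigma>) \<le> 2} (Suc 2) (2 * card S * 2 ^ ?K)"
      using betti_le_two_coloured[OF betti_le_two_colours_plane[OF S]] by simp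
    show "\<exists>\<tau>'\<in>F. (\<tau>, \<tau>') \<in> (rainbow_adj ?G \<kappa> (Suc 2))\<^sup>*" if "\<tau> \<in> rainbow ?G \<kappa> (Suc 2)" for \<tau>
      using F(2)[of \<tau>] that by simp
  qed
  then show ?thesis using cF by (auto intro: betti_le_mono)
qed

end

lemma max_betti_plane:
  assumes "p \<ge> 2"
  shows "\<exists>D::real. \<forall>n. real (max_betti TYPE('k::field) TYPE(2) p n) \<le> D * real n ^ (p - 1)"
proof -
  obtain \<kappa> :: "real ^ 2 \<Rightarrow> 2 \<Rightarrow> int" where \<kappa>: "finite (range \<kappa>)"
    "\<And>a c a' c'. \<kappa> a = \<kappa> a' \<Longrightarrow> \<kappa> c = \<kappa> c' \<Longrightarrow> dist a c \<le> 3 \<Longrightarrow> dist a' c' \<le> 3 \<Longrightarrow> dist (c - a) (c' - a') \<le> 1/100"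
    using grid_colouring[of "1/100", where 'n = 2] by auto
  interpret planar_colouring \<kappa> by (rule planar_colouring.intro[OF \<kappa>])
  \<comment> \<open>The constant arises at p = 2 and stays the same afterwards: each further
    dimension contributes only a factor \<open>n\<close>.\<close>
  define D :: nat where "D = 7 * 2 ^ card (range \<kappa>)"
  have bound: "betti_le TYPE('k) S (clique_complex rips_adj S) (Suc p) (D * n ^ (p - 1))"
    if "finite S" "card S \<le> n" for S :: "(real ^ 2) set" and n
    using assms that
  proof (induction p arbitrary: S rule: dec_induct)
    case base
    have "D * card S \<le> D * n" using base by simp
    then show ?case using betti_le_3_plane[OF base(1), where 'k = 'k] by (auto simp: D_def numeral_3_eq_3 intro: betti_le_mono)
  next
    case (step p)
    have "betti_le TYPE('k) S (clique_complex rips_adj S) (Suc (Suc p)) (D * n ^ (p - 1) * n)"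
      using step.prems by (intro betti_le_rips_Suc[where m = "D * n ^ (p - 1)"] step.IH)
    moreover have "n ^ (p - 1) * n = n ^ (Suc p - 1)" using step.hyps(1) by (cases p) (auto simp: mult.commute)
    ultimately show ?case by (simp add: mult.assoc)
  qed
  have "real (max_betti TYPE('k) TYPE(2) p n) \<le> real D * real n ^ (p - 1)" for n
  proof -
    have "max_betti TYPE('k) TYPE(2) p n \<le> D * n ^ (p - 1)" by (intro max_betti_le bound)
    then have "real (max_betti TYPE('k) TYPE(2) p n) \<le> real (D * n ^ (p - 1))" by (rule of_nat_mono)
    then show ?thesis by simp
  qed
  then show ?thesis by blast
qed

theorem theorem5p1:
  shows "(\<forall>p \<ge> 2. \<forall>\<delta> > (0::real). \<forall>\<^sub>F n in sequentially.
            real (max_betti TYPE('k::field) TYPE('d::finite) p n) < \<delta> * real n ^ p) \<and>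
         (\<forall>p \<ge> 2. \<exists>D::real. \<forall>n.
            real (max_betti TYPE('k) TYPE(2) p n) \<le> D * real n ^ (p - 1))"
  by (intro conjI allI impI max_betti_small_o max_betti_plane)

end
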